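(* Let $\Sigma=\{1,\dots,\mathfrak r\}$ be a finite set, let $(P_n)_{n\ge1}$ be stochastic matrices on $\Sigma$ converging entrywise to a stochastic matrix $P$, let $\pi$ be a probability distribution on $\Sigma$, let $\mathbb P_\pi$ be the law of the nonhomogeneous Markov chain with initial distribution $\pi$ and transition matrices $(P_n)$, let $f:\Sigma\to\mathbb R^d$ ($d\ge1$) and $Z_n=\frac1n\sum_{i=1}^nf(X_i)$. Suppose $\mathbb P_\pi$ satisfies Condition SIE (see context). Let $\Gamma\subset\mathbb R^d$ be any Borel set, with interior $\Gamma^o$. (i) The function $\mathbb J_{\mathcal T_1}$ is a good rate function and $$-\inf_{z\in\Gamma^o}\mathbb J_{\mathcal T_1}(z)\le\liminf_{n\to\infty}\frac1n\log\mathbb P_\pi(Z_n\in\Gamma^o).$$ (ii) If in addition Assumption B or Assumption C (see context) holds, then with the good rate function $\mathbb J_{\mathcal T_0}$, $$-\inf_{z\in\Gamma^o}\mathbb J_{\mathcal T_0}(z)\le\liminf_{n\to\infty}\frac1n\log\mathbb P_\pi(Z_n\in\Gamma^o).$$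
   Context: Conventions: $\pm\infty\cdot0=0$, $\log0=-\infty$, $\inf\varnothing=+\infty$. A good rate function on $\mathbb R^d$ is a lower semicontinuous function $\mathbb R^d\to[0,\infty]$ with compact level sets. Chain: $P=(p(i,j))$, $P_n=(p_n(i,j))$. Under $\mathbb P_\pi$, $X_0\sim\pi$ and $\mathbb P_\pi(X_{n+1}=j\mid X_0,\dots,X_{n-1},X_n=i)=p_{n+1}(i,j)$, $n\ge0$. $\mathbb P_{(k,x)}$ denotes the law of the chain started from $x$ at time $k$, moving from time $m-1$ to $m$ by $P_m$ for $m>k$; $\mathbf X_i^j=\langle X_i,\dots,X_j\rangle$. Decomposition of $P$: let $C_1,\dots,C_{N+M}$ be the communicating classes of $P$ (states $x,y$ are in the same class iff $x=y$ or each is reachable from the other with positive $P$-probability), numbered so that $p(x,y)=0$ for $x\in C_i,y\in C_j,i>j$. Put $P(i)=(p(x,y))_{x,y\in C_i}$. Each $P(i)$ is either the $1\times1$ zero matrix (degenerate transient; the set of such $i$ is $\mathcal D$, $|\mathcal D|=N$) or irreducible; $\mathcal G$ is the set of $i$ with $P(i)$ irreducible (either a nondegenerate transient class or a closed, i.e. stochastic, class), $|\mathcal G|=M\ge1$, $\mathcal G=\{\zeta_1,\dots,\zeta_M\}$. Rate functions: for $i\in\mathcal G$, $\lambda\in\mathbb R^d$, $\rho(C_i,\lambda)$ is the Perron–Frobenius eigenvalue of $(p(x,y)e^{\langle\lambda,f(y)\rangle})_{x,y\in C_i}$ and $\mathbb I_i(x)=\sup_{\lambda\in\mathbb R^d}\{\langle\lambda,x\rangle-\log\rho(C_i,\lambda)\}$.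 Function $\mathbb J_U$: $\mathbb S_M$ is the set of permutations of $\{1,\dots,M\}$, $\Omega_M$ the set of probability vectors in $\mathbb R^M$, $D(M,\mathbf v,z)=\{\mathbf x\in(\mathbb R^d)^M:\sum_{i=1}^Mv_ix_i=z\}$. For $U=\{u(i,j)\}$ with entries in $[-\infty,0]$ for distinct $i,j\in\mathcal G$, $$C_{\mathbf v,U}(\sigma,\mathbf x)=-\sum_{i=1}^{M-1}\Big(\sum_{j=1}^iv_j\Big)u(\zeta_{\sigma(i)},\zeta_{\sigma(i+1)})+\sum_{i=1}^Mv_i\mathbb I_{\zeta_{\sigma(i)}}(x_i)$$ if $M\ge2$, $C_{\mathbf v,U}(\sigma,\mathbf x)=\mathbb I_{\zeta_1}(x_1)$ if $M=1$, and $\mathbb J_U(z)=\inf_{\mathbf v\in\Omega_M}\inf_{\mathbf x\in D(M,\mathbf v,z)}\min_{\sigma\in\mathbb S_M}C_{\mathbf v,U}(\sigma,\mathbf x)$. Cost $\mathcal T_0$: for distinct $1\le i,j\le N+M$, $t(n,(i,j))=\max_{x\in C_i,y\in C_j}p_n(x,y)$, $\tau(i,j)=\liminf_n\frac1n\log t(n,(i,j))$, and $\mathcal T_0(i,j)=\max_{0\le k\le N+M-2}\max_{L_k}\sum_{s=0}^k\tau(l_s,l_{s+1})$, where $L_k=\langle l_0,\dots,l_{k+1}\rangle$ ranges over tuples of distinct indices in $\{1,\dots,N+M\}$ with $l_0=i$, $l_{k+1}=j$. Cost $\mathcal T_1$: let $i,j\in\mathcal G$ be distinct, $y\in C_i$,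 $z\in C_j$. For $0\le k\le N+M-2$ and $L_k=\langle l_0,\dots,l_{k+1}\rangle$ a tuple of distinct indices in $\{1,\dots,N+M\}$ with $l_0=i$, $l_{k+1}=j$, let $Q_k=\langle q_0,\dots,q_{k+1}\rangle$ be integers with $1\le q_0,q_{k+1}\le\mathfrak r$ and, when $k\ge1$, $1\le q_s\le\mathfrak r+1$ for $1\le s\le k$; let $V_k=\langle\mathbf x^0,\dots,\mathbf x^{k+1}\rangle$ where $\mathbf x^s$ is a vector of length $q_s$ with entries in $C_{l_s}$; put $r(u)=\sum_{l=0}^uq_l$. Set $$\underline\gamma^1(n,y,z)=\max_{0\le k\le N+M-2}\max_{L_k}\max_{Q_k}\max_{V_k}\mathbb P_{(n-1,y)}\big(\mathbf X_n^{n+r(k+1)}=\langle\mathbf x^0,\dots,\mathbf x^{k+1},z\rangle\big),$$ where the concatenated vector $\langle\mathbf x^0,\dots,\mathbf x^{k+1},z\rangle$ is of length at most $E_0(N,M)+1$, $E_0(N,M)=(\mathfrak r+1)(M-2)+N+2\mathfrak r$. Then $\underline\gamma^1(n,(i,j))=\inf_{y\in C_i,z\in C_j}\underline\gamma^1(n,y,z)$ and $\mathcal T_1(i,j)=\liminf_n\frac1n\log\underline\gamma^1(n,(i,j))$. Condition SIE: let $n_0\ge1$ be the first index $m$ such that for all $i\in\mathcal G$ and $s,t\in C_i$ with $p(s,t)>0$ one has $p_n(s,t)>0$ for all $n\ge m$. Condition SIE: there is $n_1\ge n_0-1$ with $\mathbb P_\pi(X_{n_1}\in C_i)>0$ for all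 $i\in\mathcal G$. Assumption B: for all distinct $1\le i,j\le N+M$ there exist $a=a(i,j)\in C_i$ and a sequence $b_n=b_n(i,j)\in C_j$ with $\tau(i,j)=\lim_n\frac1n\log p_n(a,b_n)$. Assumption C: for every $i\in\mathcal G$ the matrix $P^*(i)=(p^*(s,t))_{s,t\in C_i}$ is primitive (some power is entrywise positive), where $p^*(s,t)=p(s,t)$ if $p(s,t)>0$; $p^*(s,t)=1$ if $p(s,t)=0$ and $\liminf_n\frac1n\log p_n(s,t)=0$; $p^*(s,t)=0$ otherwise. *)

theory Defs
  imports "HOL-Probability.Probability" "HOL-Combinatorics.Permutations"
begin

definition elog :: "real \<Rightarrow> ereal" where
  "elog a = (if a \<le> 0 then -\<infinity> else ereal (ln a))"

definition log_rate_seq :: "(nat \<Rightarrow> real) \<Rightarrow> nat \<Rightarrow> ereal" where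
  "log_rate_seq a n = ereal (1 / real n) * elog (a n)"

definition log_rate :: "(nat \<Rightarrow> real) \<Rightarrow> ereal" where
  "log_rate a = liminf (log_rate_seq a)"

definition good_rate_function :: "(real ^ 'd \<Rightarrow> ereal) \<Rightarrow> bool" where
  "good_rate_function J \<longleftrightarrow>
     (\<forall>z. 0 \<le> J z) \<and>
     (\<forall>z. J z \<le> Liminf (at z) J) \<and>
     (\<forall>a::real. compact {z. J z \<le> ereal a})"

definition stochastic :: "('s::finite \<Rightarrow> 's \<Rightarrow> real) \<Rightarrow> bool" where
  "stochastic A \<longleftrightarrow> (\<forall>x y. 0 \<le> A x y) \<and> (\<forall>x. (\<Sum>y\<in>UNIV. A x y) = 1)"

text \<open>\<open>block_power B A n\<close> is the \<open>n\<close>-th power of the square matrix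
  \<open>(A x y)\<close> with \<open>x, y \<in> B\<close>.\<close>

primrec block_power :: "'s set \<Rightarrow> ('s \<Rightarrow> 's \<Rightarrow> real) \<Rightarrow> nat \<Rightarrow> 's \<Rightarrow> 's \<Rightarrow> real" where
  "block_power B A 0 x y = (if x = y then 1 else 0)"
| "block_power B A (Suc n) x y = (\<Sum>w\<in>B. A x w * block_power B A n w y)"

definition irreducible_block :: "'s set \<Rightarrow> ('s \<Rightarrow> 's \<Rightarrow> real) \<Rightarrow> bool" where
  "irreducible_block B A \<longleftrightarrow> (\<forall>x\<in>B. \<forall>y\<in>B. \<exists>n\<ge>1. block_power B A n x y > 0)"

definition primitive_block :: "'s set \<Rightarrow> ('s \<Rightarrow> 's \<Rightarrow> real) \<Rightarrow> bool" where
  "primitive_block B A \<longleftrightarrow> (\<exists>n\<ge>1. \<forall>x\<in>B. \<forall>y\<in>B. block_power B A n x y > 0)"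

definition block_eigenvalue :: "'s set \<Rightarrow> ('s \<Rightarrow> 's \<Rightarrow> real) \<Rightarrow> complex \<Rightarrow> bool" where
  "block_eigenvalue B A z \<longleftrightarrow>
     (\<exists>v::'s \<Rightarrow> complex. (\<exists>x\<in>B. v x \<noteq> 0) \<and>
        (\<forall>x\<in>B. (\<Sum>y\<in>B. complex_of_real (A x y) * v y) = z * v x))"

text \<open>The positive real eigenvalue dominating all complex eigenvalues in modulus.  It is clearly
  unique; for a nonnegative irreducible matrix it exists by the Perron--Frobenius theorem.\<close>

definition perron_frobenius :: "'s set \<Rightarrow> ('s \<Rightarrow> 's \<Rightarrow> real) \<Rightarrow> real" where
  "perron_frobenius B A =
     (THE r. 0 < r \<and> block_eigenvalue B A (complex_of_real r) \<and>
             (\<forall>z. block_eigenvalue B A z \<longrightarrow> cmod z \<le> r))"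

text \<open>\<open>Pn (Suc n)\<close> governs the step from time \<open>n\<close> to time \<open>n + 1\<close>;
  the matrix \<open>Pn 0\<close> is irrelevant.\<close>

definition markov_chain ::
  "'w measure \<Rightarrow> (nat \<Rightarrow> 'w \<Rightarrow> 's) \<Rightarrow> 's pmf \<Rightarrow> (nat \<Rightarrow> 's \<Rightarrow> 's \<Rightarrow> real) \<Rightarrow> bool" where
  "markov_chain \<Omega> X \<pi> Pn \<longleftrightarrow>
     prob_space \<Omega> \<and>
     (\<forall>n. X n \<in> measurable \<Omega> (count_space UNIV)) \<and>
     (\<forall>x. \<P>(\<omega> in \<Omega>. X 0 \<omega> = x) = pmf \<pi> x) \<and>
     (\<forall>n w j. \<P>(\<omega> in \<Omega>. \<forall>m\<le>n. X m \<omega> = w m) > 0 \<longrightarrow>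
        \<P>(\<omega> in \<Omega>. X (Suc n) \<omega> = j \<bar> \<forall>m\<le>n. X m \<omega> = w m) = Pn (Suc n) (w n) j)"

text \<open>\<open>path_prob Pn k x ys\<close> is the probability, for the chain started from \<open>x\<close> at time
  \<open>k\<close>, that the states at times \<open>k + 1, k + 2, \<dots>\<close> are the successive entries of \<open>ys\<close>.\<close>

fun path_prob :: "(nat \<Rightarrow> 's \<Rightarrow> 's \<Rightarrow> real) \<Rightarrow> nat \<Rightarrow> 's \<Rightarrow> 's list \<Rightarrow> real" where
  "path_prob Pn k x [] = 1"
| "path_prob Pn k x (y # ys) = Pn (Suc k) x y * path_prob Pn (Suc k) y ys"

definition sample_mean :: "(nat \<Rightarrow> 'w \<Rightarrow> 's) \<Rightarrow> ('s \<Rightarrow> real ^ 'd) \<Rightarrow> nat \<Rightarrow> 'w \<Rightarrow> real ^ 'd" where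
  "sample_mean X f n \<omega> = (1 / real n) *\<^sub>R (\<Sum>i=1..n. f (X i \<omega>))"

definition communicating :: "('s::finite \<Rightarrow> 's \<Rightarrow> real) \<Rightarrow> ('s \<times> 's) set" where
  "communicating P = {(x, y). x = y \<or>
     ((\<exists>n. block_power UNIV P n x y > 0) \<and> (\<exists>n. block_power UNIV P n y x > 0))}"

definition degenerate_indices :: "('s \<Rightarrow> 's \<Rightarrow> real) \<Rightarrow> (nat \<Rightarrow> 's set) \<Rightarrow> nat \<Rightarrow> nat set" where
  "degenerate_indices P C K = {i\<in>{1..K}. \<exists>x. C i = {x} \<and> P x x = 0}"

definition irreducible_indices :: "('s \<Rightarrow> 's \<Rightarrow> real) \<Rightarrow> (nat \<Rightarrow> 's set) \<Rightarrow> nat \<Rightarrow> nat set" where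
  "irreducible_indices P C K = {i\<in>{1..K}. irreducible_block (C i) P}"

definition class_decomposition ::
  "('s::finite \<Rightarrow> 's \<Rightarrow> real) \<Rightarrow> (nat \<Rightarrow> 's set) \<Rightarrow> nat \<Rightarrow> nat \<Rightarrow> (nat \<Rightarrow> nat) \<Rightarrow> bool" where
  "class_decomposition P C N M \<zeta> \<longleftrightarrow>
     bij_betw C {1..N+M} (UNIV // communicating P) \<and>
     (\<forall>i\<in>{1..N+M}. \<forall>j\<in>{1..N+M}. i > j \<longrightarrow> (\<forall>x\<in>C i. \<forall>y\<in>C j. P x y = 0)) \<and>
     card (degenerate_indices P C (N+M)) = N \<and>
     card (irreducible_indices P C (N+M)) = M \<and>
     1 \<le> M \<and>
     bij_betw \<zeta> {1..M} (irreducible_indices P C (N+M))"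

definition block_rate ::
  "('s \<Rightarrow> 's \<Rightarrow> real) \<Rightarrow> ('s \<Rightarrow> real ^ 'd) \<Rightarrow> 's set \<Rightarrow> real ^ 'd \<Rightarrow> ereal" where
  "block_rate P f B x =
     (SUP \<theta>. ereal (\<theta> \<bullet> x - ln (perron_frobenius B (\<lambda>s t. P s t * exp (\<theta> \<bullet> f t)))))"

definition prob_vectors :: "nat \<Rightarrow> (nat \<Rightarrow> real) set" where
  "prob_vectors M = {v. (\<forall>i\<in>{1..M}. 0 \<le> v i) \<and> (\<Sum>i=1..M. v i) = 1}"

definition mean_tuples :: "nat \<Rightarrow> (nat \<Rightarrow> real) \<Rightarrow> real ^ 'd \<Rightarrow> (nat \<Rightarrow> real ^ 'd) set" where
  "mean_tuples M v z = {x. (\<Sum>i=1..M. v i *\<^sub>R x i) = z}"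

text \<open>Here \<open>I i\<close> is the rate function of the \<open>i\<close>-th class and \<open>\<zeta>\<close> enumerates the
  indices of the irreducible classes.\<close>

definition visit_cost ::
  "nat \<Rightarrow> (nat \<Rightarrow> nat) \<Rightarrow> (nat \<Rightarrow> real ^ 'd \<Rightarrow> ereal) \<Rightarrow> (nat \<Rightarrow> nat \<Rightarrow> ereal) \<Rightarrow>
   (nat \<Rightarrow> real) \<Rightarrow> (nat \<Rightarrow> nat) \<Rightarrow> (nat \<Rightarrow> real ^ 'd) \<Rightarrow> ereal" where
  "visit_cost M \<zeta> I u v \<sigma> x =
     (if 2 \<le> M then
        - (\<Sum>i=1..M-1. ereal (\<Sum>j=1..i. v j) * u (\<zeta> (\<sigma> i)) (\<zeta> (\<sigma> (i+1))))
        + (\<Sum>i=1..M. ereal (v i) * I (\<zeta> (\<sigma> i)) (x i))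
      else I (\<zeta> 1) (x 1))"

definition J_fun ::
  "nat \<Rightarrow> (nat \<Rightarrow> nat) \<Rightarrow> (nat \<Rightarrow> real ^ 'd \<Rightarrow> ereal) \<Rightarrow> (nat \<Rightarrow> nat \<Rightarrow> ereal) \<Rightarrow>
   real ^ 'd \<Rightarrow> ereal" where
  "J_fun M \<zeta> I u z =
     (INF v\<in>prob_vectors M. INF x\<in>mean_tuples M v z.
        MIN \<sigma>\<in>{\<sigma>. \<sigma> permutes {1..M}}. visit_cost M \<zeta> I u v \<sigma> x)"

text \<open>The tuples \<open>L\<^sub>k = \<langle>l\<^sub>0, \<dots>, l\<^sub>k\<^sub>+\<^sub>1\<rangle>\<close> are lists of length \<open>k + 2\<close>.\<close>

definition routes :: "nat \<Rightarrow> nat \<Rightarrow> nat \<Rightarrow> nat \<Rightarrow> nat list set" where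
  "routes K i j k =
     {L. length L = k + 2 \<and> distinct L \<and> set L \<subseteq> {1..K} \<and> L ! 0 = i \<and> L ! (k+1) = j}"

definition max_entry ::
  "(nat \<Rightarrow> 's \<Rightarrow> 's \<Rightarrow> real) \<Rightarrow> (nat \<Rightarrow> 's set) \<Rightarrow> nat \<Rightarrow> nat \<Rightarrow> nat \<Rightarrow> real" where
  "max_entry Pn C i j n = (MAX (x, y)\<in>C i \<times> C j. Pn n x y)"

definition tau ::
  "(nat \<Rightarrow> 's \<Rightarrow> 's \<Rightarrow> real) \<Rightarrow> (nat \<Rightarrow> 's set) \<Rightarrow> nat \<Rightarrow> nat \<Rightarrow> ereal" where
  "tau Pn C i j = log_rate (max_entry Pn C i j)"

definition T0_cost ::
  "(nat \<Rightarrow> 's \<Rightarrow> 's \<Rightarrow> real) \<Rightarrow> (nat \<Rightarrow> 's set) \<Rightarrow> nat \<Rightarrow> nat \<Rightarrow> nat \<Rightarrow> nat \<Rightarrow> ereal" where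
  "T0_cost Pn C N M i j =
     (MAX k\<in>{0..N+M-2}. MAX L\<in>routes (N+M) i j k. \<Sum>s=0..k. tau Pn C (L ! s) (L ! (s+1)))"

text \<open>Only meaningful for \<open>M \<ge> 2\<close>, which holds whenever there are two distinct irreducible
  classes to be connected.\<close>

definition E0 :: "nat \<Rightarrow> nat \<Rightarrow> nat \<Rightarrow> nat" where
  "E0 r N M = (r + 1) * (M - 2) + N + 2 * r"

text \<open>The tuples \<open>Q\<^sub>k\<close>.  The bound on the length of the concatenated vector
  \<open>\<langle>x\<^sup>0, \<dots>, x\<^sup>k\<^sup>+\<^sup>1, z\<rangle>\<close>, which depends on \<open>Q\<^sub>k\<close> only, is imposed here.\<close>

definition sojourns :: "nat \<Rightarrow> nat \<Rightarrow> nat \<Rightarrow> nat \<Rightarrow> nat list set" where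
  "sojourns r N M k =
     {Q. length Q = k + 2 \<and> Q ! 0 \<in> {1..r} \<and> Q ! (k+1) \<in> {1..r} \<and>
         (\<forall>s\<in>{1..k}. Q ! s \<in> {1..r+1}) \<and> sum_list Q + 1 \<le> E0 r N M + 1}"

definition route_paths :: "(nat \<Rightarrow> 's set) \<Rightarrow> nat list \<Rightarrow> nat list \<Rightarrow> 's list list set" where
  "route_paths C L Q =
     {V. length V = length L \<and>
         (\<forall>s<length L. length (V ! s) = Q ! s \<and> set (V ! s) \<subseteq> C (L ! s))}"

definition gamma_points ::
  "(nat \<Rightarrow> 's::finite \<Rightarrow> 's \<Rightarrow> real) \<Rightarrow> (nat \<Rightarrow> 's set) \<Rightarrow> nat \<Rightarrow> nat \<Rightarrow> nat \<Rightarrow> nat \<Rightarrow>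
   nat \<Rightarrow> 's \<Rightarrow> 's \<Rightarrow> real" where
  "gamma_points Pn C N M i j n y z =
     (MAX k\<in>{0..N+M-2}. MAX L\<in>routes (N+M) i j k. MAX Q\<in>sojourns CARD('s) N M k.
        MAX V\<in>route_paths C L Q. path_prob Pn (n - 1) y (concat V @ [z]))"

definition gamma_classes ::
  "(nat \<Rightarrow> 's::finite \<Rightarrow> 's \<Rightarrow> real) \<Rightarrow> (nat \<Rightarrow> 's set) \<Rightarrow> nat \<Rightarrow> nat \<Rightarrow> nat \<Rightarrow> nat \<Rightarrow>
   nat \<Rightarrow> real" where
  "gamma_classes Pn C N M i j n = (INF (y, z)\<in>C i \<times> C j. gamma_points Pn C N M i j n y z)"

definition T1_cost ::
  "(nat \<Rightarrow> 's::finite \<Rightarrow> 's \<Rightarrow> real) \<Rightarrow> (nat \<Rightarrow> 's set) \<Rightarrow> nat \<Rightarrow> nat \<Rightarrow> nat \<Rightarrow> nat \<Rightarrow> ereal" where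
  "T1_cost Pn C N M i j = log_rate (gamma_classes Pn C N M i j)"

text \<open>From here on \<open>G\<close> stands for the set of indices of the irreducible classes.\<close>

definition first_positive_index ::
  "(nat \<Rightarrow> 's \<Rightarrow> 's \<Rightarrow> real) \<Rightarrow> ('s \<Rightarrow> 's \<Rightarrow> real) \<Rightarrow> (nat \<Rightarrow> 's set) \<Rightarrow> nat set \<Rightarrow> nat" where
  "first_positive_index Pn P C G =
     (LEAST m. 1 \<le> m \<and>
        (\<forall>i\<in>G. \<forall>s\<in>C i. \<forall>t\<in>C i. P s t > 0 \<longrightarrow> (\<forall>n\<ge>m. Pn n s t > 0)))"

definition condition_SIE ::
  "'w measure \<Rightarrow> (nat \<Rightarrow> 'w \<Rightarrow> 's) \<Rightarrow> (nat \<Rightarrow> 's \<Rightarrow> 's \<Rightarrow> real) \<Rightarrow> ('s \<Rightarrow> 's \<Rightarrow> real) \<Rightarrow>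
   (nat \<Rightarrow> 's set) \<Rightarrow> nat set \<Rightarrow> bool" where
  "condition_SIE \<Omega> X Pn P C G \<longleftrightarrow>
     (\<exists>n1\<ge>first_positive_index Pn P C G - 1. \<forall>i\<in>G. \<P>(\<omega> in \<Omega>. X n1 \<omega> \<in> C i) > 0)"

definition assumption_B ::
  "(nat \<Rightarrow> 's \<Rightarrow> 's \<Rightarrow> real) \<Rightarrow> (nat \<Rightarrow> 's set) \<Rightarrow> nat \<Rightarrow> bool" where
  "assumption_B Pn C K \<longleftrightarrow>
     (\<forall>i\<in>{1..K}. \<forall>j\<in>{1..K}. i \<noteq> j \<longrightarrow>
        (\<exists>a\<in>C i. \<exists>b. (\<forall>n. b n \<in> C j) \<and>
           log_rate_seq (\<lambda>n. Pn n a (b n)) \<longlonglongrightarrow> tau Pn C i j))"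

definition P_star ::
  "(nat \<Rightarrow> 's \<Rightarrow> 's \<Rightarrow> real) \<Rightarrow> ('s \<Rightarrow> 's \<Rightarrow> real) \<Rightarrow> 's \<Rightarrow> 's \<Rightarrow> real" where
  "P_star Pn P s t =
     (if P s t > 0 then P s t
      else if P s t = 0 \<and> log_rate (\<lambda>n. Pn n s t) = 0 then 1
      else 0)"

definition assumption_C ::
  "(nat \<Rightarrow> 's \<Rightarrow> 's \<Rightarrow> real) \<Rightarrow> ('s \<Rightarrow> 's \<Rightarrow> real) \<Rightarrow> (nat \<Rightarrow> 's set) \<Rightarrow> nat set \<Rightarrow> bool" where
  "assumption_C Pn P C G \<longleftrightarrow> (\<forall>i\<in>G. primitive_block (C i) (P_star Pn P))"

end

(* A homogeneous irreducible class is treated by superadditivity: concatenating loops at a base point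
   shows that the triples (length, sum of f, log-weight) of families of loops form an additive
   semigroup, so the closure of the rational cone they generate is a closed convex cone.  If
   (1, x, -I(x)) were not in this cone, a separating functional would give an exponent theta for which
   the Perron-Frobenius eigenvalue is too small.  So there are loops of a fixed length with mean close
   to x whose total weight is almost exp (- length * I(x)); since P_n tends to P, the same loops can be
   repeated at all late times of the nonhomogeneous chain.

   Given a visiting order, proportions v and means x of finite cost, one repeats such loops in the
   successive classes and joins them by connections of bounded length, whose probability at time k is
   about exp (k u(i,j)); as the connection leaving the i-th visited class is used at time about
   n (v_1 + ... + v_i), this has the exponential cost in the definition of J.  Condition SIE allows one
   to start in the first class with v_i > 0.  For T1 the connections exist by definition; for T0 under
   Assumption B or C they are composed from the best one-step jumps between classes.

   Goodness: after setting x_i = 0 where v_i = 0, the pairs (v, x) of finite cost lie in a compact set,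
   on which the cost, a supremum of continuous functions, is lower semicontinuous. *)

theory Submission
  imports Defs "HOL-Real_Asymp.Real_Asymp"
begin

section \<open>Paths and block powers\<close>

text \<open>Estimates carry errors of the form n \<epsilon> + K with \<epsilon> > 0 arbitrary and K
  independent of n. Such errors survive finitely many concatenations and absorb bounded connections,
  rounding to whole loops and the uncontrolled ends of a trajectory. One obstacle is the convention
  0 \<cdot> \<infinity> = 0. A visiting order of finite cost may contain connections of rate
  -\<infinity>, but only before the first class with a positive share: from that class on all
  partial sums of v are positive, so finite cost forces finite rates. As the earlier connections may
  be impossible for the chain, it has to be started directly in that class, whichever it is.
  Likewise x_i is arbitrary where v_i = 0; such a class is crossed without loops. The other obstacle
  is that the best one-step jump between two classes may change its end points with time. Assumption
  B freezes the source; under Assumption C every source is reached in one common number of steps at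
  subexponential cost. The target is then corrected inside its class at no exponential cost.\<close>

lemma path_prob_append:
  "path_prob Q k x (u @ w) = path_prob Q k x u * path_prob Q (k + length u) (last (x # u)) w"
  by (induction u arbitrary: k x) auto

lemma path_prob_nonneg:
  assumes "\<And>n s t. n > k \<Longrightarrow> 0 \<le> Q n s t"
  shows "0 \<le> path_prob Q k x w"
  using assms by (induction w arbitrary: k x) auto

lemma path_prob_homogeneous: "path_prob (\<lambda>_. A) k x w = path_prob (\<lambda>_. A) 0 x w"
  by (induction w arbitrary: k x) (simp, metis path_prob.simps(2))

lemma path_prob_tendsto:
  assumes "\<And>s t. (\<lambda>n. Q n s t) \<longlonglongrightarrow> A s t"
  shows "(\<lambda>k. path_prob Q k x w) \<longlonglongrightarrow> path_prob (\<lambda>_. A) 0 x w"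
proof (induction w arbitrary: x)
  case (Cons y w)
  have "(\<lambda>k. Q (Suc k) x y * path_prob Q (Suc k) y w) \<longlonglongrightarrow> A x y * path_prob (\<lambda>_. A) 0 y w"
    using LIMSEQ_Suc[OF assms[of x y]] LIMSEQ_Suc[OF Cons.IH[of y]] by (rule tendsto_mult)
  then show ?case by (simp add: path_prob_homogeneous[of A "Suc 0"])
qed simp

lemma path_prob_le_1:
  assumes "\<And>n. n > k \<Longrightarrow> stochastic (Q n)"
  shows "path_prob Q k x w \<le> 1"
  using assms
proof (induction w arbitrary: k x)
  case (Cons y w)
  have st: "stochastic (Q (Suc k))" using Cons.prems by simp
  have "Q (Suc k) x y \<le> (\<Sum>y\<in>UNIV. Q (Suc k) x y)"
    using st by (intro member_le_sum) (auto simp: stochastic_def)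
  then have "0 \<le> Q (Suc k) x y" "Q (Suc k) x y \<le> 1" using st by (auto simp: stochastic_def)
  moreover have "path_prob Q (Suc k) y w \<le> 1" using Cons by simp
  moreover have "0 \<le> path_prob Q (Suc k) y w"
    using Cons.prems by (intro path_prob_nonneg) (auto simp: stochastic_def)
  ultimately show ?case by (simp add: mult_le_one)
qed simp

text \<open>Serves the first moves after the time given by Condition SIE, when the entries of
  \<open>Q\<close> inside a class are known to be positive but may still be far from their
  limits.\<close>

lemma path_prob_pos_transfer:
  assumes "\<And>n s t. n > k \<Longrightarrow> s \<in> B \<Longrightarrow> t \<in> B \<Longrightarrow> A s t > 0 \<Longrightarrow> Q n s t > 0"
    and "\<And>s t. 0 \<le> A s t"
    and "x \<in> B" "set w \<subseteq> B" "path_prob (\<lambda>_. A) 0 x w > 0"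
  shows "path_prob Q k x w > 0"
  using assms
proof (induction w arbitrary: k x)
  case (Cons y w)
  have "path_prob (\<lambda>_. A) 0 y w \<ge> 0" "0 \<le> A x y"
    using Cons.prems(2) by (auto intro: path_prob_nonneg)
  then have *: "A x y > 0" "path_prob (\<lambda>_. A) 0 y w > 0"
    using Cons.prems(5) by (auto simp: path_prob_homogeneous[of A "Suc 0"] zero_less_mult_iff)
  have "path_prob Q (Suc k) y w > 0"
    using Cons.prems * by (intro Cons.IH) auto
  then show ?case using Cons.prems * by simp
qed simp

lemma block_power_word:
  assumes "\<And>s t. 0 \<le> A s t" "block_power B A n x y > 0"
  shows "\<exists>w. length w = n \<and> set w \<subseteq> B \<and> last (x # w) = y \<and> path_prob (\<lambda>_. A) 0 x w > 0"
  using assms(2)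
proof (induction n arbitrary: x)
  case 0
  then show ?case by (auto split: if_splits)
next
  case (Suc n)
  have "\<exists>u\<in>B. A x u * block_power B A n u y > 0"
    using Suc.prems sum_nonpos[of B "\<lambda>u. A x u * block_power B A n u y"]
    by (auto simp: not_less[symmetric])
  then obtain u where u: "u \<in> B" "A x u * block_power B A n u y > 0" by blast
  then have *: "A x u > 0" "block_power B A n u y > 0"
    using assms(1)[of x u] by (auto simp: zero_less_mult_iff)
  obtain w where "length w = n" "set w \<subseteq> B" "last (u # w) = y" "path_prob (\<lambda>_. A) 0 u w > 0"
    using Suc.IH[OF *(2)] by blast
  then show ?case
    using u(1) * by (intro exI[of _ "u # w"]) (auto simp: path_prob_homogeneous[of A "Suc 0"])
qed

lemma block_power_nonneg:
  assumes "\<And>s t. 0 \<le> A s t"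
  shows "0 \<le> block_power B A n x y"
  using assms by (induction n arbitrary: x) (auto intro: sum_nonneg)

lemma block_power_pos_mono:
  assumes "finite B" "\<And>s t. 0 \<le> A s t" "\<And>s t. 0 \<le> A' s t"
    "\<And>s t. A s t > 0 \<Longrightarrow> A' s t > 0" "block_power B A n x y > 0"
  shows "block_power B A' n x y > 0"
  using assms(5)
proof (induction n arbitrary: x)
  case (Suc n)
  have "\<exists>u\<in>B. A x u * block_power B A n u y > 0"
    using Suc.prems sum_nonpos[of B "\<lambda>u. A x u * block_power B A n u y"]
    by (auto simp: not_less[symmetric])
  then obtain u where u: "u \<in> B" "A x u * block_power B A n u y > 0" by blast
  then have "A x u > 0" "block_power B A n u y > 0"
    using assms(2)[of x u] by (auto simp: zero_less_mult_iff)
  then have "A' x u * block_power B A' n u y > 0"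
    using assms(4) Suc.IH by simp
  then show ?case
    using u(1) assms(1,3)
    by (auto intro!: sum_pos2[of B u] mult_nonneg_nonneg block_power_nonneg)
qed (auto split: if_splits)

section \<open>Perron--Frobenius pairs\<close>

text \<open>A strictly positive right eigenvector certifies that its eigenvalue is the Perron root.
  Such a pair can be computed with, unlike the definite description in
  \<open>perron_frobenius\<close>.\<close>

definition perron_pair :: "'s set \<Rightarrow> ('s \<Rightarrow> 's \<Rightarrow> real) \<Rightarrow> real \<Rightarrow> ('s \<Rightarrow> real) \<Rightarrow> bool" where
  "perron_pair B A r v \<longleftrightarrow> 0 < r \<and> (\<forall>x\<in>B. 0 < v x) \<and> (\<forall>x\<in>B. (\<Sum>y\<in>B. A x y * v y) = r * v x)"

text \<open>Compare \<open>w\<close> with \<open>v\<close> at a state where the ratio of moduli is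
  maximal, equal to \<open>c\<close>: taking absolute values in the equation for \<open>w\<close>
  there gives |z| c v \<le> r c v.\<close>

lemma perron_pair_dominates:
  assumes pp: "perron_pair B A r v" and "finite B" "\<And>x y. 0 \<le> A x y"
    and ev: "block_eigenvalue B A z"
  shows "cmod z \<le> r"
proof -
  obtain w where w: "\<exists>x\<in>B. w x \<noteq> 0"
    "\<And>x. x \<in> B \<Longrightarrow> (\<Sum>y\<in>B. complex_of_real (A x y) * w y) = z * w x"
    using ev unfolding block_eigenvalue_def by blast
  have "B \<noteq> {}" using w(1) by blast
  define c where "c = Max ((\<lambda>x. cmod (w x) / v x) ` B)"
  have le: "cmod (w x) \<le> c * v x" if "x \<in> B" for x
  proof -
    have "cmod (w x) / v x \<le> c" unfolding c_def using that \<open>finite B\<close> by (intro Max_ge) auto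
    then show ?thesis using pp that by (auto simp: perron_pair_def divide_le_eq)
  qed
  have "c \<in> (\<lambda>x. cmod (w x) / v x) ` B"
    unfolding c_def using \<open>finite B\<close> \<open>B \<noteq> {}\<close> by (intro Max_in) auto
  then obtain x where x: "x \<in> B" "c = cmod (w x) / v x" by blast
  have vx: "0 < v x" using pp x(1) by (auto simp: perron_pair_def)
  obtain y where "y \<in> B" "w y \<noteq> 0" using w(1) by blast
  then have "0 < c * v y" using le[of y] by (smt (verit) zero_less_norm_iff)
  then have c: "0 < c" using pp \<open>y \<in> B\<close> by (auto simp: perron_pair_def zero_less_mult_iff)
  have "cmod z * (c * v x) = cmod (z * w x)" using x vx by (simp add: norm_mult)
  also have "\<dots> \<le> (\<Sum>y\<in>B. A x y * cmod (w y))"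
    unfolding w(2)[OF x(1), symmetric]
    by (rule order_trans[OF norm_sum]) (auto simp: norm_mult assms(3) intro!: sum_mono)
  also have "\<dots> \<le> (\<Sum>y\<in>B. A x y * (c * v y))"
    using le assms(3) by (intro sum_mono mult_left_mono) auto
  also have "\<dots> = c * (\<Sum>y\<in>B. A x y * v y)" by (simp add: sum_distrib_left algebra_simps)
  also have "\<dots> = r * (c * v x)" using pp x(1) by (auto simp: perron_pair_def)
  finally show ?thesis using c vx by (simp add: mult_le_cancel_right)
qed

lemma perron_frobenius_eqI:
  assumes pp: "perron_pair B A r v" and "finite B" "B \<noteq> {}" "\<And>x y. 0 \<le> A x y"
  shows "perron_frobenius B A = r"
proof -
  have ev: "block_eigenvalue B A (complex_of_real r)"
    unfolding block_eigenvalue_def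
  proof (intro exI[of _ "\<lambda>x. complex_of_real (v x)"] conjI ballI)
    show "\<exists>x\<in>B. complex_of_real (v x) \<noteq> 0"
      using pp \<open>B \<noteq> {}\<close> by (force simp: perron_pair_def)
    show "(\<Sum>y\<in>B. complex_of_real (A x y) * complex_of_real (v y)) =
        complex_of_real r * complex_of_real (v x)" if "x \<in> B" for x
      using pp that by (simp add: perron_pair_def flip: of_real_mult of_real_sum)
  qed
  have dom: "cmod z \<le> r" if "block_eigenvalue B A z" for z
    using perron_pair_dominates[OF pp assms(2,4) that] .
  show ?thesis
    unfolding perron_frobenius_def
  proof (rule the_equality)
    show "0 < r \<and> block_eigenvalue B A (complex_of_real r) \<and>
        (\<forall>z. block_eigenvalue B A z \<longrightarrow> cmod z \<le> r)"
      using ev dom pp by (auto simp: perron_pair_def)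
  next
    fix q assume q: "0 < q \<and> block_eigenvalue B A (complex_of_real q) \<and>
        (\<forall>z. block_eigenvalue B A z \<longrightarrow> cmod z \<le> q)"
    show "q = r" using q ev dom[of "complex_of_real q"] pp
      by (force simp: perron_pair_def)
  qed
qed

lemma block_power_eigenvector:
  assumes "\<And>x. x \<in> B \<Longrightarrow> (\<Sum>y\<in>B. A x y * v y) = r * v x" "finite B" "x \<in> B"
  shows "(\<Sum>y\<in>B. block_power B A n x y * v y) = r ^ n * v x"
  using assms(3)
proof (induction n arbitrary: x)
  case 0
  then show ?case using assms(2) by (simp add: if_distrib if_distribR sum.delta cong: if_cong)
next
  case (Suc n)
  have "(\<Sum>y\<in>B. block_power B A (Suc n) x y * v y)
      = (\<Sum>w\<in>B. \<Sum>y\<in>B. A x w * (block_power B A n w y * v y))"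
    by (subst sum.swap) (simp add: sum_distrib_right mult.assoc)
  also have "\<dots> = (\<Sum>w\<in>B. A x w * (r ^ n * v w))"
    using Suc.IH by (simp add: sum_distrib_left[symmetric])
  also have "\<dots> = r ^ n * (\<Sum>w\<in>B. A x w * v w)"
    by (simp add: sum_distrib_left algebra_simps)
  also have "\<dots> = r ^ Suc n * v x" using assms(1)[OF Suc.prems] by simp
  finally show ?case .
qed

text \<open>Brouwer's theorem for v \<mapsto> A v / |A v|, with the l1 norm, on the simplex of
  probability vectors supported in \<open>B\<close>. Irreducibility is used twice: A v never
  vanishes on the simplex, and a fixed point has no zero entry in \<open>B\<close>.\<close>

lemma perron_pair_exists:
  fixes A :: "'s::finite \<Rightarrow> 's \<Rightarrow> real"
  assumes irr: "irreducible_block B A" and "B \<noteq> {}" and nonneg: "\<And>x y. 0 \<le> A x y"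
  shows "\<exists>r v. perron_pair B A r v"
proof -
  define S :: "(real ^ 's) set"
    where "S = {v. (\<forall>i. 0 \<le> v $ i \<and> (i \<notin> B \<longrightarrow> v $ i = 0)) \<and> (\<Sum>i\<in>UNIV. v $ i) = 1}"
  define T :: "real ^ 's \<Rightarrow> real ^ 's"
    where "T v = (\<chi> x. if x \<in> B then \<Sum>y\<in>B. A x y * v $ y else 0)" for v
  define m where "m v = (\<Sum>x\<in>UNIV. T v $ x)" for v
  have S_le: "v $ i \<le> 1" if "v \<in> S" for v i
    using that member_le_sum[of i UNIV "\<lambda>i. v $ i"] by (auto simp: S_def)
  have "bounded S"
    by (rule bounded_subset[OF bounded_cbox[of "0 :: real ^ 's" 1]])
      (auto simp: mem_box_cart S_le, auto simp: S_def)
  moreover have "closed S"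
    unfolding S_def
    by (intro closed_Collect_conj closed_Collect_all closed_Collect_imp closed_Collect_le
        closed_Collect_eq continuous_intros) auto
  ultimately have "compact S" by (simp add: compact_eq_bounded_closed)
  have "convex S"
    unfolding S_def convex_def
    by (auto simp: sum.distrib sum_distrib_left[symmetric])
  obtain b where "b \<in> B" using \<open>B \<noteq> {}\<close> by blast
  then have "axis b 1 \<in> S"
    by (auto simp: S_def axis_def if_distrib cong: if_cong)
  then have "S \<noteq> {}" by blast
  have Tnn: "0 \<le> T v $ x" if "v \<in> S" for v x
    using that nonneg by (auto simp: T_def S_def intro!: sum_nonneg)
  have m_pos: "0 < m v" if v: "v \<in> S" for v
  proof -
    have "\<exists>y. 0 < v $ y"
      using sum_nonpos[of UNIV "\<lambda>i. v $ i"] v by (force simp: S_def not_less[symmetric])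
    then obtain y where y: "0 < v $ y" "y \<in> B" using v by (force simp: S_def)
    \<comment> \<open>Only the last edge of a loop at \<open>y\<close> matters: it enters
      \<open>y\<close> from a state of \<open>B\<close>, and there \<open>T v\<close> is
      positive.\<close>
    obtain n where n: "n \<ge> 1" "block_power B A n y y > 0"
      using irr y(2) by (auto simp: irreducible_block_def)
    obtain w where w: "length w = n" "set w \<subseteq> B" "last (y # w) = y" "path_prob (\<lambda>_. A) 0 y w > 0"
      using block_power_word[OF nonneg n(2)] by blast
    obtain w' where w': "w = w' @ [y]" using w(1,3) n(1)
      by (metis One_nat_def append_butlast_last_id last.simps length_0_conv not_one_le_zero)
    define x where "x = last (y # w')"
    have xB: "x \<in> B" using w(2) w' y(2) by (auto simp: x_def)
    have "path_prob (\<lambda>_. A) 0 y w' * A x y > 0"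
      using w(4) by (simp add: w' path_prob_append x_def)
    moreover have "0 \<le> path_prob (\<lambda>_. A) 0 y w'" using nonneg by (intro path_prob_nonneg) auto
    ultimately have "A x y > 0" using nonneg[of x y] by (auto simp: zero_less_mult_iff)
    then have "0 < (\<Sum>y\<in>B. A x y * v $ y)"
      using v nonneg y by (intro sum_pos2[of B y]) (auto simp: S_def)
    then have "0 < T v $ x" using xB by (simp add: T_def)
    then show ?thesis unfolding m_def using Tnn[OF v] by (intro sum_pos2[of UNIV x]) auto
  qed
  have "continuous_on S (\<lambda>v. (1 / m v) *\<^sub>R T v)"
  proof -
    have cT: "continuous_on S T"
      unfolding T_def
    proof (rule continuous_on_vec_lambda)
      show "continuous_on S (\<lambda>v. if x \<in> B then \<Sum>y\<in>B. A x y * v $ y else 0)" for x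
        by (cases "x \<in> B") (auto intro!: continuous_intros)
    qed
    moreover have "continuous_on S m" unfolding m_def by (intro continuous_intros cT)
    ultimately show ?thesis using m_pos by (intro continuous_intros) force+
  qed
  moreover have "(\<lambda>v. (1 / m v) *\<^sub>R T v) \<in> S \<rightarrow> S"
  proof
    fix v assume v: "v \<in> S"
    have "(\<Sum>i\<in>UNIV. T v $ i / m v) = m v / m v" unfolding m_def by (rule sum_divide_distrib[symmetric])
    then show "(1 / m v) *\<^sub>R T v \<in> S"
      using Tnn[OF v] m_pos[OF v] by (auto simp: S_def T_def)
  qed
  ultimately obtain v where v: "v \<in> S" "(1 / m v) *\<^sub>R T v = v"
    using brouwer[OF \<open>compact S\<close> \<open>convex S\<close> \<open>S \<noteq> {}\<close>] by blast
  have "T v = m v *\<^sub>R v"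
    using m_pos[OF v(1)] arg_cong[OF v(2), of "\<lambda>u. m v *\<^sub>R u"] by simp
  then have ev: "(\<Sum>y\<in>B. A x y * v $ y) = m v * v $ x" if "x \<in> B" for x
  proof -
    have "(\<Sum>y\<in>B. A x y * v $ y) = T v $ x" using that by (simp add: T_def)
    then show ?thesis using \<open>T v = m v *\<^sub>R v\<close> by simp
  qed
  \<comment> \<open>A path from \<open>x\<close> to a state \<open>y\<close> with v y > 0 carries
    positivity back to \<open>x\<close> through the n-fold eigenvalue equation.\<close>
  have "0 < v $ x" if xB: "x \<in> B" for x
  proof -
    have "\<exists>y. 0 < v $ y"
      using sum_nonpos[of UNIV "\<lambda>i. v $ i"] v(1) by (force simp: S_def not_less[symmetric])
    then obtain y where y: "0 < v $ y" "y \<in> B" using v by (force simp: S_def)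
    obtain n where "block_power B A n x y > 0"
      using irr y(2) xB by (auto simp: irreducible_block_def)
    then have "0 < (\<Sum>y\<in>B. block_power B A n x y * v $ y)"
      using v(1) y nonneg
      by (intro sum_pos2[of B y]) (auto simp: S_def intro!: mult_nonneg_nonneg block_power_nonneg)
    also have "\<dots> = m v ^ n * v $ x"
      using block_power_eigenvector[OF ev] that by simp
    finally show ?thesis using m_pos[OF v(1)] by (simp add: zero_less_mult_iff)
  qed
  then have "perron_pair B A (m v) (($) v)"
    using m_pos[OF v(1)] ev by (simp add: perron_pair_def)
  then show ?thesis by blast
qed

lemma tilted_perron_pair:
  fixes P :: "'s::finite \<Rightarrow> 's \<Rightarrow> real" and f :: "'s \<Rightarrow> real ^ 'd"
  assumes irr: "irreducible_block B P" and "B \<noteq> {}" and nonneg: "\<And>x y. 0 \<le> P x y"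
  obtains v where "perron_pair B (\<lambda>s t. P s t * exp (\<theta> \<bullet> f t))
    (perron_frobenius B (\<lambda>s t. P s t * exp (\<theta> \<bullet> f t))) v"
proof -
  have "irreducible_block B (\<lambda>s t. P s t * exp (\<theta> \<bullet> f t))"
    unfolding irreducible_block_def
  proof (intro ballI)
    fix x y assume "x \<in> B" "y \<in> B"
    then obtain n where n: "n \<ge> 1" "block_power B P n x y > 0"
      using irr by (auto simp: irreducible_block_def)
    have "block_power B (\<lambda>s t. P s t * exp (\<theta> \<bullet> f t)) n x y > 0"
      by (rule block_power_pos_mono[of B P]) (use nonneg n in auto)
    then show "\<exists>n\<ge>1. block_power B (\<lambda>s t. P s t * exp (\<theta> \<bullet> f t)) n x y > 0"
      using n(1) by blast
  qed
  then obtain r v where "perron_pair B (\<lambda>s t. P s t * exp (\<theta> \<bullet> f t)) r v"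
    using perron_pair_exists[OF _ \<open>B \<noteq> {}\<close>, of "\<lambda>s t. P s t * exp (\<theta> \<bullet> f t)"] nonneg by auto
  moreover from this have "perron_frobenius B (\<lambda>s t. P s t * exp (\<theta> \<bullet> f t)) = r"
    using \<open>B \<noteq> {}\<close> nonneg by (intro perron_frobenius_eqI) auto
  ultimately show ?thesis using that by blast
qed

text \<open>Evaluating the eigenvalue equation where the eigenvector is maximal bounds the Perron
  root by the largest row sum. The linear bound in \<theta> later confines the finite values of the
  rate function to the ball of radius \<open>F\<close>.\<close>

lemma tilted_perron_bound:
  fixes P :: "'s::finite \<Rightarrow> 's \<Rightarrow> real" and f :: "'s \<Rightarrow> real ^ 'd"
  assumes irr: "irreducible_block B P" and "B \<noteq> {}" and st: "stochastic P"
    and F: "\<And>y. norm (f y) \<le> F"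
  shows "0 < perron_frobenius B (\<lambda>s t. P s t * exp (\<theta> \<bullet> f t))"
    and "ln (perron_frobenius B (\<lambda>s t. P s t * exp (\<theta> \<bullet> f t))) \<le> F * norm \<theta>"
proof -
  define r where "r = perron_frobenius B (\<lambda>s t. P s t * exp (\<theta> \<bullet> f t))"
  have nonneg: "0 \<le> P x y" for x y using st by (simp add: stochastic_def)
  obtain v where v: "perron_pair B (\<lambda>s t. P s t * exp (\<theta> \<bullet> f t)) r v"
    using tilted_perron_pair[OF irr \<open>B \<noteq> {}\<close> nonneg, of \<theta> f] unfolding r_def by blast
  show "0 < perron_frobenius B (\<lambda>s t. P s t * exp (\<theta> \<bullet> f t))"
    using v by (simp add: perron_pair_def r_def[symmetric])
  have "Max (v ` B) \<in> v ` B" using \<open>B \<noteq> {}\<close> by (intro Max_in) auto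
  then obtain x where x: "x \<in> B" "Max (v ` B) = v x" by (metis imageE)
  have le: "v y \<le> v x" if "y \<in> B" for y
    unfolding x(2)[symmetric] using that by (intro Max_ge) auto
  have vx: "0 < v x" using v x by (simp add: perron_pair_def)
  have ef: "exp (\<theta> \<bullet> f y) \<le> exp (F * norm \<theta>)" for y
  proof -
    have "\<theta> \<bullet> f y \<le> norm \<theta> * norm (f y)" by (rule norm_cauchy_schwarz)
    also have "\<dots> \<le> F * norm \<theta>" using F[of y] by (metis mult.commute mult_left_mono norm_ge_zero)
    finally show ?thesis by simp
  qed
  have "r * v x = (\<Sum>y\<in>B. P x y * exp (\<theta> \<bullet> f y) * v y)"
    using v x(1) by (simp add: perron_pair_def)
  also have "\<dots> \<le> (\<Sum>y\<in>B. P x y * exp (F * norm \<theta>) * v x)"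
    using ef le nonneg vx v
    by (intro sum_mono mult_mono mult_nonneg_nonneg) (auto simp: perron_pair_def less_imp_le)
  also have "\<dots> = (\<Sum>y\<in>B. P x y) * (exp (F * norm \<theta>) * v x)"
    by (simp add: sum_distrib_right mult.assoc)
  also have "\<dots> \<le> (\<Sum>y\<in>UNIV. P x y) * (exp (F * norm \<theta>) * v x)"
    using nonneg vx by (intro mult_right_mono sum_mono2) auto
  also have "\<dots> = exp (F * norm \<theta>) * v x" using st by (simp add: stochastic_def)
  finally have "r \<le> exp (F * norm \<theta>)" using vx by simp
  moreover have "0 < r" using v by (simp add: perron_pair_def)
  ultimately show "ln (perron_frobenius B (\<lambda>s t. P s t * exp (\<theta> \<bullet> f t))) \<le> F * norm \<theta>"
    unfolding r_def[symmetric] by (metis exp_gt_zero ln_exp ln_le_cancel_iff)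
qed

section \<open>Loops in an irreducible class\<close>

lemma finite_words [simp]: "finite {w :: 's::finite list. length w = n}"
  using finite_lists_length_eq[of "UNIV :: 's set" n] by simp

lemma finite_words_Collect [simp]: "finite {w :: 's::finite list. length w = n \<and> Q w}"
  by (rule finite_subset[OF _ finite_words[of n]]) auto

lemma sum_words_Suc:
  "(\<Sum>w | length w = Suc n \<and> set w \<subseteq> B. g w)
    = (\<Sum>y\<in>B. \<Sum>w | length w = n \<and> set w \<subseteq> B. g (y # w))"
  for g :: "'s::finite list \<Rightarrow> real"
proof -
  have "(\<Sum>y\<in>B. \<Sum>w | length w = n \<and> set w \<subseteq> B. g (y # w))
      = (\<Sum>(y, w)\<in>B \<times> {w. length w = n \<and> set w \<subseteq> B}. g (y # w))"
    by (rule sum.cartesian_product)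
  also have "\<dots> = (\<Sum>w | length w = Suc n \<and> set w \<subseteq> B. g w)"
    by (rule sum.reindex_bij_witness[of _ "\<lambda>w. (hd w, tl w)" "\<lambda>(y, w). y # w"])
      (auto simp: length_Suc_conv)
  finally show ?thesis by simp
qed

lemma sum_path_prob_eigenvector:
  fixes A :: "'s::finite \<Rightarrow> 's \<Rightarrow> real"
  assumes ev: "\<And>x. x \<in> B \<Longrightarrow> (\<Sum>y\<in>B. A x y * v y) = r * v x" and "x \<in> B"
  shows "(\<Sum>w | length w = n \<and> set w \<subseteq> B. path_prob (\<lambda>_. A) 0 x w * v (last (x # w))) = r ^ n * v x"
  using assms(2)
proof (induction n arbitrary: x)
  case 0
  have "{w. length w = 0 \<and> set w \<subseteq> B} = {[]}" by auto
  then show ?case by simp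
next
  case (Suc n)
  have "(\<Sum>w | length w = Suc n \<and> set w \<subseteq> B. path_prob (\<lambda>_. A) 0 x w * v (last (x # w)))
      = (\<Sum>y\<in>B. A x y * (\<Sum>w | length w = n \<and> set w \<subseteq> B.
          path_prob (\<lambda>_. A) 0 y w * v (last (y # w))))"
    unfolding sum_words_Suc by (simp add: sum_distrib_left mult.assoc path_prob_homogeneous[of A "Suc 0"])
  also have "\<dots> = (\<Sum>y\<in>B. A x y * (r ^ n * v y))"
    by (intro sum.cong refl) (simp only: Suc.IH)
  also have "\<dots> = r ^ n * (\<Sum>y\<in>B. A x y * v y)"
    by (simp add: sum_distrib_left mult_ac)
  finally show ?case using ev[OF Suc.prems] by simp
qed

lemma sum_path_prob_le_1:
  assumes "stochastic P"
  shows "(\<Sum>w | length w = n \<and> Q w. path_prob (\<lambda>_. P) 0 x w) \<le> 1"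
proof -
  have nn: "0 \<le> path_prob (\<lambda>_. P) 0 x w" for w
    using assms by (intro path_prob_nonneg) (auto simp: stochastic_def)
  have "(\<Sum>w | length w = n \<and> Q w. path_prob (\<lambda>_. P) 0 x w)
      \<le> (\<Sum>w | length w = n \<and> set w \<subseteq> UNIV. path_prob (\<lambda>_. P) 0 x w)"
    using nn by (intro sum_mono2) auto
  also have "\<dots> = 1"
    using sum_path_prob_eigenvector[of UNIV P "\<lambda>_. 1" 1 x n] assms by (simp add: stochastic_def)
  finally show ?thesis .
qed

text \<open>The starting state \<open>b\<close> is not an entry of the word. Hence lengths and sums
  add, and weights multiply, when a word ending in \<open>s\<close> is followed by one starting from
  \<open>s\<close>.\<close>

definition words_between ::
  "('s \<Rightarrow> real ^ 'd) \<Rightarrow> 's set \<Rightarrow> 's \<Rightarrow> 's \<Rightarrow> nat \<Rightarrow> real ^ 'd \<Rightarrow> 's list set" where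
  "words_between f B b s n S =
     {w. length w = n \<and> set w \<subseteq> B \<and> last (b # w) = s \<and> sum_list (map f w) = S}"

definition word_weight ::
  "('s \<Rightarrow> 's \<Rightarrow> real) \<Rightarrow> ('s \<Rightarrow> real ^ 'd) \<Rightarrow> 's set \<Rightarrow> 's \<Rightarrow> 's \<Rightarrow> nat \<Rightarrow> real ^ 'd \<Rightarrow> real" where
  "word_weight P f B b s n S = (\<Sum>w\<in>words_between f B b s n S. path_prob (\<lambda>_. P) 0 b w)"

lemma finite_words_between [simp]: "finite (words_between f B b s n S)"
  for f :: "'s::finite \<Rightarrow> real ^ 'd"
  unfolding words_between_def by simp

text \<open>Concatenation is injective because the first factor has the fixed length
  \<open>n\<close>. The resulting superadditivity of log-weights is the source of convexity.\<close>

lemma word_weight_mult_le: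
  fixes P :: "'s::finite \<Rightarrow> 's \<Rightarrow> real" and f :: "'s \<Rightarrow> real ^ 'd"
  assumes nonneg: "\<And>x y. 0 \<le> P x y"
  shows "word_weight P f B b s n S * word_weight P f B s t m S'
    \<le> word_weight P f B b t (n + m) (S + S')"
proof -
  let ?U = "words_between f B b s n S" and ?V = "words_between f B s t m S'"
  have inj: "inj_on (\<lambda>(u, w). u @ w) (?U \<times> ?V)"
    by (auto simp: inj_on_def words_between_def)
  have "word_weight P f B b s n S * word_weight P f B s t m S'
      = (\<Sum>(u, w)\<in>?U \<times> ?V. path_prob (\<lambda>_. P) 0 b u * path_prob (\<lambda>_. P) 0 s w)"
    unfolding word_weight_def by (simp add: sum_product sum.cartesian_product)
  also have "\<dots> = (\<Sum>(u, w)\<in>?U \<times> ?V. path_prob (\<lambda>_. P) 0 b (u @ w))"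
  proof (rule sum.cong[OF refl], clarify)
    fix u w assume "u \<in> ?U" "w \<in> ?V"
    then show "path_prob (\<lambda>_. P) 0 b u * path_prob (\<lambda>_. P) 0 s w = path_prob (\<lambda>_. P) 0 b (u @ w)"
      unfolding path_prob_append by (subst (4) path_prob_homogeneous) (auto simp: words_between_def)
  qed
  also have "\<dots> = (\<Sum>w\<in>(\<lambda>(u, w). u @ w) ` (?U \<times> ?V). path_prob (\<lambda>_. P) 0 b w)"
    using inj by (subst sum.reindex) (auto simp: case_prod_unfold)
  also have "\<dots> \<le> word_weight P f B b t (n + m) (S + S')"
    unfolding word_weight_def
    using nonneg by (intro sum_mono2) (auto simp: words_between_def intro!: path_prob_nonneg split: if_splits)
  finally show ?thesis .
qed

text \<open>The sum depends on a word only through the numbers of occurrences of the states, each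
  between 0 and \<open>n\<close>.\<close>

lemma card_word_sums_le:
  fixes f :: "'s::finite \<Rightarrow> real ^ 'd"
  shows "card ((\<lambda>w. sum_list (map f w)) ` {w. length w = n}) \<le> (n + 1) ^ CARD('s)"
proof -
  have count: "sum_list (map f w) = (\<Sum>s\<in>UNIV. real (count_list w s) *\<^sub>R f s)" for w
  proof (induction w)
    case (Cons y w)
    have "(\<Sum>s\<in>UNIV. real (count_list (y # w) s) *\<^sub>R f s)
        = (\<Sum>s\<in>UNIV. (if s = y then f s else 0) + real (count_list w s) *\<^sub>R f s)"
      by (intro sum.cong) (auto simp: algebra_simps)
    also have "\<dots> = f y + (\<Sum>s\<in>UNIV. real (count_list w s) *\<^sub>R f s)"
      by (simp add: sum.distrib)
    finally show ?case using Cons by simp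
  qed simp
  let ?F = "PiE (UNIV :: 's set) (\<lambda>_. {0..n})"
  have "(\<lambda>w. sum_list (map f w)) ` {w. length w = n} \<subseteq> (\<lambda>c. \<Sum>s\<in>UNIV. real (c s) *\<^sub>R f s) ` ?F"
  proof clarify
    fix w :: "'s list" assume "n = length w"
    then have "count_list w \<in> ?F" by (auto simp: count_le_length)
    then show "sum_list (map f w) \<in> (\<lambda>c. \<Sum>s\<in>UNIV. real (c s) *\<^sub>R f s) ` PiE UNIV (\<lambda>_. {0..length w})"
      using count[of w] \<open>n = length w\<close> by (intro image_eqI[of _ _ "count_list w"]) auto
  qed
  moreover have "finite ?F" by (intro finite_PiE) auto
  ultimately have "card ((\<lambda>w. sum_list (map f w)) ` {w. length w = n}) \<le> card ?F"
    by (meson card_image_le card_mono finite_imageI order_trans)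
  also have "card ?F = (n + 1) ^ CARD('s)" by (simp add: card_PiE)
  finally show ?thesis .
qed

lemma power_le_polynomial_imp_le_1:
  fixes q D :: real
  assumes "\<And>n. q ^ n \<le> D * (real n + 1) ^ R"
  shows "q \<le> 1"
proof (rule ccontr)
  assume "\<not> q \<le> 1"
  then have "1 < q" by simp
  then have "(\<lambda>n. D * (real n + 1) ^ R / q ^ n) \<longlonglongrightarrow> 0" by real_asymp
  then have "eventually (\<lambda>n. D * (real n + 1) ^ R / q ^ n < 1) sequentially"
    by (rule order_tendstoD) simp
  then obtain n where "D * (real n + 1) ^ R / q ^ n < 1"
    by (auto simp: eventually_sequentially)
  then show False using assms[of n] \<open>1 < q\<close> by (simp add: divide_less_eq)
qed

text \<open>Words of length \<open>n\<close> have only polynomially many different sums, so an exponential bound on the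
  weight of the loops with a prescribed sum bounds the growth of the tilted matrix.\<close>

lemma ln_perron_frobenius_le:
  fixes P :: "'s::finite \<Rightarrow> 's \<Rightarrow> real" and f :: "'s \<Rightarrow> real ^ 'd"
  assumes irr: "irreducible_block B P" and "b \<in> B" and nonneg: "\<And>x y. 0 \<le> P x y"
    and bound: "\<And>n S. n \<ge> 1 \<Longrightarrow> word_weight P f B b b n S \<le> exp (- (\<theta> \<bullet> S) - a * real n)"
  shows "ln (perron_frobenius B (\<lambda>s t. P s t * exp (\<theta> \<bullet> f t))) \<le> - a"
proof -
  define A where "A = (\<lambda>s t. P s t * exp (\<theta> \<bullet> f t))"
  define r where "r = perron_frobenius B A"
  have "B \<noteq> {}" using \<open>b \<in> B\<close> by blast
  obtain v where v: "perron_pair B A r v"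
    using tilted_perron_pair[OF irr \<open>B \<noteq> {}\<close> nonneg, of \<theta> f] unfolding r_def A_def by blast
  have tilt: "path_prob (\<lambda>_. A) 0 x w = path_prob (\<lambda>_. P) 0 x w * exp (\<theta> \<bullet> sum_list (map f w))" for x w
    by (induction w arbitrary: x)
      (auto simp: A_def inner_add_right exp_add path_prob_homogeneous[of _ "Suc 0"])
  \<comment> \<open>The hypothesis \<open>bound\<close> speaks of loops only. A return word
    \<open>u s\<close>, chosen once for each end state, closes every path at the price of a constant
    factor \<open>c s\<close>.\<close>
  have "\<forall>s\<in>B. \<exists>u. length u \<ge> 1 \<and> set u \<subseteq> B \<and> last (s # u) = b \<and> path_prob (\<lambda>_. P) 0 s u > 0"
  proof
    fix s assume "s \<in> B"
    then obtain n where "n \<ge> 1" "block_power B P n s b > 0"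
      using irr \<open>b \<in> B\<close> by (auto simp: irreducible_block_def)
    then show "\<exists>u. length u \<ge> 1 \<and> set u \<subseteq> B \<and> last (s # u) = b \<and> path_prob (\<lambda>_. P) 0 s u > 0"
      using block_power_word[of P B n s b] nonneg by auto
  qed
  then obtain u where u: "\<And>s. s \<in> B \<Longrightarrow> length (u s) \<ge> 1 \<and> set (u s) \<subseteq> B \<and> last (s # u s) = b \<and>
      path_prob (\<lambda>_. P) 0 s (u s) > 0"
    by metis
  define c where "c s = path_prob (\<lambda>_. P) 0 s (u s)" for s
  define D where "D s = v s * exp (- (\<theta> \<bullet> sum_list (map f (u s))) - a * real (length (u s))) / c s" for s
  have summand: "exp (\<theta> \<bullet> S) * v s * word_weight P f B b s n S \<le> D s * exp (- a * real n)"
    if "s \<in> B" for s n S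
  proof -
    have "c s \<le> word_weight P f B s b (length (u s)) (sum_list (map f (u s)))"
      unfolding word_weight_def c_def using u[OF that] nonneg
      by (intro member_le_sum) (auto simp: words_between_def intro!: path_prob_nonneg)
    moreover have "0 \<le> word_weight P f B b s n S"
      unfolding word_weight_def using nonneg by (intro sum_nonneg path_prob_nonneg) auto
    ultimately have "word_weight P f B b s n S * c s
        \<le> word_weight P f B b s n S * word_weight P f B s b (length (u s)) (sum_list (map f (u s)))"
      by (rule mult_left_mono)
    also have "\<dots> \<le> word_weight P f B b b (n + length (u s)) (S + sum_list (map f (u s)))"
      by (rule word_weight_mult_le[OF nonneg])
    also have "\<dots> \<le> exp (- (\<theta> \<bullet> (S + sum_list (map f (u s)))) - a * real (n + length (u s)))"
      using u[OF that] by (intro bound) auto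
    finally have "word_weight P f B b s n S
        \<le> exp (- (\<theta> \<bullet> (S + sum_list (map f (u s)))) - a * real (n + length (u s))) / c s"
      using u[OF that] by (simp add: pos_le_divide_eq c_def)
    moreover have "0 \<le> exp (\<theta> \<bullet> S) * v s"
      using v that by (simp add: perron_pair_def less_imp_le)
    ultimately have "exp (\<theta> \<bullet> S) * v s * word_weight P f B b s n S \<le> exp (\<theta> \<bullet> S) * v s *
        (exp (- (\<theta> \<bullet> (S + sum_list (map f (u s)))) - a * real (n + length (u s))) / c s)"
      by (rule mult_left_mono)
    also have "\<dots> = D s * exp (- a * real n)"
      by (simp add: D_def inner_add_right exp_add exp_diff exp_minus field_simps)
    finally show ?thesis .
  qed
  have growth: "r ^ n * v b \<le> (real n + 1) ^ CARD('s) * (\<Sum>s\<in>B. D s) * exp (- a * real n)" for n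
  proof -
    let ?S = "(\<lambda>w. sum_list (map f w)) ` {w. length w = n}"
    have fS: "finite ?S" by simp
    \<comment> \<open>For a fixed end state and sum, both the tilting factor and the eigenvector
      entry are constant, so the group contributes a multiple of one
      \<open>word_weight\<close>.\<close>
    have group: "(\<Sum>w | w \<in> {w. length w = n \<and> set w \<subseteq> B} \<and>
          (last (b # w), sum_list (map f w)) = (s, S). path_prob (\<lambda>_. A) 0 b w * v (last (b # w)))
          = exp (\<theta> \<bullet> S) * v s * word_weight P f B b s n S" for s S
    proof -
      have *: "{w. w \<in> {w. length w = n \<and> set w \<subseteq> B} \<and> (last (b # w), sum_list (map f w)) = (s, S)}
          = words_between f B b s n S"
        by (auto simp: words_between_def)
      show ?thesis
        unfolding * word_weight_def sum_distrib_left
        by (rule sum.cong) (auto simp: words_between_def tilt)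
    qed
    have "r ^ n * v b
        = (\<Sum>w | length w = n \<and> set w \<subseteq> B. path_prob (\<lambda>_. A) 0 b w * v (last (b # w)))"
      using v \<open>b \<in> B\<close> by (subst sum_path_prob_eigenvector) (auto simp: perron_pair_def)
    also have "\<dots> = (\<Sum>(s, S)\<in>B \<times> ?S. \<Sum>w | w \<in> {w. length w = n \<and> set w \<subseteq> B} \<and>
        (last (b # w), sum_list (map f w)) = (s, S). path_prob (\<lambda>_. A) 0 b w * v (last (b # w)))"
    proof -
      have "(\<lambda>w. (last (b # w), sum_list (map f w))) ` {w. length w = n \<and> set w \<subseteq> B} \<subseteq> B \<times> ?S"
        using \<open>b \<in> B\<close> last_in_set by fastforce
      note grp = sum.group[OF _ _ this, of "\<lambda>w. path_prob (\<lambda>_. A) 0 b w * v (last (b # w))", symmetric]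
      have "finite {w. length w = n \<and> set w \<subseteq> B}" "finite (B \<times> ?S)" using fS by auto
      from grp[OF this] show ?thesis unfolding case_prod_unfold prod.collapse .
    qed
    also have "\<dots> = (\<Sum>(s, S)\<in>B \<times> ?S. exp (\<theta> \<bullet> S) * v s * word_weight P f B b s n S)"
      by (simp only: group)
    also have "\<dots> \<le> (\<Sum>(s, S)\<in>B \<times> ?S. D s * exp (- a * real n))"
      using summand by (intro sum_mono) auto
    also have "\<dots> = (\<Sum>s\<in>B. \<Sum>S\<in>?S. D s * exp (- a * real n))"
      by (rule sum.cartesian_product[symmetric])
    also have "\<dots> = real (card ?S) * ((\<Sum>s\<in>B. D s) * exp (- a * real n))"
      by (simp add: sum_distrib_right sum_distrib_left)
    also have "\<dots> \<le> real ((n + 1) ^ CARD('s)) * ((\<Sum>s\<in>B. D s) * exp (- a * real n))"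
    proof (rule mult_right_mono)
      show "real (card ?S) \<le> real ((n + 1) ^ CARD('s))"
        using card_word_sums_le[of f n] by (rule of_nat_mono)
      have "0 \<le> D s" if "s \<in> B" for s
        using u[OF that] v that by (auto simp: D_def c_def perron_pair_def less_imp_le)
      then show "0 \<le> (\<Sum>s\<in>B. D s) * exp (- a * real n)" by (simp add: sum_nonneg)
    qed
    finally show ?thesis by (simp add: mult.assoc add.commute)
  qed
  have r: "0 < r" and vb: "0 < v b" using v \<open>b \<in> B\<close> by (auto simp: perron_pair_def)
  have "r * exp a \<le> 1"
  proof (rule power_le_polynomial_imp_le_1)
    fix n
    have "(r * exp a) ^ n * v b = r ^ n * v b * exp (a * real n)"
      by (simp add: power_mult_distrib exp_of_nat_mult[symmetric] mult.commute)
    also have "\<dots> \<le> (real n + 1) ^ CARD('s) * (\<Sum>s\<in>B. D s) * exp (- a * real n) * exp (a * real n)"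
      by (intro mult_right_mono growth) simp
    also have "\<dots> = (real n + 1) ^ CARD('s) * (\<Sum>s\<in>B. D s)"
      by (simp add: mult.assoc exp_add[symmetric])
    finally show "(r * exp a) ^ n \<le> ((\<Sum>s\<in>B. D s) / v b) * (real n + 1) ^ CARD('s)"
      using vb by (simp add: field_simps)
  qed
  then have "r \<le> exp (- a)" by (simp add: exp_minus field_simps)
  then show ?thesis using r unfolding r_def A_def by (metis exp_gt_zero ln_exp ln_le_cancel_iff)
qed

text \<open>Clearing denominators shows that the rational cone is closed under addition and positive
  rational multiples. Passing to limits gives sums and nonnegative real multiples in the
  closure.\<close>

lemma convex_closure_rational_cone:
  fixes \<Lambda> :: "'a::euclidean_space set"
  assumes add: "\<And>p q. p \<in> \<Lambda> \<Longrightarrow> q \<in> \<Lambda> \<Longrightarrow> p + q \<in> \<Lambda>"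
  shows "convex (closure {q. \<exists>k\<ge>1. real k *\<^sub>R q \<in> \<Lambda>})"
proof -
  define R where "R = {q. \<exists>k\<ge>1. real k *\<^sub>R q \<in> \<Lambda>}"
  have mult: "real n *\<^sub>R p \<in> \<Lambda>" if "p \<in> \<Lambda>" "n \<ge> 1" for p n
    using that(2)
  proof (induction n rule: dec_induct)
    case (step n)
    then show ?case using add[OF that(1) step.IH] by (simp add: algebra_simps)
  qed (use that(1) in simp)
  have R_add: "p + q \<in> R" if pq: "p \<in> R" "q \<in> R" for p q
  proof -
    obtain k l where kl: "k \<ge> 1" "l \<ge> 1" "real k *\<^sub>R p \<in> \<Lambda>" "real l *\<^sub>R q \<in> \<Lambda>"
      using pq by (auto simp: R_def)
    have "real l *\<^sub>R (real k *\<^sub>R p) + real k *\<^sub>R (real l *\<^sub>R q) \<in> \<Lambda>"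
      using kl by (intro add mult[OF kl(3)] mult[OF kl(4)]) auto
    then have "real (k * l) *\<^sub>R (p + q) \<in> \<Lambda>" by (simp add: algebra_simps)
    then show ?thesis using kl unfolding R_def by (intro CollectI exI[of _ "k * l"]) auto
  qed
  have R_scale: "(real m / real l) *\<^sub>R q \<in> R" if q: "q \<in> R" and "m \<ge> 1" "l \<ge> 1" for m l q
  proof -
    obtain k where k: "k \<ge> 1" "real k *\<^sub>R q \<in> \<Lambda>" using q by (auto simp: R_def)
    have "real (k * l) *\<^sub>R ((real m / real l) *\<^sub>R q) = real m *\<^sub>R (real k *\<^sub>R q)"
      using \<open>l \<ge> 1\<close> by simp
    then have "real (k * l) *\<^sub>R ((real m / real l) *\<^sub>R q) \<in> \<Lambda>" using mult[OF k(2) \<open>m \<ge> 1\<close>] by metis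
    then show ?thesis using k \<open>l \<ge> 1\<close> unfolding R_def by (intro CollectI exI[of _ "k * l"]) auto
  qed
  have cl_add: "p + q \<in> closure R" if p: "p \<in> closure R" and q: "q \<in> closure R" for p q
  proof -
    obtain x where "\<forall>n. x n \<in> R" "x \<longlonglongrightarrow> p" using p unfolding closure_sequential by blast
    moreover obtain y where "\<forall>n. y n \<in> R" "y \<longlonglongrightarrow> q" using q unfolding closure_sequential by blast
    ultimately show ?thesis
      unfolding closure_sequential using R_add by (intro exI[of _ "\<lambda>n. x n + y n"]) (auto intro: tendsto_add)
  qed
  have R_cl: "c *\<^sub>R q \<in> closure R" if q: "q \<in> R" and "c \<ge> 0" for c q
  proof -
    \<comment> \<open>The added 1 keeps the numerators positive, as \<open>R_scale\<close> demands,
      so that c = 0 is covered as well.\<close>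
    have "(\<lambda>n. real (nat \<lfloor>real n * c\<rfloor> + 1) / real (n + 1)) \<longlonglongrightarrow> c"
    proof (rule tendsto_sandwich)
      show "eventually (\<lambda>n. real n * c / real (n + 1) \<le> real (nat \<lfloor>real n * c\<rfloor> + 1) / real (n + 1)) sequentially"
        using \<open>c \<ge> 0\<close> by (intro always_eventually allI divide_right_mono) (simp_all, linarith)
      show "eventually (\<lambda>n. real (nat \<lfloor>real n * c\<rfloor> + 1) / real (n + 1) \<le> (real n * c + 1) / real (n + 1)) sequentially"
        using \<open>c \<ge> 0\<close> by (intro always_eventually allI divide_right_mono) simp_all
      show "(\<lambda>n. real n * c / real (n + 1)) \<longlonglongrightarrow> c" by real_asymp
      show "(\<lambda>n. (real n * c + 1) / real (n + 1)) \<longlonglongrightarrow> c" by real_asymp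
    qed
    then have "(\<lambda>n. (real (nat \<lfloor>real n * c\<rfloor> + 1) / real (n + 1)) *\<^sub>R q) \<longlonglongrightarrow> c *\<^sub>R q"
      by (intro tendsto_intros)
    moreover have "(real (nat \<lfloor>real n * c\<rfloor> + 1) / real (n + 1)) *\<^sub>R q \<in> R" for n
      using q by (rule R_scale) simp_all
    ultimately show ?thesis
      unfolding closure_sequential
      by (intro exI[of _ "\<lambda>n. (real (nat \<lfloor>real n * c\<rfloor> + 1) / real (n + 1)) *\<^sub>R q"]) blast
  qed
  have cl_scale: "c *\<^sub>R q \<in> closure R" if "q \<in> closure R" "c \<ge> 0" for c q
  proof -
    obtain x where "\<And>n. x n \<in> R" "x \<longlonglongrightarrow> q" using \<open>q \<in> closure R\<close> unfolding closure_sequential by blast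
    then have "\<forall>n. c *\<^sub>R x n \<in> closure R" "(\<lambda>n. c *\<^sub>R x n) \<longlonglongrightarrow> c *\<^sub>R q"
      using R_cl \<open>c \<ge> 0\<close> by (auto intro: tendsto_intros)
    then show ?thesis using closed_closure[of R] by (meson closed_sequentially)
  qed
  show ?thesis
    unfolding R_def[symmetric] convex_def using cl_add cl_scale by blast
qed

text \<open>If \<open>(1, x, - \<iota>)\<close> were separated from the closed convex cone generated by the triples
  (length, sum, log-weight) of loops, the separating functional could be normalised to have last
  coefficient \<open>1\<close>, because log-weights are nonpositive; then \<open>\<theta> \<bullet> x - ln \<rho>(\<theta>) > \<iota>\<close> for some \<open>\<theta>\<close>.\<close>

lemma loops_near_point:
  fixes P :: "'s::finite \<Rightarrow> 's \<Rightarrow> real" and f :: "'s \<Rightarrow> real ^ 'd"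
  assumes irr: "irreducible_block B P" and "b \<in> B" and st: "stochastic P"
    and rate: "\<And>\<theta>. \<theta> \<bullet> x - ln (perron_frobenius B (\<lambda>s t. P s t * exp (\<theta> \<bullet> f t))) \<le> \<iota>"
    and "\<epsilon> > 0"
  shows "\<exists>n S. n \<ge> 1 \<and> norm (S - real n *\<^sub>R x) \<le> real n * \<epsilon> \<and>
    exp (- (real n * (\<iota> + \<epsilon>))) \<le> word_weight P f B b b n S"
proof -
  have nonneg: "0 \<le> P x y" for x y using st by (simp add: stochastic_def)
  define L where "L = word_weight P f B b b"
  \<comment> \<open>The last component may be any number below the log-weight. This keeps the set
    additive under mere superadditivity and will force the last coefficient of the separating
    functional to have the right sign.\<close>
  define \<Lambda> where "\<Lambda> = {(real n, S, t) | n S t. n \<ge> 1 \<and> 0 < L n S \<and> t \<le> ln (L n S)}"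
  define R where "R = {q. \<exists>k\<ge>1. real k *\<^sub>R q \<in> \<Lambda>}"
  define z where "z = (1 :: real, x, - \<iota>)"
  have L_add: "L n S * L m S' \<le> L (n + m) (S + S')" for n m S S'
    unfolding L_def by (rule word_weight_mult_le[OF nonneg])
  have L_nonneg: "0 \<le> L n S" for n S
    unfolding L_def word_weight_def by (intro sum_nonneg path_prob_nonneg nonneg)
  have L_le_1: "L n S \<le> 1" for n S
    unfolding L_def word_weight_def words_between_def by (rule sum_path_prob_le_1[OF st])
  have \<Lambda>_add: "p + q \<in> \<Lambda>" if p: "p \<in> \<Lambda>" and q: "q \<in> \<Lambda>" for p q
  proof -
    obtain n S t where p: "p = (real n, S, t)" "n \<ge> 1" "0 < L n S" "t \<le> ln (L n S)"
      using p by (auto simp: \<Lambda>_def)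
    obtain m S' t' where q: "q = (real m, S', t')" "m \<ge> 1" "0 < L m S'" "t' \<le> ln (L m S')"
      using q by (auto simp: \<Lambda>_def)
    have pos: "0 < L n S * L m S'" using p q by simp
    then have "ln (L n S * L m S') \<le> ln (L (n + m) (S + S'))" "0 < L (n + m) (S + S')"
      using L_add[of n S m S'] by auto
    moreover have "ln (L n S * L m S') = ln (L n S) + ln (L m S')" using p q by (simp add: ln_mult)
    ultimately have "n + m \<ge> 1 \<and> 0 < L (n + m) (S + S') \<and> t + t' \<le> ln (L (n + m) (S + S'))"
      using p q by linarith
    then show ?thesis unfolding \<Lambda>_def p(1) q(1) by (force simp: of_nat_add[symmetric] simp del: of_nat_add)
  qed
  have conv: "convex (closure R)"
    unfolding R_def by (rule convex_closure_rational_cone) (rule \<Lambda>_add)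
  have "z \<in> closure R"
  proof (rule ccontr)
    assume "z \<notin> closure R"
    then obtain w d where wd: "inner w z < d" "\<And>q. q \<in> closure R \<Longrightarrow> inner w q > d"
      using separating_hyperplane_closed_point[OF conv closed_closure] by blast
    \<comment> \<open>A functional bounded below on all positive integer multiples of
      \<open>p\<close> is nonnegative at \<open>p\<close>.\<close>
    have w\<Lambda>: "0 \<le> inner w p" if p: "p \<in> \<Lambda>" for p
    proof (rule ccontr)
      assume neg: "\<not> 0 \<le> inner w p"
      have mult: "real (Suc n) *\<^sub>R p \<in> \<Lambda>" for n
      proof (induction n)
        case (Suc n)
        have "real (Suc (Suc n)) *\<^sub>R p = p + real (Suc n) *\<^sub>R p"
          by (subst of_nat_Suc) (simp only: scaleR_add_left scaleR_one)
        then show ?case using \<Lambda>_add[OF p Suc] by simp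
      qed (use p in simp)
      obtain n where "real n * (- inner w p) > - d"
        using neg reals_Archimedean3[of "- inner w p"] by (meson not_le neg_0_less_iff_less)
      moreover have "real (Suc n) *\<^sub>R p \<in> R"
        using mult[of n] unfolding R_def by (intro CollectI exI[of _ 1]) simp
      then have "inner w (real (Suc n) *\<^sub>R p) > d" using wd(2) closure_subset by blast
      then have "real n * inner w p + inner w p > d" by (simp add: algebra_simps)
      ultimately show False using neg by simp
    qed
    obtain n0 S0 where n0: "n0 \<ge> 1" "0 < L n0 S0"
    proof -
      obtain n where n: "n \<ge> 1" "block_power B P n b b > 0"
        using irr \<open>b \<in> B\<close> by (auto simp: irreducible_block_def)
      then obtain u where u: "length u = n" "set u \<subseteq> B" "last (b # u) = b" "path_prob (\<lambda>_. P) 0 b u > 0"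
        using block_power_word[of P B n b b] nonneg by auto
      have "0 < L n (sum_list (map f u))"
        unfolding L_def word_weight_def using u nonneg
        by (intro sum_pos2[of _ u]) (auto simp: words_between_def intro!: path_prob_nonneg)
      then show ?thesis using n(1) that by blast
    qed
    have wz: "inner w z < 0"
    proof -
      define p where "p = (real n0, S0, ln (L n0 S0))"
      have p: "p \<in> \<Lambda>" using n0 by (auto simp: \<Lambda>_def p_def)
      \<comment> \<open>The points \<open>p / k\<close> lie in the cone and tend to 0, so the
        separating level cannot be positive.\<close>
      have "d \<le> 0"
      proof (rule field_le_epsilon)
        fix e :: real assume "e > 0"
        obtain k :: nat where k: "inner w p / e < real k" using reals_Archimedean2 by blast
        have "(1 / real (Suc k)) *\<^sub>R p \<in> R"
          unfolding R_def using p by (intro CollectI exI[of _ "Suc k"]) (simp only: scaleR_scaleR, simp)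
        then have "d < inner w ((1 / real (Suc k)) *\<^sub>R p)" using wd(2) closure_subset by blast
        then have "d < inner w p / real (Suc k)" by (simp only: inner_scaleR_right) simp
        also have "\<dots> \<le> e"
          using k \<open>e > 0\<close> by (simp add: pos_divide_le_eq pos_divide_less_eq algebra_simps)
        finally show "d \<le> 0 + e" by simp
      qed
      then show ?thesis using wd(1) by simp
    qed
    obtain a \<theta> \<beta> where w: "w = (- a, - \<theta>, - \<beta>)"
      by (metis add.inverse_inverse prod.exhaust)
    have fn: "a * real n + \<theta> \<bullet> S + \<beta> * t \<le> 0" if "n \<ge> 1" "0 < L n S" "t \<le> ln (L n S)" for n S t
      using w\<Lambda>[of "(real n, S, t)"] that by (auto simp: w \<Lambda>_def inner_prod_def)
    have gz: "0 < a + \<theta> \<bullet> x - \<beta> * \<iota>"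
      using wz by (simp add: w z_def inner_prod_def)
    \<comment> \<open>Otherwise letting \<open>t\<close> tend to -\<infinity> at one fixed loop
      length and sum violates \<open>fn\<close>.\<close>
    have "0 \<le> \<beta>"
    proof (rule ccontr)
      assume "\<not> 0 \<le> \<beta>"
      then have \<beta>: "\<beta> < 0" by simp
      define t where "t = min (ln (L n0 S0)) ((1 + \<bar>a * real n0 + \<theta> \<bullet> S0\<bar>) / \<beta>)"
      have "a * real n0 + \<theta> \<bullet> S0 + \<beta> * t \<le> 0" using n0 by (intro fn) (auto simp: t_def)
      moreover have "\<beta> * t \<ge> \<beta> * ((1 + \<bar>a * real n0 + \<theta> \<bullet> S0\<bar>) / \<beta>)"
        using \<beta> by (intro mult_left_mono_neg) (auto simp: t_def)
      ultimately show False using \<beta> by simp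
    qed
    \<comment> \<open>If \<open>\<beta>\<close> > 0, normalise with \<open>s = 1 / \<beta>\<close>.
      If \<open>\<beta>\<close> = 0, a large \<open>s\<close> makes the strict gain
      \<open>gz\<close> exceed |\<iota>|. The share 1 - s \<beta> of the log-weight left over is
      harmless because weights are at most 1.\<close>
    obtain s where s: "0 \<le> s" "s * \<beta> \<le> 1" "0 < s * (a + \<theta> \<bullet> x - \<beta> * \<iota>) - (1 - s * \<beta>) * \<iota>"
    proof (cases "\<beta> = 0")
      case True
      let ?s = "\<bar>\<iota>\<bar> / (a + \<theta> \<bullet> x - \<beta> * \<iota>) + 1"
      have "?s * (a + \<theta> \<bullet> x - \<beta> * \<iota>) = \<bar>\<iota>\<bar> + (a + \<theta> \<bullet> x - \<beta> * \<iota>)" using gz by (simp add: field_simps)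
      then show ?thesis using that[of ?s] gz True by auto
    next
      case False
      then show ?thesis using that[of "1 / \<beta>"] gz \<open>0 \<le> \<beta>\<close> by auto
    qed
    have "ln (perron_frobenius B (\<lambda>r t. P r t * exp ((s *\<^sub>R \<theta>) \<bullet> f t))) \<le> - (s * a)"
    proof (rule ln_perron_frobenius_le[OF irr \<open>b \<in> B\<close> nonneg])
      fix n :: nat and S assume n: "n \<ge> 1"
      show "word_weight P f B b b n S \<le> exp (- (s *\<^sub>R \<theta> \<bullet> S) - s * a * real n)"
      proof (cases "0 < L n S")
        case True
        have "s * (a * real n + \<theta> \<bullet> S + \<beta> * ln (L n S)) \<le> 0"
          using fn[OF n True order_refl] s(1) by (simp add: mult_nonneg_nonpos)
        moreover have "(1 - s * \<beta>) * ln (L n S) \<le> 0"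
          using s(2) True L_le_1[of n S] by (intro mult_nonneg_nonpos) auto
        ultimately have "ln (L n S) \<le> - (s *\<^sub>R \<theta> \<bullet> S) - s * a * real n" by (simp add: algebra_simps)
        then show ?thesis using True unfolding L_def[symmetric] by (metis exp_le_cancel_iff exp_ln)
      next
        case False
        then show ?thesis unfolding L_def[symmetric] by (smt (verit) exp_gt_zero)
      qed
    qed
    then show False using rate[of "s *\<^sub>R \<theta>"] s(3) by (simp add: algebra_simps)
  qed
  \<comment> \<open>The bound 1/2 ensures k \<le> 2 n for the approximating loop length
    \<open>n\<close> and denominator \<open>k\<close>. The second bound then turns all errors, which
    are multiples of k \<eta>, into at most n \<epsilon>.\<close>
  define \<eta> where "\<eta> = min (1 / 2) (\<epsilon> / (2 * (1 + norm x + \<bar>\<iota>\<bar>)))"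
  have pos: "1 + norm x + \<bar>\<iota>\<bar> > 0" by (smt (verit) norm_ge_zero)
  have "\<eta> > 0" unfolding \<eta>_def using pos \<open>\<epsilon> > 0\<close> by simp
  moreover have "\<eta> \<le> 1 / 2" unfolding \<eta>_def by (rule min.cobounded1)
  ultimately have \<eta>: "\<eta> > 0" "\<eta> \<le> 1 / 2" by blast+
  have "\<eta> \<le> \<epsilon> / (2 * (1 + norm x + \<bar>\<iota>\<bar>))" by (simp add: \<eta>_def)
  then have \<eta>3: "2 * (\<eta> * (1 + norm x + \<bar>\<iota>\<bar>)) \<le> \<epsilon>"
    using pos by (simp only: pos_le_divide_eq mult_pos_pos zero_less_numeral mult_ac)
  obtain q where q: "q \<in> R" "dist q z < \<eta>"
    using \<eta>(1) \<open>z \<in> closure R\<close> by (meson closure_approachable)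
  then obtain k n S t where k: "k \<ge> 1" and kq: "real k *\<^sub>R q = (real n, S, t)"
    and n: "n \<ge> 1" "0 < L n S" "t \<le> ln (L n S)"
    by (auto simp: R_def \<Lambda>_def)
  have "norm (real k *\<^sub>R (q - z)) \<le> real k * \<eta>"
    using q(2) by (simp add: dist_norm mult_left_mono)
  moreover have "real k *\<^sub>R (q - z) = (real n - real k, S - real k *\<^sub>R x, t + real k * \<iota>)"
    using kq by (simp add: z_def scaleR_diff_right)
  ultimately have bd: "norm (real n - real k, S - real k *\<^sub>R x, t + real k * \<iota>) \<le> real k * \<eta>" by simp
  have comp: "\<bar>c\<bar> \<le> norm (c, v, c')" "norm v \<le> norm (c, v, c')" "\<bar>c'\<bar> \<le> norm (c, v, c')"
    for c c' :: real and v :: "real ^ 'd"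
    using norm_fst_le[of c "(v, c')"] norm_snd_le[of "(v, c')" c] norm_fst_le[of v c'] norm_snd_le[of c' v]
    by (auto intro: order_trans)
  note d = comp[THEN order_trans, OF bd]
  have "real k * \<eta> \<le> real k * (1 / 2)" using \<eta>(2) by (intro mult_left_mono) auto
  then have kn: "real k \<le> 2 * real n" using d(1) by linarith
  have main: "real k * (\<eta> * (1 + norm x + \<bar>\<iota>\<bar>)) \<le> real n * \<epsilon>"
  proof -
    have "real k * (\<eta> * (1 + norm x + \<bar>\<iota>\<bar>)) \<le> 2 * real n * (\<eta> * (1 + norm x + \<bar>\<iota>\<bar>))"
      using kn \<eta>(1) by (intro mult_right_mono) auto
    also have "\<dots> = real n * (2 * (\<eta> * (1 + norm x + \<bar>\<iota>\<bar>)))" by simp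
    also have "\<dots> \<le> real n * \<epsilon>" by (intro mult_left_mono \<eta>3) simp
    finally show ?thesis .
  qed
  have "S - real n *\<^sub>R x = (S - real k *\<^sub>R x) + (real k - real n) *\<^sub>R x"
    by (simp add: algebra_simps)
  then have "norm (S - real n *\<^sub>R x) \<le> norm (S - real k *\<^sub>R x) + norm ((real k - real n) *\<^sub>R x)"
    by (metis norm_triangle_ineq)
  also have "\<dots> \<le> real k * \<eta> + real k * \<eta> * norm x"
    using d(1,2) by (intro add_mono) (auto simp: abs_minus_commute intro: mult_right_mono)
  also have "\<dots> \<le> real k * (\<eta> * (1 + norm x + \<bar>\<iota>\<bar>))"
    using \<eta>(1) by (simp add: algebra_simps)
  finally have 1: "norm (S - real n *\<^sub>R x) \<le> real n * \<epsilon>" using main by simp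
  have "\<bar>(real k - real n) * \<iota>\<bar> \<le> real k * \<eta> * \<bar>\<iota>\<bar>"
    unfolding abs_mult using d(1) by (intro mult_right_mono) auto
  moreover have "0 \<le> real k * \<eta> * norm x" using \<eta>(1) by simp
  ultimately have "t \<ge> - (real n * (\<iota> + \<epsilon>))"
    using d(3) main by (simp add: algebra_simps)
  then have "- (real n * (\<iota> + \<epsilon>)) \<le> ln (L n S)" using n(3) by linarith
  then have "exp (- (real n * (\<iota> + \<epsilon>))) \<le> L n S" using n(2) by (metis exp_le_cancel_iff exp_ln)
  then show ?thesis using 1 n(1) unfolding L_def by blast
qed

section \<open>Stages, corridors and links\<close>

text \<open>A lower bound for one segment of the trajectory, witnessed by a chosen family
  \<open>W\<close> of words rather than all of them: appending two stages then just concatenates the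
  families.\<close>

definition stage ::
  "(nat \<Rightarrow> 's \<Rightarrow> 's \<Rightarrow> real) \<Rightarrow> ('s \<Rightarrow> real ^ 'd) \<Rightarrow> nat \<Rightarrow> 's \<Rightarrow> nat \<Rightarrow> 's \<Rightarrow> real ^ 'd \<Rightarrow> real \<Rightarrow> real \<Rightarrow> bool"
where
  "stage Q f k y n z s \<rho> c \<longleftrightarrow>
     (\<exists>W \<subseteq> {w. length w = n \<and> last (y # w) = z \<and> norm (sum_list (map f w) - s) \<le> \<rho>}.
        c \<le> (\<Sum>w\<in>W. path_prob Q k y w))"

text \<open>The lower bound \<open>T\<close> on the length lets estimates that hold only at late times be used at the end
  of the stage, even when \<open>V = 0\<close>.\<close>

definition corridor ::
  "(nat \<Rightarrow> 's \<Rightarrow> 's \<Rightarrow> real) \<Rightarrow> ('s \<Rightarrow> real ^ 'd) \<Rightarrow> nat \<Rightarrow> 's \<Rightarrow> 's \<Rightarrow> real \<Rightarrow> real ^ 'd \<Rightarrow> real \<Rightarrow> bool"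
where
  "corridor Q f k y z V Y c \<longleftrightarrow>
     (\<forall>\<epsilon>>0. \<forall>T. \<exists>K. \<forall>n\<ge>K. \<exists>m\<ge>T. \<bar>real m - real n * V\<bar> \<le> real K \<and>
        stage Q f k y m z (real n *\<^sub>R Y) (real n * \<epsilon> + real K) (exp (- (real n * (c + \<epsilon>)) - real K)))"

text \<open>A connection of exponential rate \<open>u\<close> between arbitrary states. Only real
  \<open>c\<close> below \<open>u\<close> are tested, which matches a liminf and makes the rate
  -\<infinity> vacuous. One constant \<open>K\<close> serves as time threshold, length bound and
  prefactor.\<close>

definition link ::
  "(nat \<Rightarrow> 's \<Rightarrow> 's \<Rightarrow> real) \<Rightarrow> 's set \<Rightarrow> 's set \<Rightarrow> ereal \<Rightarrow> bool"
where
  "link Q B B' u \<longleftrightarrow>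
     (\<forall>c. ereal c < u \<longrightarrow> (\<exists>K. \<forall>k\<ge>K. \<forall>y\<in>B. \<forall>z\<in>B'.
        \<exists>w. length w \<le> K \<and> last (y # w) = z \<and> exp (c * real k - real K) \<le> path_prob Q k y w))"

lemma stage_mono:
  assumes "stage Q f k y n z s \<rho> c" "\<rho> \<le> \<rho>'" "c' \<le> c"
  shows "stage Q f k y n z s \<rho>' c'"
  using assms unfolding stage_def by (smt (verit, best) Collect_mono_iff order_trans)

lemma stage_recentre:
  assumes "stage Q f k y n z s \<rho> c" "norm (s - s') \<le> d"
  shows "stage Q f k y n z s' (\<rho> + d) c"
proof -
  have "norm (t - s') \<le> \<rho> + d" if "norm (t - s) \<le> \<rho>" for t
    using that assms(2) norm_triangle_ineq[of "t - s" "s - s'"] by simp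
  then show ?thesis using assms(1) unfolding stage_def by (smt (verit, best) Collect_mono_iff order_trans)
qed

lemma stage_append:
  fixes Q :: "nat \<Rightarrow> 's::finite \<Rightarrow> 's \<Rightarrow> real"
  assumes nn: "\<And>n s t. n \<ge> 1 \<Longrightarrow> 0 \<le> Q n s t"
    and 1: "stage Q f k y n z s \<rho> c" and 2: "stage Q f (k + n) z m z' s' \<rho>' c'"
    and "0 \<le> c" "0 \<le> c'"
  shows "stage Q f k y (n + m) z' (s + s') (\<rho> + \<rho>') (c * c')"
proof -
  obtain U where U: "U \<subseteq> {w. length w = n \<and> last (y # w) = z \<and> norm (sum_list (map f w) - s) \<le> \<rho>}"
    "c \<le> (\<Sum>w\<in>U. path_prob Q k y w)" using 1 unfolding stage_def by blast
  obtain W where W: "W \<subseteq> {w. length w = m \<and> last (z # w) = z' \<and> norm (sum_list (map f w) - s') \<le> \<rho>'}"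
    "c' \<le> (\<Sum>w\<in>W. path_prob Q (k + n) z w)" using 2 unfolding stage_def by blast
  have inj: "inj_on (\<lambda>(u, w). u @ w) (U \<times> W)"
  proof -
    have "length u = n" if "u \<in> U" for u using that U(1) by auto
    then show ?thesis by (auto simp: inj_on_def)
  qed
  have "c * c' \<le> (\<Sum>w\<in>U. path_prob Q k y w) * (\<Sum>w\<in>W. path_prob Q (k + n) z w)"
    using assms(4,5) U(2) W(2) by (intro mult_mono) auto
  also have "\<dots> = (\<Sum>(u, w)\<in>U \<times> W. path_prob Q k y u * path_prob Q (k + n) z w)"
    by (simp add: sum_product sum.cartesian_product)
  also have "\<dots> = (\<Sum>(u, w)\<in>U \<times> W. path_prob Q k y (u @ w))"
    using U(1) by (intro sum.cong refl) (auto simp: path_prob_append)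
  also have "\<dots> = (\<Sum>w\<in>(\<lambda>(u, w). u @ w) ` (U \<times> W). path_prob Q k y w)"
    using inj by (subst sum.reindex) (auto simp: case_prod_unfold)
  finally have le: "c * c' \<le> (\<Sum>w\<in>(\<lambda>(u, w). u @ w) ` (U \<times> W). path_prob Q k y w)" .
  have "norm (sum_list (map f (u @ w)) - (s + s')) \<le> \<rho> + \<rho>'" if "u \<in> U" "w \<in> W" for u w
  proof -
    have "sum_list (map f (u @ w)) - (s + s') = (sum_list (map f u) - s) + (sum_list (map f w) - s')"
      by simp
    moreover have "norm (sum_list (map f u) - s) \<le> \<rho>" "norm (sum_list (map f w) - s') \<le> \<rho>'"
      using that U(1) W(1) by auto
    ultimately show ?thesis by (metis norm_triangle_le add_mono)
  qed
  moreover have "length (u @ w) = n + m \<and> last (y # u @ w) = z'" if "u \<in> U" "w \<in> W" for u w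
  proof -
    have "length u = n" "last (y # u) = z" "length w = m" "last (z # w) = z'"
      using that U(1) W(1) by auto
    moreover have "last (y # u @ w) = last (last (y # u) # w)" by simp
    ultimately show ?thesis by (simp only: length_append)
  qed
  ultimately have "(\<lambda>(u, w). u @ w) ` (U \<times> W) \<subseteq>
      {w. length w = n + m \<and> last (y # w) = z' \<and> norm (sum_list (map f w) - (s + s')) \<le> \<rho> + \<rho>'}"
    by fast
  then show ?thesis using le unfolding stage_def by blast
qed

lemma norm_sum_list_map_le:
  fixes f :: "'s \<Rightarrow> 'a::real_normed_vector"
  assumes "\<And>y. norm (f y) \<le> F"
  shows "norm (sum_list (map f w)) \<le> F * real (length w)"
proof (induction w)
  case (Cons y w)
  then show ?case using assms[of y] norm_triangle_ineq[of "f y" "sum_list (map f w)"]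
    by (simp add: algebra_simps)
qed simp

text \<open>Meant for connecting words of bounded length, whose contribution to the sum is
  controlled only by its size.\<close>

lemma stage_word:
  assumes "\<And>y. norm (f y) \<le> F"
  shows "stage Q f k y (length w) (last (y # w)) 0 (F * real (length w)) (path_prob Q k y w)"
  unfolding stage_def using norm_sum_list_map_le[of f F w, OF assms]
  by (intro exI[of _ "{w}"]) auto

lemma stage_power:
  fixes Q :: "nat \<Rightarrow> 's::finite \<Rightarrow> 's \<Rightarrow> real"
  assumes nn: "\<And>n s t. n \<ge> 1 \<Longrightarrow> 0 \<le> Q n s t"
    and st: "\<And>j. j \<ge> K \<Longrightarrow> stage Q f j b n b s \<rho> c" and "0 \<le> c" "0 \<le> \<rho>" "k \<ge> K"
  shows "stage Q f k b (m * n) b (real m *\<^sub>R s) (real m * \<rho>) (c ^ m)"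
proof (induction m)
  case 0
  show ?case unfolding stage_def by (intro exI[of _ "{[]}"]) auto
next
  case (Suc m)
  have "stage Q f (k + m * n) b n b s \<rho> c" using \<open>k \<ge> K\<close> by (intro st) simp
  from stage_append[OF nn Suc this] show ?case
    using \<open>0 \<le> c\<close> by (simp add: algebra_simps)
qed

text \<open>The loops supplied by \<open>loops_near_point\<close> form a finite family of words, so
  their total weight under \<open>Q\<close> tends to the homogeneous one. The gap between
  \<epsilon>/2 and \<epsilon> absorbs the difference at all late times.\<close>

lemma block_stage:
  fixes P :: "'s::finite \<Rightarrow> 's \<Rightarrow> real" and f :: "'s \<Rightarrow> real ^ 'd"
  assumes irr: "irreducible_block B P" and "b \<in> B" and st: "stochastic P"
    and lim: "\<And>x y. (\<lambda>n. Q n x y) \<longlonglongrightarrow> P x y"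
    and rate: "\<And>\<theta>. \<theta> \<bullet> x - ln (perron_frobenius B (\<lambda>s t. P s t * exp (\<theta> \<bullet> f t))) \<le> \<iota>"
    and "\<epsilon> > 0"
  shows "\<exists>n\<ge>1. \<exists>K. \<forall>k\<ge>K.
    stage Q f k b n b (real n *\<^sub>R x) (real n * \<epsilon>) (exp (- (real n * (\<iota> + \<epsilon>))))"
proof -
  obtain n S where n: "n \<ge> 1" "norm (S - real n *\<^sub>R x) \<le> real n * (\<epsilon> / 2)"
    "exp (- (real n * (\<iota> + \<epsilon> / 2))) \<le> word_weight P f B b b n S"
    using loops_near_point[OF irr \<open>b \<in> B\<close> st rate, of "\<epsilon> / 2"] \<open>\<epsilon> > 0\<close> by auto
  have "exp (- (real n * (\<iota> + \<epsilon>))) < exp (- (real n * (\<iota> + \<epsilon> / 2)))"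
    using n(1) \<open>\<epsilon> > 0\<close> by simp
  then have "exp (- (real n * (\<iota> + \<epsilon>))) < word_weight P f B b b n S" using n(3) by linarith
  moreover have "(\<lambda>k. \<Sum>w\<in>words_between f B b b n S. path_prob Q k b w) \<longlonglongrightarrow> word_weight P f B b b n S"
    unfolding word_weight_def by (intro tendsto_sum path_prob_tendsto lim)
  ultimately have "eventually (\<lambda>k. exp (- (real n * (\<iota> + \<epsilon>))) <
      (\<Sum>w\<in>words_between f B b b n S. path_prob Q k b w)) sequentially"
    by (simp add: order_tendstoD)
  then obtain K where K: "\<And>k. k \<ge> K \<Longrightarrow> exp (- (real n * (\<iota> + \<epsilon>))) <
      (\<Sum>w\<in>words_between f B b b n S. path_prob Q k b w)"
    by (auto simp: eventually_sequentially)
  have "real n * (\<epsilon> / 2) \<le> real n * \<epsilon>" using \<open>\<epsilon> > 0\<close> by (intro mult_left_mono) auto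
  with n(2) have "norm (S - real n *\<^sub>R x) \<le> real n * \<epsilon>" by (rule order_trans)
  then have "words_between f B b b n S \<subseteq>
      {w. length w = n \<and> last (b # w) = b \<and> norm (sum_list (map f w) - real n *\<^sub>R x) \<le> real n * \<epsilon>}"
    by (auto simp: words_between_def)
  then show ?thesis
    using n(1) K unfolding stage_def by (meson less_imp_le)
qed

text \<open>Words are lengthened by appending loops at \<open>b\<close>. This is how a corridor
  waits past an arbitrary time \<open>T\<close>.\<close>

lemma irreducible_long_word:
  assumes irr: "irreducible_block B P" and nonneg: "\<And>x y. 0 \<le> P x y" and "y \<in> B" "b \<in> B"
  shows "\<exists>w. T \<le> length w \<and> set w \<subseteq> B \<and> last (y # w) = b \<and> path_prob (\<lambda>_. P) 0 y w > 0"
proof (induction T)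
  case 0
  obtain n where "block_power B P n y b > 0"
    using irr \<open>y \<in> B\<close> \<open>b \<in> B\<close> by (auto simp: irreducible_block_def)
  then show ?case using block_power_word[of P B n y b] nonneg by auto
next
  case (Suc T)
  then obtain w where w: "T \<le> length w" "set w \<subseteq> B" "last (y # w) = b" "path_prob (\<lambda>_. P) 0 y w > 0"
    by blast
  obtain n where n: "n \<ge> 1" "block_power B P n b b > 0"
    using irr \<open>b \<in> B\<close> by (auto simp: irreducible_block_def)
  then obtain u where u: "length u = n" "set u \<subseteq> B" "last (b # u) = b" "path_prob (\<lambda>_. P) 0 b u > 0"
    using block_power_word[of P B n b b] nonneg by auto
  show ?case
    using w u n(1) by (intro exI[of _ "w @ u"])
      (auto simp: path_prob_append path_prob_homogeneous[of P "length w"] split: if_splits)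
qed

text \<open>Waiting inside the first class for any prescribed time costs a factor independent of
  \<open>n\<close>, which disappears in exp (-K).\<close>

lemma corridor_start:
  fixes P :: "'s::finite \<Rightarrow> 's \<Rightarrow> real"
  assumes irr: "irreducible_block B P" and nonneg: "\<And>x y. 0 \<le> P x y" and B: "y \<in> B" "b \<in> B"
    and pos: "\<And>n s t. n > k \<Longrightarrow> s \<in> B \<Longrightarrow> t \<in> B \<Longrightarrow> P s t > 0 \<Longrightarrow> Q n s t > 0"
    and F: "\<And>y. norm (f y) \<le> F"
  shows "corridor Q f k y b 0 0 0"
  unfolding corridor_def
proof (intro allI impI)
  fix \<epsilon> :: real and T :: nat assume "\<epsilon> > 0"
  obtain w where w: "T \<le> length w" "set w \<subseteq> B" "last (y # w) = b" "path_prob (\<lambda>_. P) 0 y w > 0"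
    using irreducible_long_word[OF irr nonneg B] by blast
  have p: "path_prob Q k y w > 0"
    by (rule path_prob_pos_transfer[where A = P and B = B and Q = Q]) (use pos nonneg B(1) w(2,4) in auto)
  define K where "K = nat \<lceil>real (length w) + F * real (length w) + \<bar>ln (path_prob Q k y w)\<bar>\<rceil>"
  have F0: "0 \<le> F" using F norm_ge_zero order_trans by blast
  then have K: "real (length w) \<le> real K" "F * real (length w) \<le> real K"
    "\<bar>ln (path_prob Q k y w)\<bar> \<le> real K"
    unfolding K_def by (smt (verit) mult_nonneg_nonneg of_nat_0_le_iff real_nat_ceiling_ge)+
  show "\<exists>K. \<forall>n\<ge>K. \<exists>m\<ge>T. \<bar>real m - real n * 0\<bar> \<le> real K \<and>
      stage Q f k y m b (real n *\<^sub>R 0) (real n * \<epsilon> + real K) (exp (- (real n * (0 + \<epsilon>)) - real K))"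
  proof (rule exI[of _ K], intro allI impI)
    fix n assume "n \<ge> K"
    have "stage Q f k y (length w) b 0 (F * real (length w)) (path_prob Q k y w)"
      using stage_word[of f F Q k y w, OF F] w(3) by metis
    moreover have "exp (- (real n * (0 + \<epsilon>)) - real K) \<le> path_prob Q k y w"
    proof -
      have "0 \<le> real n * \<epsilon>" using \<open>\<epsilon> > 0\<close> by simp
      then have "- (real n * (0 + \<epsilon>)) - real K \<le> ln (path_prob Q k y w)" using K(3) by simp
      then show ?thesis using p by (metis exp_le_cancel_iff exp_ln)
    qed
    moreover have "F * real (length w) \<le> real n * \<epsilon> + real K" using K(2) \<open>\<epsilon> > 0\<close>
      by (simp add: add_increasing)
    ultimately have "stage Q f k y (length w) b (real n *\<^sub>R 0) (real n * \<epsilon> + real K)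
        (exp (- (real n * (0 + \<epsilon>)) - real K))"
      by (simp add: stage_mono)
    then show "\<exists>m\<ge>T. \<bar>real m - real n * 0\<bar> \<le> real K \<and>
        stage Q f k y m b (real n *\<^sub>R 0) (real n * \<epsilon> + real K) (exp (- (real n * (0 + \<epsilon>)) - real K))"
      using w(1) K(1) by (intro exI[of _ "length w"]) auto
  qed
qed

text \<open>Spends a further proportion \<open>v\<close> of the time near the mean \<open>x\<close>
  by repeating one good loop at its base point. The constant of the old corridor and the rounding to
  whole loops go into the new constant.\<close>

lemma corridor_block:
  fixes P :: "'s::finite \<Rightarrow> 's \<Rightarrow> real" and f :: "'s \<Rightarrow> real ^ 'd"
  assumes nn: "\<And>n s t. n \<ge> 1 \<Longrightarrow> 0 \<le> Q n s t"
    and irr: "irreducible_block B P" and "b \<in> B" and st: "stochastic P"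
    and lim: "\<And>x y. (\<lambda>n. Q n x y) \<longlonglongrightarrow> P x y"
    and rate: "\<And>\<theta>. \<theta> \<bullet> x - ln (perron_frobenius B (\<lambda>s t. P s t * exp (\<theta> \<bullet> f t))) \<le> \<iota>"
    and "0 \<le> v" and cor: "corridor Q f k y b V Y c"
  shows "corridor Q f k y b (V + v) (Y + v *\<^sub>R x) (c + v * \<iota>)"
  unfolding corridor_def
proof (intro allI impI)
  fix \<epsilon> :: real and T :: nat assume "\<epsilon> > 0"
  \<comment> \<open>The loss per unit of time is spread so that v \<delta> \<le> \<epsilon>/2; the
    added 1 covers v = 0.\<close>
  define \<delta> where "\<delta> = \<epsilon> / (2 * (1 + v))"
  have \<delta>: "\<delta> > 0" "v * \<delta> \<le> \<epsilon> / 2"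
    using \<open>\<epsilon> > 0\<close> \<open>0 \<le> v\<close> by (auto simp: \<delta>_def divide_simps)
  obtain l K0 where l: "l \<ge> 1" and K0: "\<And>j. j \<ge> K0 \<Longrightarrow>
      stage Q f j b l b (real l *\<^sub>R x) (real l * \<delta>) (exp (- (real l * (\<iota> + \<delta>))))"
    using block_stage[OF irr \<open>b \<in> B\<close> st lim rate \<delta>(1)] by auto
  \<comment> \<open>Asking the old corridor for at least \<open>T + K0\<close> steps makes the loops
    begin after the time from which \<open>K0\<close> guarantees them.\<close>
  obtain K1 where K1: "\<And>n. n \<ge> K1 \<Longrightarrow> \<exists>m\<ge>T + K0. \<bar>real m - real n * V\<bar> \<le> real K1 \<and>
      stage Q f k y m b (real n *\<^sub>R Y) (real n * (\<epsilon> / 2) + real K1) (exp (- (real n * (c + \<epsilon> / 2)) - real K1))"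
    using cor \<open>\<epsilon> > 0\<close> unfolding corridor_def by (meson half_gt_zero)
  define K where "K = K1 + nat \<lceil>real l * (1 + norm x + \<bar>\<iota> + \<delta>\<bar>)\<rceil>"
  have K: "real K1 + real l * (1 + norm x + \<bar>\<iota> + \<delta>\<bar>) \<le> real K" "K1 \<le> K"
    unfolding K_def by (auto simp: real_nat_ceiling_ge)
  then have K': "real K1 + real l + real l * norm x + real l * \<bar>\<iota> + \<delta>\<bar> \<le> real K"
    by (simp add: algebra_simps)
  have l0: "0 \<le> real l * norm x" "0 \<le> real l * \<bar>\<iota> + \<delta>\<bar>" by simp_all
  then have K2: "real K1 + real l * \<bar>\<iota> + \<delta>\<bar> \<le> real K" "real K1 + real l \<le> real K"
    using K' by linarith+
  show "\<exists>K. \<forall>n\<ge>K. \<exists>m\<ge>T. \<bar>real m - real n * (V + v)\<bar> \<le> real K \<and>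
      stage Q f k y m b (real n *\<^sub>R (Y + v *\<^sub>R x)) (real n * \<epsilon> + real K)
        (exp (- (real n * (c + v * \<iota> + \<epsilon>)) - real K))"
  proof (rule exI[of _ K], intro allI impI)
    fix n assume "n \<ge> K"
    then obtain m where m: "m \<ge> T + K0" "\<bar>real m - real n * V\<bar> \<le> real K1"
      "stage Q f k y m b (real n *\<^sub>R Y) (real n * (\<epsilon> / 2) + real K1) (exp (- (real n * (c + \<epsilon> / 2)) - real K1))"
      using K1[of n] K(2) by auto
    \<comment> \<open>The number of whole loops that fit into n v steps; less than one loop is
      missing, and \<open>K\<close> pays for its length, sum and exponent.\<close>
    define j where "j = nat \<lfloor>real n * v / real l\<rfloor>"
    have "0 \<le> real n * v / real l" using \<open>0 \<le> v\<close> by simp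
    then have "real j \<le> real n * v / real l" "real n * v / real l \<le> real j + 1"
      unfolding j_def by (auto simp: of_nat_nat)
    then have j: "real j * real l \<le> real n * v" "real n * v \<le> real j * real l + real l"
      using l by (auto simp: field_simps)
    then have j': "\<bar>real j * real l - real n * v\<bar> \<le> real l" by linarith
    have "stage Q f (k + m) b (j * l) b (real j *\<^sub>R (real l *\<^sub>R x)) (real j * (real l * \<delta>))
        (exp (- (real l * (\<iota> + \<delta>))) ^ j)"
      using \<delta>(1) m(1) by (intro stage_power[of Q K0] nn K0) auto
    from stage_append[of Q, OF nn m(3) this]
    have "stage Q f k y (m + j * l) b (real n *\<^sub>R Y + real j *\<^sub>R (real l *\<^sub>R x))
        (real n * (\<epsilon> / 2) + real K1 + real j * (real l * \<delta>))
        (exp (- (real n * (c + \<epsilon> / 2)) - real K1) * exp (- (real l * (\<iota> + \<delta>))) ^ j)" by simp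
    moreover have "norm ((real n *\<^sub>R Y + real j *\<^sub>R (real l *\<^sub>R x)) - real n *\<^sub>R (Y + v *\<^sub>R x)) \<le> real l * norm x"
    proof -
      have "(real n *\<^sub>R Y + real j *\<^sub>R (real l *\<^sub>R x)) - real n *\<^sub>R (Y + v *\<^sub>R x)
          = (real j * real l - real n * v) *\<^sub>R x"
        by (simp add: algebra_simps)
      then show ?thesis using j' by (simp add: mult_right_mono)
    qed
    ultimately have "stage Q f k y (m + j * l) b (real n *\<^sub>R (Y + v *\<^sub>R x))
        (real n * (\<epsilon> / 2) + real K1 + real j * (real l * \<delta>) + real l * norm x)
        (exp (- (real n * (c + \<epsilon> / 2)) - real K1) * exp (- (real l * (\<iota> + \<delta>))) ^ j)"
      by (rule stage_recentre)
    then have stg: "stage Q f k y (m + j * l) b (real n *\<^sub>R (Y + v *\<^sub>R x)) (real n * \<epsilon> + real K)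
        (exp (- (real n * (c + v * \<iota> + \<epsilon>)) - real K))"
    proof (rule stage_mono)
      have "real j * (real l * \<delta>) = (real j * real l) * \<delta>" by simp
      also have "\<dots> \<le> (real n * v) * \<delta>" using j \<delta>(1) by (intro mult_right_mono) auto
      also have "\<dots> = real n * (v * \<delta>)" by simp
      also have "\<dots> \<le> real n * (\<epsilon> / 2)" using \<delta>(2) by (intro mult_left_mono) auto
      finally show "real n * (\<epsilon> / 2) + real K1 + real j * (real l * \<delta>) + real l * norm x
          \<le> real n * \<epsilon> + real K" using K' l0 by linarith
      have "\<bar>(real j * real l - real n * v) * (\<iota> + \<delta>)\<bar> \<le> real l * \<bar>\<iota> + \<delta>\<bar>"
        unfolding abs_mult using j' by (intro mult_right_mono) auto
      then have "(real j * real l) * (\<iota> + \<delta>) \<le> (real n * v) * (\<iota> + \<delta>) + real l * \<bar>\<iota> + \<delta>\<bar>"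
        by (simp add: algebra_simps)
      moreover have "(real n * v) * (\<iota> + \<delta>) \<le> real n * (v * \<iota>) + real n * (\<epsilon> / 2)"
        using mult_left_mono[OF \<delta>(2), of "real n"] by (simp add: algebra_simps)
      ultimately have "- (real n * (c + v * \<iota> + \<epsilon>)) - real K
          \<le> - (real n * (c + \<epsilon> / 2)) - real K1 + real j * (- (real l * (\<iota> + \<delta>)))"
        using K2(1) by (simp add: algebra_simps)
      then show "exp (- (real n * (c + v * \<iota> + \<epsilon>)) - real K)
          \<le> exp (- (real n * (c + \<epsilon> / 2)) - real K1) * exp (- (real l * (\<iota> + \<delta>))) ^ j"
        by (simp only: exp_of_nat_mult[symmetric] exp_add[symmetric] exp_le_cancel_iff)
    qed
    have "\<bar>real (m + j * l) - real n * (V + v)\<bar> \<le> real K"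
      using m(2) j' K2(2) by (simp add: algebra_simps)
    then show "\<exists>m\<ge>T. \<bar>real m - real n * (V + v)\<bar> \<le> real K \<and>
        stage Q f k y m b (real n *\<^sub>R (Y + v *\<^sub>R x)) (real n * \<epsilon> + real K)
          (exp (- (real n * (c + v * \<iota> + \<epsilon>)) - real K))"
      using stg m(1) by (intro exI[of _ "m + j * l"]) auto
  qed
qed

text \<open>The connection begins after about n V steps, hence the exponential price -n V u. The end
  state changes while the proportions and the scaled sum stay the same.\<close>

lemma corridor_link:
  fixes f :: "'s::finite \<Rightarrow> real ^ 'd"
  assumes nn: "\<And>n s t. n \<ge> 1 \<Longrightarrow> 0 \<le> Q n s t"
    and F: "\<And>y. norm (f y) \<le> F"
    and lk: "link Q B B' (ereal u)" and "b \<in> B" "z \<in> B'"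
    and "0 \<le> V" and cor: "corridor Q f k y b V Y c"
  shows "corridor Q f k y z V Y (c - V * u)"
  unfolding corridor_def
proof (intro allI impI)
  fix \<epsilon> :: real and T :: nat assume "\<epsilon> > 0"
  define \<delta> where "\<delta> = \<epsilon> / (2 * (1 + V))"
  have \<delta>: "\<delta> > 0" "V * \<delta> \<le> \<epsilon> / 2"
    using \<open>\<epsilon> > 0\<close> \<open>0 \<le> V\<close> by (auto simp: \<delta>_def divide_simps)
  have "ereal (u - \<delta>) < ereal u" using \<delta> by simp
  then obtain K0 where K0: "\<And>j. j \<ge> K0 \<Longrightarrow> \<exists>w. length w \<le> K0 \<and> last (b # w) = z \<and>
      exp ((u - \<delta>) * real j - real K0) \<le> path_prob Q j b w"
    using lk \<open>b \<in> B\<close> \<open>z \<in> B'\<close> unfolding link_def by meson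
  obtain K1 where K1: "\<And>n. n \<ge> K1 \<Longrightarrow> \<exists>m\<ge>T + K0. \<bar>real m - real n * V\<bar> \<le> real K1 \<and>
      stage Q f k y m b (real n *\<^sub>R Y) (real n * (\<epsilon> / 2) + real K1) (exp (- (real n * (c + \<epsilon> / 2)) - real K1))"
    using cor \<open>\<epsilon> > 0\<close> unfolding corridor_def by (meson half_gt_zero)
  have F0: "0 \<le> F" using F norm_ge_zero order_trans by blast
  \<comment> \<open>The connection starts at time k + m, which differs from n V by at most k + K1.
    The last term pays for this discrepancy in its exponent.\<close>
  define K where "K = K1 + K0 + nat \<lceil>F * real K0 + \<bar>u - \<delta>\<bar> * (real k + real K1)\<rceil>"
  have "F * real K0 + \<bar>u - \<delta>\<bar> * (real k + real K1)
      \<le> real (nat \<lceil>F * real K0 + \<bar>u - \<delta>\<bar> * (real k + real K1)\<rceil>)" by (rule real_nat_ceiling_ge)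
  then have K: "real K1 + real K0 + F * real K0 + \<bar>u - \<delta>\<bar> * (real k + real K1) \<le> real K" "K1 \<le> K"
    unfolding K_def by auto
  have nn0: "0 \<le> F * real K0" "0 \<le> \<bar>u - \<delta>\<bar> * (real k + real K1)" using F0 by simp_all
  then have K3: "real K1 + real K0 + \<bar>u - \<delta>\<bar> * (real k + real K1) \<le> real K" using K(1) by linarith
  show "\<exists>K. \<forall>n\<ge>K. \<exists>m\<ge>T. \<bar>real m - real n * V\<bar> \<le> real K \<and>
      stage Q f k y m z (real n *\<^sub>R Y) (real n * \<epsilon> + real K) (exp (- (real n * (c - V * u + \<epsilon>)) - real K))"
  proof (rule exI[of _ K], intro allI impI)
    fix n assume "n \<ge> K"
    then obtain m where m: "m \<ge> T + K0" "\<bar>real m - real n * V\<bar> \<le> real K1"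
      "stage Q f k y m b (real n *\<^sub>R Y) (real n * (\<epsilon> / 2) + real K1) (exp (- (real n * (c + \<epsilon> / 2)) - real K1))"
      using K1[of n] K(2) by auto
    obtain w where w: "length w \<le> K0" "last (b # w) = z"
      "exp ((u - \<delta>) * real (k + m) - real K0) \<le> path_prob Q (k + m) b w"
      using K0[of "k + m"] m(1) by auto
    have "stage Q f (k + m) b (length w) z 0 (F * real (length w)) (path_prob Q (k + m) b w)"
      using stage_word[of f F Q "k + m" b w, OF F] w(2) by metis
    then have "stage Q f (k + m) b (length w) z 0 (F * real K0) (exp ((u - \<delta>) * real (k + m) - real K0))"
      by (rule stage_mono) (use w F0 in \<open>auto intro: mult_left_mono\<close>)
    from stage_append[of Q, OF nn m(3) this]
    have "stage Q f k y (m + length w) z (real n *\<^sub>R Y)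
        (real n * (\<epsilon> / 2) + real K1 + F * real K0)
        (exp (- (real n * (c + \<epsilon> / 2)) - real K1) * exp ((u - \<delta>) * real (k + m) - real K0))" by simp
    then have stg: "stage Q f k y (m + length w) z (real n *\<^sub>R Y) (real n * \<epsilon> + real K)
        (exp (- (real n * (c - V * u + \<epsilon>)) - real K))"
    proof (rule stage_mono)
      have "0 \<le> real n * (\<epsilon> / 2)" using \<open>\<epsilon> > 0\<close> by simp
      then show "real n * (\<epsilon> / 2) + real K1 + F * real K0 \<le> real n * \<epsilon> + real K" using K(1) nn0 by linarith
      have "\<bar>(u - \<delta>) * (real k + (real m - real n * V))\<bar> \<le> \<bar>u - \<delta>\<bar> * (real k + real K1)"
        unfolding abs_mult using m(2) by (intro mult_left_mono) auto
      then have "(u - \<delta>) * real (k + m) \<ge> (u - \<delta>) * (real n * V) - \<bar>u - \<delta>\<bar> * (real k + real K1)"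
        by (simp add: algebra_simps)
      moreover have "(u - \<delta>) * (real n * V) \<ge> real n * (V * u) - real n * (\<epsilon> / 2)"
        using mult_left_mono[OF \<delta>(2), of "real n"] by (simp add: algebra_simps)
      ultimately have "- (real n * (c - V * u + \<epsilon>)) - real K
          \<le> - (real n * (c + \<epsilon> / 2)) - real K1 + ((u - \<delta>) * real (k + m) - real K0)"
        using K3 by (simp add: algebra_simps)
      then show "exp (- (real n * (c - V * u + \<epsilon>)) - real K)
          \<le> exp (- (real n * (c + \<epsilon> / 2)) - real K1) * exp ((u - \<delta>) * real (k + m) - real K0)"
        by (simp only: exp_add[symmetric] exp_le_cancel_iff)
    qed
    have "\<bar>real (m + length w) - real n * V\<bar> \<le> real K"
    proof -
      have "real K1 + real K0 \<le> real K" using K(1) nn0 by linarith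
      then show ?thesis using m(2) w(1) by simp
    qed
    then show "\<exists>m\<ge>T. \<bar>real m - real n * V\<bar> \<le> real K \<and>
        stage Q f k y m z (real n *\<^sub>R Y) (real n * \<epsilon> + real K) (exp (- (real n * (c - V * u + \<epsilon>)) - real K))"
      using stg m(1) by (intro exI[of _ "m + length w"]) auto
  qed
qed

section \<open>From corridors to probabilities\<close>

lemma pred_map_eq [measurable (raw)]:
  assumes [measurable]: "\<And>i. X i \<in> measurable M (count_space UNIV)"
  shows "Measurable.pred M (\<lambda>\<omega>. map (\<lambda>i. X i \<omega>) is = w)"
proof (induction "is" arbitrary: w)
  case (Cons i "is")
  show ?case
  proof (cases w)
    case (Cons a u)
    have [measurable]: "Measurable.pred M (\<lambda>\<omega>. map (\<lambda>i. X i \<omega>) is = u)" by (rule Cons.IH)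
    show ?thesis unfolding Cons list.map list.inject by measurable
  qed simp
qed simp

text \<open>Induction on the last state: the transition law in \<open>markov_chain\<close>
  conditions on the whole history, which is why the full initial segment is treated first.\<close>

lemma markov_chain_initial_path:
  fixes Q :: "nat \<Rightarrow> 's::finite \<Rightarrow> 's \<Rightarrow> real"
  assumes mc: "markov_chain \<Omega> X \<pi> Q"
  shows "\<P>(\<omega> in \<Omega>. map (\<lambda>i. X i \<omega>) [0..<Suc (length w)] = x # w) = pmf \<pi> x * path_prob Q 0 x w"
proof (induction w rule: rev_induct)
  case Nil
  then show ?case using mc by (simp add: markov_chain_def)
next
  case (snoc y w)
  interpret prob_space \<Omega> using mc by (simp add: markov_chain_def)
  define n where "n = length w"
  define g where "g i = (x # w) ! i" for i
  have meas: "X i \<in> measurable \<Omega> (count_space UNIV)" for i using mc by (simp add: markov_chain_def)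
  have [measurable]: "X i \<in> measurable \<Omega> (count_space UNIV)" for i by (rule meas)
  have hist: "map (\<lambda>i. X i \<omega>) [0..<Suc n] = x # w \<longleftrightarrow> (\<forall>m\<le>n. X m \<omega> = g m)" for \<omega>
    unfolding list_eq_iff_nth_eq by (auto simp: n_def g_def nth_append less_Suc_eq_le simp del: upt_Suc)
  have last: "g n = last (x # w)" by (simp add: g_def n_def last_conv_nth)
  have eq: "(map (\<lambda>i. X i \<omega>) [0..<Suc (length (w @ [y]))] = x # w @ [y]) \<longleftrightarrow>
      X (Suc n) \<omega> = y \<and> (\<forall>m\<le>n. X m \<omega> = g m)" for \<omega>
  proof -
    have e1: "map (\<lambda>i. X i \<omega>) [0..<Suc (length (w @ [y]))] = map (\<lambda>i. X i \<omega>) [0..<Suc n] @ [X (Suc n) \<omega>]"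
      by (simp add: n_def)
    have e2: "x # w @ [y] = (x # w) @ [y]" by simp
    show ?thesis unfolding e1 e2 append1_eq_conv hist by blast
  qed
  have IH: "\<P>(\<omega> in \<Omega>. \<forall>m\<le>n. X m \<omega> = g m) = pmf \<pi> x * path_prob Q 0 x w"
    using snoc.IH unfolding n_def[symmetric] hist .
  have prod: "\<P>(\<omega> in \<Omega>. X (Suc n) \<omega> = y \<and> (\<forall>m\<le>n. X m \<omega> = g m))
      = \<P>(\<omega> in \<Omega>. \<forall>m\<le>n. X m \<omega> = g m) * Q (Suc n) (g n) y"
  proof (cases "\<P>(\<omega> in \<Omega>. \<forall>m\<le>n. X m \<omega> = g m) > 0")
    case True
    have "\<P>(\<omega> in \<Omega>. X (Suc n) \<omega> = y \<bar> \<forall>m\<le>n. X m \<omega> = g m) = Q (Suc n) (g n) y"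
      using mc True unfolding markov_chain_def by blast
    then show ?thesis using True by (simp add: cond_prob_def divide_eq_eq mult.commute)
  next
    case False
    \<comment> \<open>On a null history the conditional law is unspecified, but both sides
      vanish.\<close>
    then have z: "\<P>(\<omega> in \<Omega>. \<forall>m\<le>n. X m \<omega> = g m) = 0"
      by (simp only: not_less measure_le_0_iff)
    have "\<P>(\<omega> in \<Omega>. X (Suc n) \<omega> = y \<and> (\<forall>m\<le>n. X m \<omega> = g m)) \<le> \<P>(\<omega> in \<Omega>. \<forall>m\<le>n. X m \<omega> = g m)"
      by (rule finite_measure_mono) auto
    then show ?thesis unfolding z by (simp only: measure_le_0_iff mult_zero_left)
  qed
  show ?case unfolding eq prod IH last by (simp add: path_prob_append n_def)
qed

text \<open>The Markov property at time \<open>k\<close>, obtained by summing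
  \<open>markov_chain_initial_path\<close> over all histories of length k + 1 that end in
  \<open>y\<close>.\<close>

lemma markov_chain_path_from:
  fixes Q :: "nat \<Rightarrow> 's::finite \<Rightarrow> 's \<Rightarrow> real"
  assumes mc: "markov_chain \<Omega> X \<pi> Q"
  shows "\<P>(\<omega> in \<Omega>. X k \<omega> = y \<and> map (\<lambda>i. X i \<omega>) [Suc k..<Suc k + length w] = w)
    = \<P>(\<omega> in \<Omega>. X k \<omega> = y) * path_prob Q k y w"
proof -
  interpret prob_space \<Omega> using mc by (simp add: markov_chain_def)
  have [measurable]: "X i \<in> measurable \<Omega> (count_space UNIV)" for i using mc by (simp add: markov_chain_def)
  define H where "H = {h. length h = Suc k \<and> last h = y}"
  have fH: "finite H" unfolding H_def by simp
  define E where "E h w = {\<omega> \<in> space \<Omega>. map (\<lambda>i. X i \<omega>) [0..<length (h @ w)] = h @ w}" for h w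
  have [measurable]: "E h w \<in> sets \<Omega>" for h w
    unfolding E_def by measurable
  have pE: "prob (E h w) = prob (E h []) * path_prob Q k y w" if hH: "h \<in> H" for h w
  proof -
    obtain x t where h: "h = x # t" using hH by (cases h) (auto simp: H_def)
    have "prob (E h w) = pmf \<pi> x * path_prob Q 0 x (t @ w)" for w
      using markov_chain_initial_path[OF mc, of "t @ w" x] by (simp add: E_def h)
    then show ?thesis using hH by (simp add: path_prob_append h H_def)
  qed
  have split: "{\<omega> \<in> space \<Omega>. X k \<omega> = y \<and> map (\<lambda>i. X i \<omega>) [Suc k..<Suc k + length w] = w} = (\<Union>h\<in>H. E h w)" for w
  proof (rule set_eqI)
    fix \<omega>
    have up: "map (\<lambda>i. X i \<omega>) [0..<Suc k + length w]
        = map (\<lambda>i. X i \<omega>) [0..<Suc k] @ map (\<lambda>i. X i \<omega>) [Suc k..<Suc k + length w]"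
      using upt_add_eq_append[of 0 "Suc k" "length w"] by simp
    have "\<omega> \<in> (\<Union>h\<in>H. E h w) \<longleftrightarrow> \<omega> \<in> space \<Omega> \<and>
        (\<exists>h\<in>H. map (\<lambda>i. X i \<omega>) [0..<Suc k] = h \<and> map (\<lambda>i. X i \<omega>) [Suc k..<Suc k + length w] = w)"
      unfolding E_def using up by (auto simp: H_def simp del: upt_Suc)
    also have "\<dots> \<longleftrightarrow> \<omega> \<in> space \<Omega> \<and> X k \<omega> = y \<and> map (\<lambda>i. X i \<omega>) [Suc k..<Suc k + length w] = w"
      by (auto simp: H_def)
    finally show "\<omega> \<in> {\<omega> \<in> space \<Omega>. X k \<omega> = y \<and> map (\<lambda>i. X i \<omega>) [Suc k..<Suc k + length w] = w}
        \<longleftrightarrow> \<omega> \<in> (\<Union>h\<in>H. E h w)" by blast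
  qed
  have disj: "disjoint_family_on (\<lambda>h. E h w) H" for w
    unfolding disjoint_family_on_def E_def H_def by auto
  have sum: "prob {\<omega> \<in> space \<Omega>. X k \<omega> = y \<and> map (\<lambda>i. X i \<omega>) [Suc k..<Suc k + length w] = w}
      = (\<Sum>h\<in>H. prob (E h w))" for w
    unfolding split by (rule finite_measure_finite_Union[OF fH _ disj]) auto
  have "prob {\<omega> \<in> space \<Omega>. X k \<omega> = y} = (\<Sum>h\<in>H. prob (E h []))" using sum[of "[]"] by simp
  then show ?thesis unfolding sum by (simp only: sum_distrib_right) (rule sum.cong[OF refl pE])
qed

lemma stage_probability:
  fixes Q :: "nat \<Rightarrow> 's::finite \<Rightarrow> 's \<Rightarrow> real"
  assumes mc: "markov_chain \<Omega> X \<pi> Q" and stg: "stage Q f k y m z s \<rho> c"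
    and good: "\<And>\<omega>. \<omega> \<in> space \<Omega> \<Longrightarrow> norm ((\<Sum>i=Suc k..k+m. f (X i \<omega>)) - s) \<le> \<rho> \<Longrightarrow> Z \<omega>"
    and [measurable]: "Measurable.pred \<Omega> Z"
  shows "\<P>(\<omega> in \<Omega>. X k \<omega> = y) * c \<le> \<P>(\<omega> in \<Omega>. Z \<omega>)"
proof -
  interpret prob_space \<Omega> using mc by (simp add: markov_chain_def)
  have [measurable]: "X i \<in> measurable \<Omega> (count_space UNIV)" for i using mc by (simp add: markov_chain_def)
  obtain W where W: "W \<subseteq> {w. length w = m \<and> last (y # w) = z \<and> norm (sum_list (map f w) - s) \<le> \<rho>}"
    "c \<le> (\<Sum>w\<in>W. path_prob Q k y w)" using stg unfolding stage_def by blast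
  have fW: "finite W" by (rule finite_subset[OF W(1)]) simp
  define E where "E w = {\<omega> \<in> space \<Omega>. X k \<omega> = y \<and> map (\<lambda>i. X i \<omega>) [Suc k..<Suc k + length w] = w}" for w
  have [measurable]: "E w \<in> sets \<Omega>" for w
    unfolding E_def by measurable
  have "\<P>(\<omega> in \<Omega>. X k \<omega> = y) * c \<le> \<P>(\<omega> in \<Omega>. X k \<omega> = y) * (\<Sum>w\<in>W. path_prob Q k y w)"
    by (intro mult_left_mono W(2)) simp
  also have "\<dots> = (\<Sum>w\<in>W. prob (E w))"
    unfolding E_def markov_chain_path_from[OF mc] by (simp add: sum_distrib_left)
  also have "\<dots> = prob (\<Union>w\<in>W. E w)"
  proof (rule finite_measure_finite_Union[symmetric, OF fW])
    show "disjoint_family_on E W"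
      unfolding disjoint_family_on_def E_def
    proof (intro ballI impI)
      fix u w assume "u \<in> W" "w \<in> W" "u \<noteq> w"
      moreover from this have "length u = length w" using W(1) by auto
      ultimately show "{\<omega> \<in> space \<Omega>. X k \<omega> = y \<and> map (\<lambda>i. X i \<omega>) [Suc k..<Suc k + length u] = u} \<inter>
          {\<omega> \<in> space \<Omega>. X k \<omega> = y \<and> map (\<lambda>i. X i \<omega>) [Suc k..<Suc k + length w] = w} = {}"
        by auto
    qed
  qed auto
  also have "\<dots> \<le> \<P>(\<omega> in \<Omega>. Z \<omega>)"
  proof (rule finite_measure_mono)
    show "(\<Union>w\<in>W. E w) \<subseteq> {\<omega> \<in> space \<Omega>. Z \<omega>}"
    proof clarify
      fix w \<omega> assume w: "w \<in> W" "\<omega> \<in> E w"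
      have "sum_list (map f w) = sum_list (map (\<lambda>i. f (X i \<omega>)) [Suc k..<Suc k + length w])"
      proof -
        have "w = map (\<lambda>i. X i \<omega>) [Suc k..<Suc k + length w]" using w(2) by (simp only: E_def mem_Collect_eq)
        then have "map f w = map f (map (\<lambda>i. X i \<omega>) [Suc k..<Suc k + length w])" by (rule arg_cong)
        then show ?thesis by (simp only: map_map comp_def)
      qed
      also have "\<dots> = (\<Sum>i=Suc k..k+m. f (X i \<omega>))"
        using w(1) W(1) by (auto simp: sum_list_distinct_conv_sum_set atLeastLessThanSuc_atLeastAtMost simp del: upt_Suc)
      finally show "\<omega> \<in> space \<Omega> \<and> Z \<omega>"
        using good[of \<omega>] w W(1) by (auto simp: E_def)
    qed
  qed auto
  finally show ?thesis .
qed

text \<open>A corridor with V = 1 fills all but boundedly many of the first \<open>n\<close> steps,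
  so the remaining steps, before and after it, move the sample mean by O(1/n) only.\<close>

lemma corridor_log_rate:
  fixes Q :: "nat \<Rightarrow> 's::finite \<Rightarrow> 's \<Rightarrow> real" and f :: "'s \<Rightarrow> real ^ 'd"
  assumes mc: "markov_chain \<Omega> X \<pi> Q" and F: "\<And>y. norm (f y) \<le> F"
    and cor: "corridor Q f k y z 1 Y c"
    and pos: "\<P>(\<omega> in \<Omega>. X k \<omega> = y) > 0" and "open U" "Y \<in> U"
  shows "ereal (- c) \<le> log_rate (\<lambda>n. \<P>(\<omega> in \<Omega>. sample_mean X f n \<omega> \<in> U))"
proof -
  let ?p = "\<lambda>n. \<P>(\<omega> in \<Omega>. sample_mean X f n \<omega> \<in> U)"
  interpret prob_space \<Omega> using mc by (simp add: markov_chain_def)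
  have [measurable]: "X i \<in> measurable \<Omega> (count_space UNIV)" for i using mc by (simp add: markov_chain_def)
  have [measurable]: "U \<in> sets borel" using \<open>open U\<close> by simp
  have fX [measurable]: "(\<lambda>\<omega>. f (X i \<omega>)) \<in> borel_measurable \<Omega>" for i
    by (rule measurable_compose[of "X i" _ "count_space UNIV"]) auto
  have pred: "Measurable.pred \<Omega> (\<lambda>\<omega>. sample_mean X f n \<omega> \<in> U)" for n
    unfolding sample_mean_def by measurable
  obtain \<delta> where \<delta>: "\<delta> > 0" "ball Y \<delta> \<subseteq> U" using \<open>open U\<close> \<open>Y \<in> U\<close> openE by blast
  have F0: "0 \<le> F" using F norm_ge_zero order_trans by blast
  define p where "p = \<P>(\<omega> in \<Omega>. X k \<omega> = y)"
  \<comment> \<open>One \<epsilon> is the loss of the corridor, the other absorbs the constant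
    \<open>D\<close> once n \<epsilon> \<ge> D. The restriction \<epsilon> \<le> \<delta>/2 leaves
    half of the radius for the bounded error \<open>A\<close>.\<close>
  have rate: "ereal (- c - 2 * \<epsilon>) \<le> log_rate ?p"
    if \<epsilon>: "\<epsilon> > 0" "\<epsilon> \<le> \<delta> / 2" for \<epsilon>
  proof -
    obtain K where K: "\<And>n. n \<ge> K \<Longrightarrow> \<exists>m\<ge>0. \<bar>real m - real n * 1\<bar> \<le> real K \<and>
      stage Q f k y m z (real n *\<^sub>R Y) (real n * \<epsilon> + real K) (exp (- (real n * (c + \<epsilon>)) - real K))"
      using cor \<epsilon>(1) unfolding corridor_def by meson
    define A where "A = F * (2 * real k + 2 * real K) + (real K + real k) * norm Y + real K"
    define D where "D = (real K + real k) * \<bar>c + \<epsilon>\<bar> + real K - ln p"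
    have "eventually (\<lambda>n. ereal (- c - 2 * \<epsilon>) \<le> log_rate_seq ?p n) sequentially"
      using eventually_ge_at_top[of "2 * K + k + 1"]
        eventually_gt_at_top[of "nat \<lceil>2 * A / \<delta>\<rceil>"] eventually_ge_at_top[of "nat \<lceil>D / \<epsilon>\<rceil>"]
    proof eventually_elim
      case (elim n)
      have n0: "real n > 0" using elim(1) by simp
      have nA: "2 * A < real n * \<delta>"
      proof -
        have "2 * A / \<delta> < real n"
          using elim(2) real_nat_ceiling_ge[of "2 * A / \<delta>"] by linarith
        then show ?thesis using \<delta>(1) by (simp add: pos_divide_less_eq)
      qed
      have nD: "D \<le> real n * \<epsilon>"
        using elim(3) \<epsilon>(1) by (metis order_trans real_nat_ceiling_ge of_nat_le_iff pos_divide_le_eq)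
      \<comment> \<open>The corridor is used at a smaller parameter: its length may exceed n' by
        \<open>K\<close> and it starts at time \<open>k\<close>, so it ends by time
        \<open>n\<close>, leaving at most 2 K steps.\<close>
      define n' where "n' = n - (K + k)"
      have n': "real n' = real n - real K - real k" "n' \<ge> K" using elim(1) by (auto simp: n'_def)
      obtain m where m: "\<bar>real m - real n'\<bar> \<le> real K"
        and stg: "stage Q f k y m z (real n' *\<^sub>R Y) (real n' * \<epsilon> + real K) (exp (- (real n' * (c + \<epsilon>)) - real K))"
        using K[OF n'(2)] by auto
      have km: "k + m \<le> n" "real n - real (k + m) \<le> 2 * real K" using m n' by linarith+
      have "p * exp (- (real n' * (c + \<epsilon>)) - real K) \<le> ?p n"
        unfolding p_def
      proof (rule stage_probability[OF mc stg _ pred])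
        fix \<omega> assume h: "norm ((\<Sum>i=Suc k..k+m. f (X i \<omega>)) - real n' *\<^sub>R Y) \<le> real n' * \<epsilon> + real K"
        have bd: "norm (\<Sum>i\<in>I. f (X i \<omega>)) \<le> F * real (card I)" for I
          using sum_norm_le[of I "\<lambda>i. f (X i \<omega>)" "\<lambda>_. F"] F by (simp add: mult.commute)
        define a where "a = (\<Sum>i=1..k. f (X i \<omega>))"
        define b where "b = (\<Sum>i=Suc k..k+m. f (X i \<omega>))"
        define d where "d = (\<Sum>i=Suc (k+m)..n. f (X i \<omega>))"
        have "(\<Sum>i=1..n. f (X i \<omega>)) = a + b + d"
        proof -
          have "{1..n} = {1..k+m} \<union> {Suc (k+m)..n}" "{1..k+m} = {1..k} \<union> {Suc k..k+m}"
            using km(1) by auto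
          moreover have "(\<Sum>i\<in>{1..k+m} \<union> {Suc (k+m)..n}. f (X i \<omega>)) = (\<Sum>i\<in>{1..k+m}. f (X i \<omega>)) + d"
            unfolding d_def by (rule sum.union_disjoint) auto
          moreover have "(\<Sum>i\<in>{1..k} \<union> {Suc k..k+m}. f (X i \<omega>)) = a + b"
            unfolding a_def b_def by (rule sum.union_disjoint) auto
          ultimately show ?thesis by metis
        qed
        then have "(\<Sum>i=1..n. f (X i \<omega>)) - real n *\<^sub>R Y = a + d + (b - real n' *\<^sub>R Y) - (real K + real k) *\<^sub>R Y"
          by (simp add: n' algebra_simps)
        also have "norm \<dots> \<le> norm a + norm d + norm (b - real n' *\<^sub>R Y) + (real K + real k) * norm Y"
          by (smt (verit, best) norm_scaleR norm_triangle_ineq norm_triangle_ineq4 of_nat_0_le_iff)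
        also have "\<dots> \<le> F * real k + F * (2 * real K) + (real n' * \<epsilon> + real K) + (real K + real k) * norm Y"
        proof -
          have "norm d \<le> F * real (n - (k + m))" using bd[of "{Suc (k+m)..n}"] by (simp add: d_def)
          also have "\<dots> \<le> F * (2 * real K)" using km F0 by (intro mult_left_mono) auto
          finally have "norm d \<le> F * (2 * real K)" .
          moreover have "norm a \<le> F * real k" using bd[of "{1..k}"] by (simp add: a_def)
          ultimately show ?thesis using h by (simp add: b_def)
        qed
        also have "\<dots> \<le> A + real n * \<epsilon>"
        proof -
          have "real n' * \<epsilon> \<le> real n * \<epsilon>" using n' \<epsilon>(1) by (intro mult_right_mono) auto
          moreover have "0 \<le> F * real k" using F0 by simp
          ultimately show ?thesis by (simp add: A_def algebra_simps)
        qed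
        also have "\<dots> < real n * \<delta>"
          using nA mult_left_mono[OF \<epsilon>(2), of "real n"] by simp
        finally have lt: "norm ((\<Sum>i=1..n. f (X i \<omega>)) - real n *\<^sub>R Y) < real n * \<delta>" .
        have "sample_mean X f n \<omega> - Y = (1 / real n) *\<^sub>R ((\<Sum>i=1..n. f (X i \<omega>)) - real n *\<^sub>R Y)"
          using n0 by (simp add: sample_mean_def scaleR_diff_right)
        then have "norm (sample_mean X f n \<omega> - Y)
            = norm ((\<Sum>i=1..n. f (X i \<omega>)) - real n *\<^sub>R Y) / real n"
          by (simp only: norm_scaleR) simp
        also have "\<dots> < \<delta>" using lt n0 by (simp only: pos_divide_less_eq mult.commute)
        finally have "norm (sample_mean X f n \<omega> - Y) < \<delta>" .
        then show "sample_mean X f n \<omega> \<in> U" using \<delta>(2) by (auto simp: dist_norm norm_minus_commute)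
      qed
      moreover have "exp (real n * (- c - 2 * \<epsilon>)) \<le> p * exp (- (real n' * (c + \<epsilon>)) - real K)"
      proof -
        have "(real K + real k) * (c + \<epsilon>) \<ge> - ((real K + real k) * \<bar>c + \<epsilon>\<bar>)"
          by (metis abs_ge_minus_self abs_mult abs_of_nonneg add_nonneg_nonneg minus_le_iff of_nat_0_le_iff)
        then have "real n * (- c - 2 * \<epsilon>) \<le> ln p + (- (real n' * (c + \<epsilon>)) - real K)"
          using nD by (simp add: D_def n' algebra_simps)
        then have "exp (real n * (- c - 2 * \<epsilon>)) \<le> exp (ln p + (- (real n' * (c + \<epsilon>)) - real K))" by simp
        then show ?thesis using pos by (simp only: exp_add p_def exp_ln)
      qed
      ultimately have le: "exp (real n * (- c - 2 * \<epsilon>)) \<le> ?p n" by linarith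
      then have q: "0 < ?p n" by (meson exp_gt_zero less_le_trans)
      then have "real n * (- c - 2 * \<epsilon>) \<le> ln (?p n)"
        using le by (simp add: ln_ge_iff)
      then have "- c - 2 * \<epsilon> \<le> (1 / real n) * ln (?p n)"
        using n0 by (simp add: field_simps)
      then show ?case using q by (simp add: log_rate_seq_def elog_def)
    qed
    then show ?thesis unfolding log_rate_def by (rule Liminf_bounded)
  qed
  show ?thesis
  proof (rule ereal_le_epsilon2)
    fix e :: real assume "0 < e"
    define \<epsilon> where "\<epsilon> = min (e / 2) (\<delta> / 2)"
    have "\<epsilon> > 0" "\<epsilon> \<le> \<delta> / 2" "2 * \<epsilon> \<le> e" using \<open>0 < e\<close> \<delta>(1) by (auto simp: \<epsilon>_def)
    with rate[of \<epsilon>] have "ereal (- c - 2 * \<epsilon>) \<le> log_rate ?p" by simp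
    moreover have "ereal (- c) \<le> ereal (- c - 2 * \<epsilon>) + ereal e" using \<open>2 * \<epsilon> \<le> e\<close> by simp
    ultimately show "ereal (- c) \<le> log_rate ?p + ereal e"
      by (meson add_right_mono order_trans)
  qed
qed

section \<open>Links between classes\<close>

text \<open>Unlike a link, \<open>reach\<close> lets the end point depend on the starting time: under Assumptions B and C
  the best jump between two classes varies with time.\<close>

definition reach ::
  "(nat \<Rightarrow> 's \<Rightarrow> 's \<Rightarrow> real) \<Rightarrow> 's set \<Rightarrow> 's set \<Rightarrow> ereal \<Rightarrow> bool"
where
  "reach Q B B' u \<longleftrightarrow>
     (\<forall>c. ereal c < u \<longrightarrow> (\<exists>K. \<forall>k\<ge>K. \<forall>y\<in>B.
        \<exists>w. length w \<le> K \<and> last (y # w) \<in> B' \<and> exp (c * real k - real K) \<le> path_prob Q k y w))"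

lemma link_imp_reach: "link Q B B' u \<Longrightarrow> B' \<noteq> {} \<Longrightarrow> reach Q B B' u"
  unfolding link_def reach_def by (metis equals0I)

lemma link_subset: "link Q B B' u \<Longrightarrow> A \<subseteq> B \<Longrightarrow> A' \<subseteq> B' \<Longrightarrow> link Q A A' u"
  unfolding link_def by (meson subsetD)

lemma link_minus_infinity [simp]: "link Q B B' (- \<infinity>)"
  by (simp add: link_def)

text \<open>The second word starts at most \<open>K1\<close> steps later than the first, which
  alters its exponent by a bounded amount. Nonpositivity of the rates rules out \<infinity> -
  \<infinity>.\<close>

lemma reach_link_trans:
  fixes Q :: "nat \<Rightarrow> 's \<Rightarrow> 's \<Rightarrow> real"
  assumes nn: "\<And>n s t. n \<ge> 1 \<Longrightarrow> 0 \<le> Q n s t"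
    and 1: "reach Q A B u" and 2: "link Q B D v" and "u \<le> 0" "v \<le> 0"
  shows "link Q A D (u + v)"
proof (cases "u = -\<infinity> \<or> v = -\<infinity>")
  case True
  then have e: "u + v = -\<infinity>" using assms(4,5) by (cases u; cases v) auto
  show ?thesis unfolding e by (rule link_minus_infinity)
next
  case False
  then obtain u' v' where uv: "u = ereal u'" "v = ereal v'" using assms(4,5)
    by (cases u; cases v) auto
  show ?thesis
    unfolding link_def
  proof (intro allI impI)
    fix c assume "ereal c < u + v"
    then have c: "c < u' + v'" by (simp add: uv)
    define \<delta> where "\<delta> = (u' + v' - c) / 2"
    have \<delta>: "\<delta> > 0" "c = (u' - \<delta>) + (v' - \<delta>)" using c by (auto simp: \<delta>_def field_simps)
    obtain K1 where K1: "\<And>k y. k \<ge> K1 \<Longrightarrow> y \<in> A \<Longrightarrow> \<exists>w. length w \<le> K1 \<and> last (y # w) \<in> B \<and>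
        exp ((u' - \<delta>) * real k - real K1) \<le> path_prob Q k y w"
      using 1[unfolded reach_def, rule_format, of "u' - \<delta>"] uv \<delta> by auto
    obtain K2 where K2: "\<And>k y z. k \<ge> K2 \<Longrightarrow> y \<in> B \<Longrightarrow> z \<in> D \<Longrightarrow> \<exists>w. length w \<le> K2 \<and> last (y # w) = z \<and>
        exp ((v' - \<delta>) * real k - real K2) \<le> path_prob Q k y w"
    proof -
      have "ereal (v' - \<delta>) < v" using uv \<delta> by simp
      with 2 show ?thesis unfolding link_def using that by meson
    qed
    define K where "K = K1 + K2 + nat \<lceil>\<bar>v' - \<delta>\<bar> * real K1\<rceil>"
    have K: "real K1 + real K2 + \<bar>v' - \<delta>\<bar> * real K1 \<le> real K"
      unfolding K_def using real_nat_ceiling_ge[of "\<bar>v' - \<delta>\<bar> * real K1"] by simp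
    show "\<exists>K. \<forall>k\<ge>K. \<forall>y\<in>A. \<forall>z\<in>D.
        \<exists>w. length w \<le> K \<and> last (y # w) = z \<and> exp (c * real k - real K) \<le> path_prob Q k y w"
    proof (rule exI[of _ K], intro allI impI ballI)
      fix k y z assume h: "k \<ge> K" "y \<in> A" "z \<in> D"
      have "k \<ge> K1" "k \<ge> K2" using h(1) by (auto simp: K_def)
      obtain w where w: "length w \<le> K1" "last (y # w) \<in> B"
        "exp ((u' - \<delta>) * real k - real K1) \<le> path_prob Q k y w"
        using K1[OF \<open>k \<ge> K1\<close> h(2)] by blast
      obtain x where x: "length x \<le> K2" "last (last (y # w) # x) = z"
        "exp ((v' - \<delta>) * real (k + length w) - real K2) \<le> path_prob Q (k + length w) (last (y # w)) x"
        using K2[of "k + length w", OF _ w(2) h(3)] \<open>k \<ge> K2\<close> by auto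
      have "\<bar>(v' - \<delta>) * real (length w)\<bar> \<le> \<bar>v' - \<delta>\<bar> * real K1"
        unfolding abs_mult using w(1) by (intro mult_left_mono) auto
      then have "c * real k - real K \<le> ((u' - \<delta>) * real k - real K1) + ((v' - \<delta>) * real (k + length w) - real K2)"
        unfolding \<delta>(2) using K by (simp add: algebra_simps)
      then have "exp (c * real k - real K)
          \<le> exp ((u' - \<delta>) * real k - real K1) * exp ((v' - \<delta>) * real (k + length w) - real K2)"
        by (simp only: exp_add[symmetric] exp_le_cancel_iff)
      also have "\<dots> \<le> path_prob Q k y w * path_prob Q (k + length w) (last (y # w)) x"
        using w(3) x(3) nn by (intro mult_mono path_prob_nonneg) auto
      also have "\<dots> = path_prob Q k y (w @ x)" by (simp add: path_prob_append)
      finally have "exp (c * real k - real K) \<le> path_prob Q k y (w @ x)" .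
      moreover have "last (y # w @ x) = z" using x(2) by (auto simp: last_append split: if_splits)
      moreover have "length (w @ x) \<le> K" using w(1) x(1) by (simp add: K_def)
      ultimately show "\<exists>w. length w \<le> K \<and> last (y # w) = z \<and> exp (c * real k - real K) \<le> path_prob Q k y w"
        by blast
    qed
  qed
qed

section \<open>Exponential rates of sequences\<close>

lemma log_rate_greater_imp_exp_le:
  assumes "ereal c < log_rate a"
  shows "\<exists>K. \<forall>n\<ge>K. exp (c * real n) \<le> a n"
proof -
  have "eventually (\<lambda>n. ereal c < log_rate_seq a n) sequentially"
    using assms unfolding log_rate_def by (rule less_LiminfD)
  then obtain K where K: "\<And>n. n \<ge> K \<Longrightarrow> ereal c < log_rate_seq a n" by (auto simp: eventually_sequentially)
  \<comment> \<open>Index 0 is avoided because there the factor 1 / n of \<open>log_rate_seq\<close>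
    is 0 and gives no information.\<close>
  have "exp (c * real n) \<le> a n" if n: "n \<ge> max K 1" for n
  proof -
    have lt: "ereal c < ereal (1 / real n) * elog (a n)" using K[of n] n by (simp add: log_rate_seq_def)
    have pos: "0 < a n"
    proof (rule ccontr)
      assume "\<not> 0 < a n"
      then show False using lt n by (simp add: elog_def)
    qed
    then have "c < ln (a n) / real n" using lt by (simp add: elog_def)
    then have "c * real n \<le> ln (a n)" using n by (simp add: pos_less_divide_eq)
    then show ?thesis using pos by (metis exp_le_cancel_iff exp_ln)
  qed
  then show ?thesis by blast
qed

lemma log_rate_nonpos:
  assumes "\<And>n. n \<ge> 1 \<Longrightarrow> a n \<le> 1"
  shows "log_rate a \<le> 0"
proof (rule ccontr)
  assume "\<not> log_rate a \<le> 0"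
  then obtain c where c: "0 < ereal c" "ereal c < log_rate a" using ereal_dense2[of 0 "log_rate a"] by (auto simp: not_le)
  obtain K where "\<And>n. n \<ge> K \<Longrightarrow> exp (c * real n) \<le> a n" using log_rate_greater_imp_exp_le[OF c(2)] by blast
  then have "exp (c * real (max K 1)) \<le> 1" using assms[of "max K 1"] by (meson max.cobounded1 max.cobounded2 order_trans)
  then show False using c(1) by (simp add: mult_le_0_iff max_def split: if_splits)
qed

section \<open>Maxima over routes and the cost T1\<close>

lemma Max_image_attained:
  assumes "finite A" "A \<noteq> {}"
  shows "\<exists>a\<in>A. (MAX a\<in>A. g a) = g a"
proof -
  have "Max (g ` A) \<in> g ` A" using assms by (intro Max_in) auto
  then show ?thesis by blast
qed

lemma finite_routes: "finite (routes K i j k)"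
  by (rule finite_subset[OF _ finite_lists_length_eq[of "{1..K}" "k + 2"]]) (auto simp: routes_def)

lemma routes_nth:
  assumes "L \<in> routes K i j k" "s < k + 2"
  shows "L ! s \<in> {1..K}"
proof -
  have "L ! s \<in> set L" using assms by (intro nth_mem) (simp add: routes_def)
  moreover have "set L \<subseteq> {1..K}" using assms(1) by (simp add: routes_def)
  ultimately show ?thesis by (rule rev_subsetD)
qed

lemma routes_nonempty:
  assumes "i \<in> {1..K}" "j \<in> {1..K}" "i \<noteq> j" "k \<le> K - 2"
  shows "routes K i j k \<noteq> {}"
proof -
  have "card ({1..K} - {i, j}) = K - 2"
    using assms(1-3) by (subst card_Diff_subset) auto
  then obtain T where T: "T \<subseteq> {1..K} - {i, j}" "card T = k"
    using obtain_subset_with_card_n[of k "{1..K} - {i, j}"] assms(4) by metis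
  obtain L where L: "set L = T" "distinct L"
    using finite_distinct_list[of T] T(1) finite_subset by blast
  then have "length L = k" using T(2) distinct_card by metis
  then have "i # L @ [j] \<in> routes K i j k"
    using L T assms by (auto simp: routes_def nth_append)
  then show ?thesis by blast
qed

lemma finite_sojourns: "finite (sojourns r N M k)"
proof (rule finite_subset[OF _ finite_lists_length_eq[of "{0..r + 1}" "k + 2"]])
  show "sojourns r N M k \<subseteq> {xs. set xs \<subseteq> {0..r + 1} \<and> length xs = k + 2}"
  proof clarify
    fix Q assume Q: "Q \<in> sojourns r N M k"
    have "q \<le> r + 1" if qQ: "q \<in> set Q" for q
    proof -
      obtain s where s: "s < k + 2" "q = Q ! s" using qQ Q by (auto simp: in_set_conv_nth sojourns_def)
      then consider "s = 0" | "s = k + 1" | "s \<in> {1..k}" by force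
      then show ?thesis using Q s by cases (auto simp: sojourns_def)
    qed
    then show "set Q \<subseteq> {0..r + 1} \<and> length Q = k + 2" using Q by (auto simp: sojourns_def)
  qed
qed auto

text \<open>The tuple of ones fits: k + 2 \<le> N + M \<le> \<open>E0 r N M\<close>. This includes M
  = 1, where \<open>M - 2\<close> is truncated to 0.\<close>

lemma sojourns_nonempty:
  assumes "r \<ge> 1" "M \<ge> 1" "N + M \<ge> 2" "k \<le> N + M - 2"
  shows "sojourns r N M k \<noteq> {}"
proof -
  have "2 * (M - 2) \<le> (r + 1) * (M - 2)" using assms(1) by (intro mult_right_mono) auto
  then have "k + 2 \<le> E0 r N M" using assms unfolding E0_def by linarith
  then have "replicate (k + 2) 1 \<in> sojourns r N M k"
    using assms(1) by (auto simp: sojourns_def sum_list_replicate nth_append simp del: replicate_Suc)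
  then show ?thesis by blast
qed

lemma finite_route_paths: "finite (route_paths C L Q)" for C :: "nat \<Rightarrow> 's::finite set"
proof -
  define q where "q = Max (insert 0 ((!) Q ` {..<length L}))"
  have "route_paths C L Q \<subseteq> {V. set V \<subseteq> {v. set v \<subseteq> UNIV \<and> length v \<le> q} \<and> length V = length L}"
  proof clarify
    fix V assume V: "V \<in> route_paths C L Q"
    have "length v \<le> q" if vV: "v \<in> set V" for v
    proof -
      obtain s where "s < length L" "v = V ! s" using vV V by (auto simp: in_set_conv_nth route_paths_def)
      then show ?thesis using V unfolding q_def by (intro Max_ge) (auto simp: route_paths_def)
    qed
    then show "set V \<subseteq> {v. set v \<subseteq> UNIV \<and> length v \<le> q} \<and> length V = length L"
      using V by (auto simp: route_paths_def)
  qed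
  then show ?thesis
    by (rule finite_subset) (intro finite_lists_length_eq finite_lists_length_le finite)
qed

lemma route_paths_nonempty:
  assumes "\<And>s. s < length L \<Longrightarrow> C (L ! s) \<noteq> {}"
  shows "route_paths C L Q \<noteq> {}"
proof -
  define V where "V = map (\<lambda>s. replicate (Q ! s) (SOME x. x \<in> C (L ! s))) [0..<length L]"
  have "(SOME x. x \<in> C (L ! s)) \<in> C (L ! s)" if "s < length L" for s
    using assms[OF that] some_in_eq by blast
  then have "V \<in> route_paths C L Q"
    unfolding route_paths_def V_def by auto
  then show ?thesis by blast
qed

text \<open>Of the four nested maxima a \<open>link\<close> needs only one maximising word and a
  bound on its length that is uniform in \<open>n\<close>, \<open>y\<close> and \<open>z\<close>.
  The finiteness and nonemptiness facts above give \<open>Max\<close> its meaning here.\<close>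

lemma gamma_points_attained:
  fixes Q :: "nat \<Rightarrow> 's::finite \<Rightarrow> 's \<Rightarrow> real"
  assumes "i \<in> {1..N+M}" "j \<in> {1..N+M}" "i \<noteq> j" "1 \<le> M" and ne: "\<And>l. l \<in> {1..N+M} \<Longrightarrow> C l \<noteq> {}"
  shows "\<exists>w. length w \<le> E0 CARD('s) N M + 1 \<and> last (y # w) = z \<and>
    gamma_points Q C N M i j n y z = path_prob Q (n - 1) y w"
proof -
  have K2: "N + M \<ge> 2" using assms(1-3) by (cases "N + M"; cases "N + M - 1") auto
  have r: "CARD('s) \<ge> 1" by (simp add: Suc_leI)
  have "\<exists>k\<in>{0..N+M-2}. gamma_points Q C N M i j n y z =
      (MAX L\<in>routes (N+M) i j k. MAX q\<in>sojourns CARD('s) N M k.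
        MAX V\<in>route_paths C L q. path_prob Q (n - 1) y (concat V @ [z]))"
    unfolding gamma_points_def by (rule Max_image_attained) auto
  then obtain k where k: "k \<in> {0..N+M-2}" and 1: "gamma_points Q C N M i j n y z =
      (MAX L\<in>routes (N+M) i j k. MAX q\<in>sojourns CARD('s) N M k.
        MAX V\<in>route_paths C L q. path_prob Q (n - 1) y (concat V @ [z]))" ..
  have "routes (N+M) i j k \<noteq> {}" using k by (intro routes_nonempty assms(1-3)) auto
  from Max_image_attained[OF finite_routes this]
  obtain L where L: "L \<in> routes (N+M) i j k" and 2: "gamma_points Q C N M i j n y z =
      (MAX q\<in>sojourns CARD('s) N M k. MAX V\<in>route_paths C L q. path_prob Q (n - 1) y (concat V @ [z]))"
    unfolding 1 by blast
  have "sojourns CARD('s) N M k \<noteq> {}" using k by (intro sojourns_nonempty r assms(4) K2) auto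
  from Max_image_attained[OF finite_sojourns this]
  obtain q where q: "q \<in> sojourns CARD('s) N M k" and 3: "gamma_points Q C N M i j n y z =
      (MAX V\<in>route_paths C L q. path_prob Q (n - 1) y (concat V @ [z]))"
    unfolding 2 by blast
  have "C (L ! s) \<noteq> {}" if "s < length L" for s
  proof (rule ne)
    have "L ! s \<in> set L" using that by simp
    then show "L ! s \<in> {1..N+M}" using L by (auto simp: routes_def)
  qed
  from Max_image_attained[OF finite_route_paths route_paths_nonempty[of L C q, OF this]]
  obtain V where V: "V \<in> route_paths C L q" and 4: "gamma_points Q C N M i j n y z =
      path_prob Q (n - 1) y (concat V @ [z])"
    unfolding 3 by blast
  have "map length V = q"
    using V q L by (intro nth_equalityI) (auto simp: route_paths_def sojourns_def routes_def)
  then have "length (concat V @ [z]) \<le> E0 CARD('s) N M + 1"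
    using q by (simp add: length_concat sojourns_def)
  then show ?thesis using 4 by (intro exI[of _ "concat V @ [z]"]) simp
qed

lemma gamma_classes_le:
  "y \<in> C i \<Longrightarrow> z \<in> C j \<Longrightarrow> gamma_classes Q C N M i j n \<le> gamma_points Q C N M i j n y z"
  unfolding gamma_classes_def
  using cINF_lower[of "\<lambda>(y, z). gamma_points Q C N M i j n y z" "C i \<times> C j" "(y, z)"] by simp

lemma T1_cost_link:
  fixes Q :: "nat \<Rightarrow> 's::finite \<Rightarrow> 's \<Rightarrow> real"
  assumes "i \<in> {1..N+M}" "j \<in> {1..N+M}" "i \<noteq> j" "1 \<le> M" and ne: "\<And>l. l \<in> {1..N+M} \<Longrightarrow> C l \<noteq> {}"
  shows "link Q (C i) (C j) (T1_cost Q C N M i j)"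
  unfolding link_def
proof (intro allI impI)
  fix c assume "ereal c < T1_cost Q C N M i j"
  then obtain K where K: "\<And>n. n \<ge> K \<Longrightarrow> exp (c * real n) \<le> gamma_classes Q C N M i j n"
    unfolding T1_cost_def using log_rate_greater_imp_exp_le by blast
  \<comment> \<open>Leaving at time \<open>k\<close> corresponds to index k + 1 of the sequence; the
    term |c| pays for this shift.\<close>
  define K' where "K' = K + E0 CARD('s) N M + 1 + nat \<lceil>\<bar>c\<bar>\<rceil>"
  show "\<exists>K. \<forall>k\<ge>K. \<forall>y\<in>C i. \<forall>z\<in>C j. \<exists>w. length w \<le> K \<and> last (y # w) = z \<and>
      exp (c * real k - real K) \<le> path_prob Q k y w"
  proof (rule exI[of _ K'], intro allI impI ballI)
    fix k y z assume h: "k \<ge> K'" "y \<in> C i" "z \<in> C j"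
    obtain w where w: "length w \<le> E0 CARD('s) N M + 1" "last (y # w) = z"
      "gamma_points Q C N M i j (Suc k) y z = path_prob Q k y w"
      using gamma_points_attained[where C = C and y = y and z = z and n = "Suc k" and Q = Q, OF assms] by auto
    have "\<bar>c\<bar> \<le> real K'" using real_nat_ceiling_ge[of "\<bar>c\<bar>"] unfolding K'_def of_nat_add by linarith
    then have "exp (c * real k - real K') \<le> exp (c * real (Suc k))" by (simp add: algebra_simps)
    also have "\<dots> \<le> gamma_points Q C N M i j (Suc k) y z"
      using K[of "Suc k"] gamma_classes_le[OF h(2,3), of Q N M "Suc k"] h(1) by (simp add: K'_def)
    finally show "\<exists>w. length w \<le> K' \<and> last (y # w) = z \<and> exp (c * real k - real K') \<le> path_prob Q k y w"
      using w by (intro exI[of _ w]) (auto simp: K'_def)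
  qed
qed

lemma T1_cost_nonpos:
  fixes Q :: "nat \<Rightarrow> 's::finite \<Rightarrow> 's \<Rightarrow> real"
  assumes "i \<in> {1..N+M}" "j \<in> {1..N+M}" "i \<noteq> j" "1 \<le> M" and ne: "\<And>l. l \<in> {1..N+M} \<Longrightarrow> C l \<noteq> {}"
    and st: "\<And>n. n \<ge> 1 \<Longrightarrow> stochastic (Q n)"
  shows "T1_cost Q C N M i j \<le> 0"
  unfolding T1_cost_def
proof (rule log_rate_nonpos)
  fix n :: nat
  obtain y z where yz: "y \<in> C i" "z \<in> C j" using ne assms(1,2) by blast
  obtain w where "gamma_points Q C N M i j n y z = path_prob Q (n - 1) y w"
    using gamma_points_attained[where C = C and y = y and z = z and n = n and Q = Q, OF assms(1-5)] by auto
  then show "gamma_classes Q C N M i j n \<le> 1"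
    using gamma_classes_le[OF yz, of Q N M n] path_prob_le_1[of "n - 1" Q y w] st by fastforce
qed

section \<open>Direct jumps and the cost T0\<close>

lemma max_entry_attained:
  fixes Q :: "nat \<Rightarrow> 's::finite \<Rightarrow> 's \<Rightarrow> real"
  assumes "C i \<noteq> {}" "C j \<noteq> {}"
  shows "\<exists>x\<in>C i. \<exists>y\<in>C j. max_entry Q C i j n = Q n x y"
proof -
  have "\<exists>p\<in>C i \<times> C j. max_entry Q C i j n = (case p of (x, y) \<Rightarrow> Q n x y)"
    unfolding max_entry_def by (rule Max_image_attained) (use assms in auto)
  then show ?thesis by auto
qed

lemma stochastic_entry_le_1: "stochastic A \<Longrightarrow> A x y \<le> 1"
  using member_le_sum[of y UNIV "A x"] by (simp add: stochastic_def)

lemma tau_nonpos: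
  fixes Q :: "nat \<Rightarrow> 's::finite \<Rightarrow> 's \<Rightarrow> real"
  assumes "C i \<noteq> {}" "C j \<noteq> {}" and st: "\<And>n. n \<ge> 1 \<Longrightarrow> stochastic (Q n)"
  shows "tau Q C i j \<le> 0"
  unfolding tau_def
proof (rule log_rate_nonpos)
  fix n :: nat assume "n \<ge> 1"
  then show "max_entry Q C i j n \<le> 1"
    using max_entry_attained[of C i j Q n] assms(1,2) stochastic_entry_le_1[OF st[OF \<open>n \<ge> 1\<close>]] by auto
qed

lemma T0_cost_attained:
  assumes "i \<in> {1..N+M}" "j \<in> {1..N+M}" "i \<noteq> j"
  shows "\<exists>k. \<exists>L\<in>routes (N+M) i j k. T0_cost Q C N M i j = (\<Sum>s=0..k. tau Q C (L ! s) (L ! (s+1)))"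
proof -
  have "\<exists>k\<in>{0..N+M-2}. T0_cost Q C N M i j =
      (MAX L\<in>routes (N+M) i j k. \<Sum>s=0..k. tau Q C (L ! s) (L ! (s+1)))"
    unfolding T0_cost_def by (rule Max_image_attained) auto
  then obtain k where k: "k \<in> {0..N+M-2}" and 1: "T0_cost Q C N M i j =
      (MAX L\<in>routes (N+M) i j k. \<Sum>s=0..k. tau Q C (L ! s) (L ! (s+1)))" ..
  have "routes (N+M) i j k \<noteq> {}" using k by (intro routes_nonempty assms) auto
  from Max_image_attained[OF finite_routes this]
  have "\<exists>L\<in>routes (N+M) i j k. T0_cost Q C N M i j = (\<Sum>s=0..k. tau Q C (L ! s) (L ! (s+1)))"
    unfolding 1 .
  then show ?thesis by blast
qed

lemma T0_cost_nonpos: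
  fixes Q :: "nat \<Rightarrow> 's::finite \<Rightarrow> 's \<Rightarrow> real"
  assumes "i \<in> {1..N+M}" "j \<in> {1..N+M}" "i \<noteq> j" and ne: "\<And>l. l \<in> {1..N+M} \<Longrightarrow> C l \<noteq> {}"
    and st: "\<And>n. n \<ge> 1 \<Longrightarrow> stochastic (Q n)"
  shows "T0_cost Q C N M i j \<le> 0"
proof -
  obtain k L where L: "L \<in> routes (N+M) i j k"
    "T0_cost Q C N M i j = (\<Sum>s=0..k. tau Q C (L ! s) (L ! (s+1)))"
    using T0_cost_attained[OF assms(1-3)] by blast
  have "L ! s \<in> {1..N+M}" if "s < k + 2" for s
    using routes_nth[OF L(1) that] .
  then show ?thesis unfolding L(2) by (intro sum_nonpos tau_nonpos ne st) auto
qed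

text \<open>Direct links are joined along an optimal route. A link may be left from any state of the
  class it enters, so only the order of the classes matters.\<close>

lemma T0_cost_link:
  fixes Q :: "nat \<Rightarrow> 's::finite \<Rightarrow> 's \<Rightarrow> real"
  assumes ij: "i \<in> {1..N+M}" "j \<in> {1..N+M}" "i \<noteq> j" and ne: "\<And>l. l \<in> {1..N+M} \<Longrightarrow> C l \<noteq> {}"
    and st: "\<And>n. n \<ge> 1 \<Longrightarrow> stochastic (Q n)"
    and direct: "\<And>k l. k \<in> {1..N+M} \<Longrightarrow> l \<in> {1..N+M} \<Longrightarrow> k \<noteq> l \<Longrightarrow> link Q (C k) (C l) (tau Q C k l)"
  shows "link Q (C i) (C j) (T0_cost Q C N M i j)"
proof -
  have nn: "0 \<le> Q n s t" if "n \<ge> 1" for n s t using st[OF that] by (simp add: stochastic_def)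
  obtain k L where L: "L \<in> routes (N+M) i j k"
    "T0_cost Q C N M i j = (\<Sum>s=0..k. tau Q C (L ! s) (L ! (s+1)))"
    using T0_cost_attained[OF ij] by blast
  have mem: "L ! s \<in> {1..N+M}" if "s < k + 2" for s
    using routes_nth[OF L(1) that] .
  have neq: "L ! s \<noteq> L ! (s + 1)" if "s < k + 1" for s
    using L(1) that by (auto simp: routes_def nth_eq_iff_index_eq)
  have "link Q (C (L ! 0)) (C (L ! (m + 1))) (\<Sum>s=0..m. tau Q C (L ! s) (L ! (s+1)))" if "m \<le> k" for m
    using that
  proof (induction m)
    case 0
    then show ?case using direct[OF mem mem neq, of 0] by simp
  next
    case (Suc m)
    have "link Q (C (L ! 0)) (C (L ! (Suc m + 1)))
        ((\<Sum>s=0..m. tau Q C (L ! s) (L ! (s+1))) + tau Q C (L ! (m + 1)) (L ! (m + 1 + 1)))"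
    proof (rule reach_link_trans)
      show "reach Q (C (L ! 0)) (C (L ! (m + 1))) (\<Sum>s=0..m. tau Q C (L ! s) (L ! (s+1)))"
        using Suc mem by (intro link_imp_reach ne) auto
      show "link Q (C (L ! (m + 1))) (C (L ! (Suc m + 1))) (tau Q C (L ! (m + 1)) (L ! (m + 1 + 1)))"
        using direct[OF mem mem neq, of "m + 1"] Suc.prems by simp
      show "(\<Sum>s=0..m. tau Q C (L ! s) (L ! (s+1))) \<le> 0"
        using mem Suc.prems by (intro sum_nonpos tau_nonpos ne st) auto
      show "tau Q C (L ! (m + 1)) (L ! (m + 1 + 1)) \<le> 0"
        using mem Suc.prems by (intro tau_nonpos ne st) auto
    qed (use nn in auto)
    then show ?case by simp
  qed
  from this[of k] show ?thesis using L by (simp add: routes_def)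
qed

section \<open>Connections inside a class and jumps under Assumptions B and C\<close>

lemma class_in_quotient:
  assumes "class_decomposition P C N M \<zeta>" "i \<in> {1..N+M}"
  shows "C i \<in> UNIV // communicating P"
proof -
  have "bij_betw C {1..N+M} (UNIV // communicating P)"
    using assms(1) unfolding class_decomposition_def by blast
  then show ?thesis using assms(2) bij_betwE by blast
qed

lemma class_nonempty:
  assumes "class_decomposition P C N M \<zeta>" "i \<in> {1..N+M}"
  shows "C i \<noteq> {}"
proof -
  have "C i \<in> UNIV // communicating P" by (rule class_in_quotient[OF assms])
  then show ?thesis by (auto simp: quotient_def communicating_def)
qed

lemma communicating_word:
  assumes "(x, y) \<in> communicating P" and nonneg: "\<And>x y. 0 \<le> P x y"
  shows "\<exists>w. last (x # w) = y \<and> path_prob (\<lambda>_. P) 0 x w > 0"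
    and "\<exists>w. last (y # w) = x \<and> path_prob (\<lambda>_. P) 0 y w > 0"
proof -
  consider "x = y" | n m where "block_power UNIV P n x y > 0" "block_power UNIV P m y x > 0"
    using assms(1) by (auto simp: communicating_def)
  then have "(\<exists>w. last (x # w) = y \<and> path_prob (\<lambda>_. P) 0 x w > 0) \<and>
      (\<exists>w. last (y # w) = x \<and> path_prob (\<lambda>_. P) 0 y w > 0)"
  proof cases
    case 1
    then show ?thesis by (auto intro!: exI[of _ "[]"])
  next
    case 2
    then show ?thesis using block_power_word[of P UNIV n x y] block_power_word[of P UNIV m y x] nonneg by blast
  qed
  then show "\<exists>w. last (x # w) = y \<and> path_prob (\<lambda>_. P) 0 x w > 0"
    "\<exists>w. last (y # w) = x \<and> path_prob (\<lambda>_. P) 0 y w > 0" by blast+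
qed

lemma class_word:
  assumes dec: "class_decomposition P C N M \<zeta>" and i: "i \<in> {1..N+M}"
    and nonneg: "\<And>x y. 0 \<le> P x y" and "y \<in> C i" "z \<in> C i"
  shows "\<exists>w. last (y # w) = z \<and> path_prob (\<lambda>_. P) 0 y w > 0"
proof -
  have "C i \<in> UNIV // communicating P" by (rule class_in_quotient[OF dec i])
  then obtain x where "C i = communicating P `` {x}" by (auto simp: quotient_def)
  then have "(x, y) \<in> communicating P" "(x, z) \<in> communicating P" using assms(4,5) by auto
  then obtain u w where u: "last (y # u) = x" "path_prob (\<lambda>_. P) 0 y u > 0"
    and w: "last (x # w) = z" "path_prob (\<lambda>_. P) 0 x w > 0"
    using communicating_word nonneg by metis
  have "last (y # u @ w) = z" using u(1) w(1) by (auto simp: last_append split: if_splits)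
  moreover have "path_prob (\<lambda>_. P) 0 y (u @ w) > 0"
    using u w by (simp only: path_prob_append path_prob_homogeneous[of P "0 + length u"]) simp
  ultimately show ?thesis by blast
qed

text \<open>Each pair of states in a class is joined by a fixed word of positive probability under
  \<open>P\<close>, the empty word in a degenerate class. With finitely many pairs, these
  probabilities are uniformly bounded below at late times.\<close>

lemma class_link:
  fixes Q :: "nat \<Rightarrow> 's::finite \<Rightarrow> 's \<Rightarrow> real"
  assumes dec: "class_decomposition P C N M \<zeta>" and i: "i \<in> {1..N+M}"
    and nonneg: "\<And>x y. 0 \<le> P x y" and lim: "\<And>x y. (\<lambda>n. Q n x y) \<longlonglongrightarrow> P x y"
  shows "link Q (C i) (C i) 0"
  unfolding link_def
proof (intro allI impI)
  fix c assume "ereal c < 0"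
  then have c: "c < 0" by simp
  define W where "W y z = (SOME w. last (y # w) = z \<and> path_prob (\<lambda>_. P) 0 y w > 0)" for y z
  have W: "last (y # W y z) = z" "path_prob (\<lambda>_. P) 0 y (W y z) > 0" if "y \<in> C i" "z \<in> C i" for y z
    using someI_ex[OF class_word[OF dec i nonneg that]] unfolding W_def by auto
  define h where "h y z = path_prob (\<lambda>_. P) 0 y (W y z) / 2" for y z
  have "eventually (\<lambda>k. \<forall>p\<in>C i \<times> C i. h (fst p) (snd p) < path_prob Q k (fst p) (W (fst p) (snd p))) sequentially"
  proof (rule eventually_ball_finite, simp, rule ballI)
    fix p assume "p \<in> C i \<times> C i"
    then have "h (fst p) (snd p) < path_prob (\<lambda>_. P) 0 (fst p) (W (fst p) (snd p))"
      using W(2) by (auto simp: h_def)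
    then show "eventually (\<lambda>k. h (fst p) (snd p) < path_prob Q k (fst p) (W (fst p) (snd p))) sequentially"
      by (rule order_tendstoD(1)[OF path_prob_tendsto[OF lim]])
  qed
  then obtain K1 where K1: "\<And>k y z. k \<ge> K1 \<Longrightarrow> y \<in> C i \<Longrightarrow> z \<in> C i \<Longrightarrow> h y z < path_prob Q k y (W y z)"
    by (fastforce simp: eventually_sequentially)
  \<comment> \<open>Summing natural numbers over the finitely many pairs bounds all word lengths and
    all log-probabilities at once.\<close>
  define g where "g p = length (W (fst p) (snd p)) + nat \<lceil>\<bar>ln (h (fst p) (snd p))\<bar>\<rceil>" for p
  define K where "K = K1 + (\<Sum>p\<in>C i \<times> C i. g p)"
  have K: "length (W y z) \<le> K" "nat \<lceil>\<bar>ln (h y z)\<bar>\<rceil> \<le> K" if "y \<in> C i" "z \<in> C i" for y z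
  proof -
    have "g (y, z) \<le> (\<Sum>p\<in>C i \<times> C i. g p)" using that by (intro member_le_sum) auto
    moreover have "g (y, z) = length (W y z) + nat \<lceil>\<bar>ln (h y z)\<bar>\<rceil>" by (simp add: g_def)
    ultimately show "length (W y z) \<le> K" "nat \<lceil>\<bar>ln (h y z)\<bar>\<rceil> \<le> K"
      unfolding K_def by linarith+
  qed
  show "\<exists>K. \<forall>k\<ge>K. \<forall>y\<in>C i. \<forall>z\<in>C i. \<exists>w. length w \<le> K \<and> last (y # w) = z \<and>
      exp (c * real k - real K) \<le> path_prob Q k y w"
  proof (rule exI[of _ K], intro allI impI ballI)
    fix k y z assume a: "k \<ge> K" "y \<in> C i" "z \<in> C i"
    have "h y z > 0" using W(2)[OF a(2,3)] by (simp add: h_def)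
    have "\<bar>ln (h y z)\<bar> \<le> real K"
      using real_nat_ceiling_ge[of "\<bar>ln (h y z)\<bar>"] K(2)[OF a(2,3)] by linarith
    moreover have "c * real k \<le> 0" using c by (simp add: mult_nonpos_nonneg)
    ultimately have "c * real k - real K \<le> ln (h y z)" by linarith
    then have "exp (c * real k - real K) \<le> h y z" using \<open>h y z > 0\<close> by (metis exp_le_cancel_iff exp_ln)
    also have "\<dots> \<le> path_prob Q k y (W y z)" using K1[OF _ a(2,3), of k] a(1) by (simp add: K_def)
    finally show "\<exists>w. length w \<le> K \<and> last (y # w) = z \<and> exp (c * real k - real K) \<le> path_prob Q k y w"
      using W(1)[OF a(2,3)] K(1)[OF a(2,3)] by blast
  qed
qed

text \<open>By counting: degenerate and irreducible indices are disjoint and their numbers add up to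
  N + M.\<close>

lemma irreducible_or_singleton:
  assumes dec: "class_decomposition P C N M \<zeta>" and i: "i \<in> {1..N+M}"
  shows "i \<in> irreducible_indices P C (N+M) \<or> (\<exists>x. C i = {x})"
proof -
  let ?D = "degenerate_indices P C (N+M)" and ?G = "irreducible_indices P C (N+M)"
  have zero: "block_power {x} P n x x = (P x x) ^ n" for x n by (induction n) auto
  have "?D \<inter> ?G = {}"
    unfolding degenerate_indices_def irreducible_indices_def irreducible_block_def
    by (auto simp: zero power_0_left)
  moreover have sub: "?D \<subseteq> {1..N+M}" "?G \<subseteq> {1..N+M}"
    by (auto simp: degenerate_indices_def irreducible_indices_def)
  moreover have "finite ?D" "finite ?G" using sub finite_subset by blast+
  ultimately have "card (?D \<union> ?G) = N + M"
    using dec by (simp add: card_Un_disjoint class_decomposition_def)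
  then have "?D \<union> ?G = {1..N+M}" using sub by (intro card_subset_eq) auto
  then have "i \<in> ?D \<or> i \<in> ?G" using i by blast
  then show ?thesis by (auto simp: degenerate_indices_def)
qed

text \<open>Wherever the chain lands in C j, it can move on to a prescribed state of that class at
  rate 0.\<close>

lemma link_via_reach:
  fixes Q :: "nat \<Rightarrow> 's::finite \<Rightarrow> 's \<Rightarrow> real"
  assumes dec: "class_decomposition P C N M \<zeta>"
    and st: "\<And>n. n \<ge> 1 \<Longrightarrow> stochastic (Q n)" and stP: "stochastic P"
    and lim: "\<And>x y. (\<lambda>n. Q n x y) \<longlonglongrightarrow> P x y"
    and j: "j \<in> {1..N+M}" and re: "reach Q B (C j) u" and "u \<le> 0"
  shows "link Q B (C j) u"
proof -
  have "link Q B (C j) (u + 0)"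
    by (rule reach_link_trans[OF _ re class_link[OF dec j _ lim]])
      (use st stP \<open>u \<le> 0\<close> in \<open>auto simp: stochastic_def\<close>)
  then show ?thesis by simp
qed

text \<open>The source \<open>a\<close> of near-optimal jumps is fixed, so the chain can be steered
  to it beforehand. The target \<open>b n\<close> moves with time and is corrected
  afterwards.\<close>

lemma assumption_B_link:
  fixes Q :: "nat \<Rightarrow> 's::finite \<Rightarrow> 's \<Rightarrow> real"
  assumes dec: "class_decomposition P C N M \<zeta>"
    and st: "\<And>n. n \<ge> 1 \<Longrightarrow> stochastic (Q n)" and stP: "stochastic P"
    and lim: "\<And>x y. (\<lambda>n. Q n x y) \<longlonglongrightarrow> P x y"
    and B: "assumption_B Q C (N+M)" and ij: "i \<in> {1..N+M}" "j \<in> {1..N+M}" "i \<noteq> j"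
  shows "link Q (C i) (C j) (tau Q C i j)"
proof -
  obtain a b where a: "a \<in> C i" and b: "\<And>n. b n \<in> C j"
    and conv: "log_rate_seq (\<lambda>n. Q n a (b n)) \<longlonglongrightarrow> tau Q C i j"
    using B ij unfolding assumption_B_def by blast
  have tau: "tau Q C i j = log_rate (\<lambda>n. Q n a (b n))"
    unfolding log_rate_def using lim_imp_Liminf[OF _ conv] by simp
  have tau0: "tau Q C i j \<le> 0" using ij dec st by (intro tau_nonpos class_nonempty) auto
  have "reach Q {a} (C j) (tau Q C i j)"
    unfolding reach_def
  proof (intro allI impI)
    fix c assume "ereal c < tau Q C i j"
    then obtain K where K: "\<And>n. n \<ge> K \<Longrightarrow> exp (c * real n) \<le> Q n a (b n)"
      unfolding tau using log_rate_greater_imp_exp_le by blast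
    define K' where "K' = K + 1 + nat \<lceil>\<bar>c\<bar>\<rceil>"
    show "\<exists>K. \<forall>k\<ge>K. \<forall>y\<in>{a}. \<exists>w. length w \<le> K \<and> last (y # w) \<in> C j \<and>
        exp (c * real k - real K) \<le> path_prob Q k y w"
    proof (rule exI[of _ K'], intro allI impI ballI)
      fix k y assume k: "k \<ge> K'" and "y \<in> {a}"
      have "\<bar>c\<bar> \<le> real K'" using real_nat_ceiling_ge[of "\<bar>c\<bar>"] unfolding K'_def of_nat_add by linarith
      then have "exp (c * real k - real K') \<le> exp (c * real (Suc k))" by (simp add: algebra_simps)
      also have "\<dots> \<le> Q (Suc k) a (b (Suc k))" using K[of "Suc k"] k by (simp add: K'_def)
      finally show "\<exists>w. length w \<le> K' \<and> last (y # w) \<in> C j \<and> exp (c * real k - real K') \<le> path_prob Q k y w"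
        using b \<open>y \<in> {a}\<close> by (intro exI[of _ "[b (Suc k)]"]) (auto simp: K'_def)
    qed
  qed
  then have jump: "link Q {a} (C j) (tau Q C i j)"
    using link_via_reach[OF dec st stP lim ij(2)] tau0 by blast
  have "link Q (C i) {a} 0"
    using class_link[OF dec ij(1) _ lim] stP a by (auto simp: stochastic_def intro: link_subset)
  then have "reach Q (C i) {a} 0" by (rule link_imp_reach) simp
  then have "link Q (C i) (C j) (0 + tau Q C i j)"
    by (rule reach_link_trans[rotated]) (use jump st tau0 in \<open>auto simp: stochastic_def\<close>)
  then show ?thesis by simp
qed

lemma path_prob_ge_power:
  assumes "\<And>n s t. k < n \<Longrightarrow> n \<le> k + length w \<Longrightarrow> A s t > 0 \<Longrightarrow> e \<le> Q n s t"
    and "0 \<le> e" "\<And>s t. 0 \<le> A s t" "path_prob (\<lambda>_. A) 0 x w > 0"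
  shows "e ^ length w \<le> path_prob Q k x w"
  using assms(1,4)
proof (induction w arbitrary: k x)
  case (Cons y w)
  have "path_prob (\<lambda>_. A) 0 y w \<ge> 0" "0 \<le> A x y"
    using assms(3) by (auto intro: path_prob_nonneg)
  then have *: "A x y > 0" "path_prob (\<lambda>_. A) 0 y w > 0"
    using Cons.prems(2) by (auto simp: path_prob_homogeneous[of A "Suc 0"] zero_less_mult_iff)
  have "e ^ length w \<le> path_prob Q (Suc k) y w"
    using Cons.prems(1) *(2) by (intro Cons.IH) auto
  moreover have "e \<le> Q (Suc k) x y" using Cons.prems(1)[of "Suc k" x y] * by simp
  ultimately show ?case using assms(2) by (auto intro: mult_mono order_trans)
qed simp

text \<open>A positive entry of \<open>P_star\<close> comes either from a positive limit or from
  exponential rate 0; in both cases it eventually exceeds every decaying exponential.\<close>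

lemma P_star_subexponential:
  fixes Q :: "nat \<Rightarrow> 's::finite \<Rightarrow> 's \<Rightarrow> real"
  assumes lim: "\<And>x y. (\<lambda>n. Q n x y) \<longlonglongrightarrow> P x y" and "\<epsilon> > 0"
  shows "\<exists>K. \<forall>n\<ge>K. \<forall>s t. P_star Q P s t > 0 \<longrightarrow> exp (- \<epsilon> * real n) \<le> Q n s t"
proof -
  have one: "eventually (\<lambda>n. exp (- \<epsilon> * real n) \<le> Q n s t) sequentially" if h: "P_star Q P s t > 0" for s t
  proof (cases "P s t > 0")
    case True
    have "(\<lambda>n. exp (- \<epsilon> * real n)) \<longlonglongrightarrow> 0" using \<open>\<epsilon> > 0\<close> by real_asymp
    then have "eventually (\<lambda>n. exp (- \<epsilon> * real n) < P s t / 2) sequentially"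
      using True by (intro order_tendstoD) auto
    moreover have "eventually (\<lambda>n. P s t / 2 < Q n s t) sequentially"
      using True by (intro order_tendstoD(1)[OF lim]) simp
    ultimately show ?thesis by eventually_elim simp
  next
    case False
    then have "ereal (- \<epsilon>) < log_rate (\<lambda>n. Q n s t)"
      using h \<open>\<epsilon> > 0\<close> by (auto simp: P_star_def split: if_splits)
    then show ?thesis using log_rate_greater_imp_exp_le unfolding eventually_sequentially by blast
  qed
  have "eventually (\<lambda>n. \<forall>p\<in>UNIV. P_star Q P (fst p) (snd p) > 0 \<longrightarrow>
      exp (- \<epsilon> * real n) \<le> Q n (fst p) (snd p)) sequentially"
  proof (rule eventually_ball_finite, simp, rule ballI)
    fix p :: "'s \<times> 's"
    show "eventually (\<lambda>n. P_star Q P (fst p) (snd p) > 0 \<longrightarrow>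
      exp (- \<epsilon> * real n) \<le> Q n (fst p) (snd p)) sequentially"
      using one[of "fst p" "snd p"] by (cases "P_star Q P (fst p) (snd p) > 0") auto
  qed
  then show ?thesis unfolding eventually_sequentially by fastforce
qed

text \<open>Primitivity provides a number \<open>m\<close> of steps common to all pairs of states in
  C i. At time \<open>k\<close> one therefore inspects which jump is best at time k + m + 1 and
  arrives at its source exactly in time. For a degenerate class m = 0 works.\<close>

lemma assumption_C_link:
  fixes Q :: "nat \<Rightarrow> 's::finite \<Rightarrow> 's \<Rightarrow> real"
  assumes dec: "class_decomposition P C N M \<zeta>"
    and st: "\<And>n. n \<ge> 1 \<Longrightarrow> stochastic (Q n)" and stP: "stochastic P"
    and lim: "\<And>x y. (\<lambda>n. Q n x y) \<longlonglongrightarrow> P x y"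
    and Cas: "assumption_C Q P C (irreducible_indices P C (N+M))"
    and ij: "i \<in> {1..N+M}" "j \<in> {1..N+M}" "i \<noteq> j"
  shows "link Q (C i) (C j) (tau Q C i j)"
proof (rule link_via_reach[OF dec st stP lim ij(2)])
  have ne: "C i \<noteq> {}" "C j \<noteq> {}" using class_nonempty[OF dec] ij by auto
  show tau0: "tau Q C i j \<le> 0" using ne st by (intro tau_nonpos) auto
  have star0: "0 \<le> P_star Q P s t" for s t by (auto simp: P_star_def)
  obtain m where m: "\<And>x y. x \<in> C i \<Longrightarrow> y \<in> C i \<Longrightarrow>
      \<exists>w. length w = m \<and> last (x # w) = y \<and> path_prob (\<lambda>_. P_star Q P) 0 x w > 0"
  proof (cases "i \<in> irreducible_indices P C (N+M)")
    case True
    then obtain n where "\<And>x y. x \<in> C i \<Longrightarrow> y \<in> C i \<Longrightarrow> block_power (C i) (P_star Q P) n x y > 0"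
      using Cas unfolding assumption_C_def primitive_block_def by blast
    then show ?thesis using block_power_word[of "P_star Q P"] star0 that by metis
  next
    case False
    then obtain x where "C i = {x}" using irreducible_or_singleton[OF dec ij(1)] by blast
    then show ?thesis using that[of 0] by simp
  qed
  show "reach Q (C i) (C j) (tau Q C i j)"
    unfolding reach_def
  proof (intro allI impI)
    fix c assume "ereal c < tau Q C i j"
    then obtain c' where c': "ereal c < ereal c'" "ereal c' < tau Q C i j" using ereal_dense2 by blast
    then have "c < c'" by simp
    \<comment> \<open>Each of the \<open>m\<close> preparatory steps loses at most exp (-\<epsilon>
      (k + m)). Together they lower the rate by no more than the gap between \<open>c'\<close> and
      \<open>c\<close>.\<close>
    define \<epsilon> where "\<epsilon> = (c' - c) / real (m + 1)"
    have \<epsilon>: "\<epsilon> > 0" "\<epsilon> * real m \<le> c' - c"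
      using \<open>c < c'\<close> by (auto simp: \<epsilon>_def field_simps)
    obtain K1 where K1: "\<And>n. n \<ge> K1 \<Longrightarrow> exp (c' * real n) \<le> max_entry Q C i j n"
      using log_rate_greater_imp_exp_le[of c'] c'(2) unfolding tau_def by blast
    obtain K2 where K2: "\<And>n s t. n \<ge> K2 \<Longrightarrow> P_star Q P s t > 0 \<Longrightarrow> exp (- \<epsilon> * real n) \<le> Q n s t"
      using P_star_subexponential[of Q P \<epsilon>, OF lim \<epsilon>(1)] by blast
    define K where "K = K1 + K2 + m + 1 + nat \<lceil>\<bar>c\<bar> * real m + \<bar>c'\<bar>\<rceil>"
    have K: "\<bar>c\<bar> * real m + \<bar>c'\<bar> \<le> real K"
      using real_nat_ceiling_ge[of "\<bar>c\<bar> * real m + \<bar>c'\<bar>"] unfolding K_def of_nat_add by linarith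
    show "\<exists>K. \<forall>k\<ge>K. \<forall>y\<in>C i. \<exists>w. length w \<le> K \<and> last (y # w) \<in> C j \<and>
        exp (c * real k - real K) \<le> path_prob Q k y w"
    proof (rule exI[of _ K], intro allI impI ballI)
      fix k y assume k: "k \<ge> K" and y: "y \<in> C i"
      obtain x z where xz: "x \<in> C i" "z \<in> C j" "max_entry Q C i j (Suc (k + m)) = Q (Suc (k + m)) x z"
        using max_entry_attained[OF ne, of Q "Suc (k + m)"] by blast
      obtain w where w: "length w = m" "last (y # w) = x" "path_prob (\<lambda>_. P_star Q P) 0 y w > 0"
        using m[OF y xz(1)] by blast
      have "exp (- \<epsilon> * real (k + m)) ^ length w \<le> path_prob Q k y w"
      proof (rule path_prob_ge_power[OF _ _ star0 w(3)])
        fix n s t assume n: "k < n" "n \<le> k + length w" "P_star Q P s t > 0"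
        have "exp (- \<epsilon> * real (k + m)) \<le> exp (- \<epsilon> * real n)" using n w(1) \<epsilon>(1) by simp
        also have "\<dots> \<le> Q n s t" using n k by (intro K2) (auto simp: K_def)
        finally show "exp (- \<epsilon> * real (k + m)) \<le> Q n s t" .
      qed simp
      then have stay: "exp (real m * (- \<epsilon> * real (k + m))) \<le> path_prob Q k y w"
        unfolding w(1) exp_of_nat_mult .
      have jump: "exp (c' * real (Suc (k + m))) \<le> Q (Suc (k + m)) x z"
        using K1[of "Suc (k + m)"] k xz(3) by (simp add: K_def)
      have "(\<epsilon> * real m) * real (k + m) \<le> (c' - c) * real (k + m)" using \<epsilon>(2) by (intro mult_right_mono) auto
      moreover have "- (\<bar>c\<bar> * real m) \<le> c * real m"
        by (metis abs_ge_minus_self abs_mult abs_of_nat minus_le_iff)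
      ultimately have "c * real k - real K \<le> real m * (- \<epsilon> * real (k + m)) + c' * real (Suc (k + m))"
        using K by (simp add: algebra_simps)
      then have "exp (c * real k - real K)
          \<le> exp (real m * (- \<epsilon> * real (k + m))) * exp (c' * real (Suc (k + m)))"
        by (simp only: exp_add[symmetric] exp_le_cancel_iff)
      also have "\<dots> \<le> path_prob Q k y w * Q (Suc (k + m)) x z"
        using stay jump st by (intro mult_mono path_prob_nonneg) (auto simp: stochastic_def)
      also have "\<dots> = path_prob Q k y (w @ [z])" using w(1,2) by (simp add: path_prob_append)
      finally show "\<exists>w. length w \<le> K \<and> last (y # w) \<in> C j \<and> exp (c * real k - real K) \<le> path_prob Q k y w"
        using w(1) xz(2) by (intro exI[of _ "w @ [z]"]) (auto simp: K_def)
    qed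
  qed
qed

section \<open>The rate function\<close>

lemma uminus_sum_ereal:
  fixes g :: "'a \<Rightarrow> ereal"
  assumes "\<And>i. i \<in> S \<Longrightarrow> g i \<le> 0"
  shows "- (\<Sum>i\<in>S. g i) = (\<Sum>i\<in>S. - g i)"
  using assms
proof (induction S rule: infinite_finite_induct)
  case (insert i S)
  have "g i \<le> 0" "(\<Sum>i\<in>S. g i) \<le> 0" using insert by (auto intro: sum_nonpos)
  then have "- (g i + (\<Sum>i\<in>S. g i)) = - g i + - (\<Sum>i\<in>S. g i)"
    by (cases "g i"; cases "\<Sum>i\<in>S. g i") auto
  then show ?case using insert by simp
qed auto

text \<open>The formula covers M = 1 too, where the first sum is empty and v 1 = 1. The sign moves
  inside the sum because all its terms are nonpositive.\<close>

lemma visit_cost_eq: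
  assumes v: "v \<in> prob_vectors M" and \<sigma>: "\<sigma> permutes {1..M}" and "1 \<le> M"
    and u: "\<And>i. i \<in> {1..M-1} \<Longrightarrow> u (\<zeta> (\<sigma> i)) (\<zeta> (\<sigma> (i+1))) \<le> 0"
  shows "visit_cost M \<zeta> I u v \<sigma> x =
    (\<Sum>i=1..M-1. ereal (\<Sum>j=1..i. v j) * - u (\<zeta> (\<sigma> i)) (\<zeta> (\<sigma> (i+1)))) +
    (\<Sum>i=1..M. ereal (v i) * I (\<zeta> (\<sigma> i)) (x i))"
proof (cases "2 \<le> M")
  case True
  have V: "0 \<le> (\<Sum>j=1..i. v j)" if "i \<in> {1..M-1}" for i
    using v that by (intro sum_nonneg) (auto simp: prob_vectors_def)
  have "ereal (\<Sum>j=1..i. v j) * u (\<zeta> (\<sigma> i)) (\<zeta> (\<sigma> (i+1))) \<le> 0" if i: "i \<in> {1..M-1}" for i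
  proof -
    have "0 \<le> ereal (\<Sum>j=1..i. v j)" using V[OF i] by simp
    moreover have "0 \<le> - u (\<zeta> (\<sigma> i)) (\<zeta> (\<sigma> (i+1)))" using u[OF i] by simp
    ultimately have "0 \<le> ereal (\<Sum>j=1..i. v j) * - u (\<zeta> (\<sigma> i)) (\<zeta> (\<sigma> (i+1)))"
      by (rule ereal_0_le_mult)
    then show ?thesis by simp
  qed
  then have "- (\<Sum>i=1..M-1. ereal (\<Sum>j=1..i. v j) * u (\<zeta> (\<sigma> i)) (\<zeta> (\<sigma> (i+1))))
      = (\<Sum>i=1..M-1. - (ereal (\<Sum>j=1..i. v j) * u (\<zeta> (\<sigma> i)) (\<zeta> (\<sigma> (i+1)))))"
    by (rule uminus_sum_ereal)
  then show ?thesis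
    using True unfolding visit_cost_def by (simp only: if_True ereal_mult_minus_right)
next
  case False
  then have M: "M = 1" using \<open>1 \<le> M\<close> by simp
  have "\<sigma> 1 = 1" using permutes_in_image[OF \<sigma>, of 1] M by auto
  moreover have "v 1 = 1" using v M by (simp add: prob_vectors_def)
  ultimately show ?thesis using M by (simp add: visit_cost_def flip: One_nat_def)
qed

text \<open>A finite sum of suprema is the supremum of sums of independent choices. The hypothesis
  on \<open>t\<close> says that t i is at most the supremum of A i, in a form ready for unbounded A
  i.\<close>

lemma sum_ereal_le_minorants:
  fixes t :: "'a \<Rightarrow> ereal" and A :: "'a \<Rightarrow> real set"
  assumes "finite S" and ne: "\<And>i. i \<in> S \<Longrightarrow> A i \<noteq> {}"
    and t: "\<And>i c. i \<in> S \<Longrightarrow> (\<And>y. y \<in> A i \<Longrightarrow> y \<le> c) \<Longrightarrow> t i \<le> ereal c"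
    and nm: "\<And>i. i \<in> S \<Longrightarrow> t i \<noteq> -\<infinity>"
    and b: "\<And>g. (\<And>i. i \<in> S \<Longrightarrow> g i \<in> A i) \<Longrightarrow> (\<Sum>i\<in>S. g i) \<le> b"
  shows "(\<Sum>i\<in>S. t i) \<le> ereal b"
  using assms
proof (induction S arbitrary: b rule: finite_induct)
  case (insert i S)
  have le: "t i \<le> ereal (b - (\<Sum>j\<in>S. g j))" if g: "\<And>j. j \<in> S \<Longrightarrow> g j \<in> A j" for g
  proof (rule insert.prems(2))
    fix y assume y: "y \<in> A i"
    have "(\<Sum>j\<in>insert i S. (g(i := y)) j) \<le> b"
      using g y by (intro insert.prems(4)) auto
    moreover have "(\<Sum>j\<in>S. (g(i := y)) j) = (\<Sum>j\<in>S. g j)"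
      using insert.hyps by (intro sum.cong) auto
    ultimately show "y \<le> b - (\<Sum>j\<in>S. g j)" using insert.hyps by simp
  qed simp
  \<comment> \<open>One arbitrary choice of the other summands already shows that t i is finite, so
    it can be moved to the other side.\<close>
  have "t i \<le> ereal (b - (\<Sum>j\<in>S. SOME y. y \<in> A j))"
    using insert.prems(1) by (intro le) (simp add: some_in_eq)
  then obtain \<tau> where \<tau>: "t i = ereal \<tau>" using insert.prems(3)[of i] by (cases "t i") auto
  have "(\<Sum>j\<in>S. t j) \<le> ereal (b - \<tau>)"
  proof (rule insert.IH)
    fix g assume "\<And>j. j \<in> S \<Longrightarrow> g j \<in> A j"
    from le[OF this] show "(\<Sum>j\<in>S. g j) \<le> b - \<tau>" by (simp add: \<tau>)
  qed (use insert.prems in auto)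
  then have "t i + (\<Sum>j\<in>S. t j) \<le> ereal \<tau> + ereal (b - \<tau>)" unfolding \<tau> by (rule add_left_mono)
  then show ?case using insert.hyps by simp
qed simp

lemma compact_functions:
  fixes S :: "'i \<Rightarrow> 'a::topological_space set"
  assumes "\<And>i. compact (S i)"
  shows "compact {g. \<forall>i. g i \<in> S i}"
proof -
  have "compactin (product_topology (\<lambda>i. euclidean) UNIV) (PiE UNIV S)"
    using assms by (simp add: compactin_PiE)
  then have "compact (PiE UNIV S)"
    by (simp add: euclidean_product_topology)
  moreover have "PiE UNIV S = {g. \<forall>i. g i \<in> S i}" by (auto simp: PiE_def)
  ultimately show ?thesis by simp
qed

lemma closed_sublevels_imp_lsc:
  fixes J :: "'a::t2_space \<Rightarrow> ereal"
  assumes "\<And>a::real. closed {z. J z \<le> ereal a}"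
  shows "J z \<le> Liminf (at z) J"
  unfolding le_Liminf_iff
proof (intro allI impI)
  fix y assume "y < J z"
  then obtain a where a: "y < ereal a" "ereal a < J z" using ereal_dense2 by blast
  have "open (- {z. J z \<le> ereal a})" using assms[of a] by (rule open_Compl)
  moreover have "z \<in> - {z. J z \<le> ereal a}" using a(2) by simp
  ultimately have "eventually (\<lambda>x. x \<in> - {z. J z \<le> ereal a}) (at z)"
    by (meson eventually_at_topological)
  then show "eventually (\<lambda>x. y < J x) (at z)"
    by eventually_elim (use a(1) in \<open>auto simp: not_le intro: less_trans\<close>)
qed

text \<open>\<open>r i\<close> abstracts the logarithm of the Perron root of class i. Its linear
  bound yields nonnegativity of the rate at \<theta> = 0 and infinite rate outside the ball of
  radius \<open>F\<close>.\<close>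

locale class_rates =
  fixes M :: nat and \<zeta> :: "nat \<Rightarrow> nat" and r :: "nat \<Rightarrow> real ^ 'd \<Rightarrow> real" and F :: real
    and u :: "nat \<Rightarrow> nat \<Rightarrow> ereal" and I :: "nat \<Rightarrow> real ^ 'd \<Rightarrow> ereal"
  assumes M: "1 \<le> M" and F: "0 \<le> F" and inj: "inj_on \<zeta> {1..M}"
    and r: "\<And>i \<theta>. i \<in> {1..M} \<Longrightarrow> r (\<zeta> i) \<theta> \<le> F * norm \<theta>"
    and u: "\<And>i j. i \<in> {1..M} \<Longrightarrow> j \<in> {1..M} \<Longrightarrow> i \<noteq> j \<Longrightarrow> u (\<zeta> i) (\<zeta> j) \<le> 0"
    and I: "\<And>i x. I i x = (SUP \<theta>. ereal (\<theta> \<bullet> x - r i \<theta>))"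
begin

lemma I_ge: "ereal (\<theta> \<bullet> x - r i \<theta>) \<le> I i x"
  unfolding I by (rule SUP_upper) simp

lemma I_nonneg: "i \<in> {1..M} \<Longrightarrow> 0 \<le> I (\<zeta> i) x"
  using r[of i 0] I_ge[of 0 x "\<zeta> i"] by (auto intro: order_trans[rotated])

text \<open>Along \<theta> = s x the defining expression is at least s |x| (|x| - F), which is
  unbounded if |x| > F.\<close>

lemma I_finite_imp:
  assumes "i \<in> {1..M}" "I (\<zeta> i) x < \<infinity>"
  shows "norm x \<le> F"
proof (rule ccontr)
  assume "\<not> norm x \<le> F"
  then have pos: "0 < norm x * (norm x - F)" using F by (intro mult_pos_pos) linarith+
  obtain \<iota> where \<iota>: "I (\<zeta> i) x = ereal \<iota>"
    using assms(2) I_nonneg[OF assms(1), of x] by (cases "I (\<zeta> i) x") auto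
  obtain s :: nat where s: "\<iota> < real s * (norm x * (norm x - F))" using reals_Archimedean3[OF pos] by blast
  have "r (\<zeta> i) (real s *\<^sub>R x) \<le> real s * (F * norm x)"
    using r[OF assms(1), of "real s *\<^sub>R x"] by (simp add: mult.left_commute)
  moreover have "(real s *\<^sub>R x) \<bullet> x = real s * (norm x * norm x)"
    by (simp add: dot_square_norm power2_eq_square)
  moreover have "(real s *\<^sub>R x) \<bullet> x - r (\<zeta> i) (real s *\<^sub>R x) \<le> \<iota>"
    using I_ge[of "real s *\<^sub>R x" x "\<zeta> i"] by (simp add: \<iota>)
  moreover have "real s * (norm x * (norm x - F)) = real s * (norm x * norm x) - real s * (F * norm x)"
    by (simp add: algebra_simps)
  ultimately show False using s by linarith
qed

context
  fixes \<sigma> assumes \<sigma>: "\<sigma> permutes {1..M}"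
begin

lemma \<sigma>_in: "i \<in> {1..M} \<Longrightarrow> \<sigma> i \<in> {1..M}"
  using permutes_in_image[OF \<sigma>] by blast

lemma u_\<sigma>: "i \<in> {1..M-1} \<Longrightarrow> u (\<zeta> (\<sigma> i)) (\<zeta> (\<sigma> (i+1))) \<le> 0"
  using permutes_inj[OF \<sigma>] by (intro u \<sigma>_in) (auto simp: inj_eq)

lemma cost_eq:
  assumes "v \<in> prob_vectors M"
  shows "visit_cost M \<zeta> I u v \<sigma> x =
    (\<Sum>i=1..M-1. ereal (\<Sum>j=1..i. v j) * - u (\<zeta> (\<sigma> i)) (\<zeta> (\<sigma> (i+1)))) +
    (\<Sum>i=1..M. ereal (v i) * I (\<zeta> (\<sigma> i)) (x i))"
  by (rule visit_cost_eq[where u = u and \<zeta> = \<zeta> and \<sigma> = \<sigma>]) (use assms \<sigma> M u_\<sigma> in auto)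

lemma cost_nonneg:
  assumes v: "v \<in> prob_vectors M"
  shows "0 \<le> visit_cost M \<zeta> I u v \<sigma> x"
proof -
  have "0 \<le> ereal (\<Sum>j=1..i. v j) * - u (\<zeta> (\<sigma> i)) (\<zeta> (\<sigma> (i+1)))" if "i \<in> {1..M-1}" for i
  proof (rule ereal_0_le_mult)
    show "0 \<le> ereal (\<Sum>j=1..i. v j)"
      using v that by (auto simp: prob_vectors_def intro!: sum_nonneg)
    show "0 \<le> - u (\<zeta> (\<sigma> i)) (\<zeta> (\<sigma> (i+1)))" using u_\<sigma>[OF that] by simp
  qed
  moreover have "0 \<le> ereal (v i) * I (\<zeta> (\<sigma> i)) (x i)" if "i \<in> {1..M}" for i
    using v that I_nonneg[OF \<sigma>_in[OF that]] by (intro ereal_0_le_mult) (auto simp: prob_vectors_def)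
  ultimately show ?thesis unfolding cost_eq[OF v] by (intro add_nonneg_nonneg sum_nonneg) auto
qed

text \<open>Connection costs may be \<infinity>. Replacing each by a finite number below it, and
  each class rate by a single \<theta>, yields a finite function that is continuous in (v,
  x).\<close>

definition admissible :: "(nat \<Rightarrow> real) \<Rightarrow> bool" where
  "admissible a \<longleftrightarrow> (\<forall>i\<in>{1..M-1}. 0 \<le> a i \<and> ereal (a i) \<le> - u (\<zeta> (\<sigma> i)) (\<zeta> (\<sigma> (i+1))))"

definition minorant :: "(nat \<Rightarrow> real) \<Rightarrow> (nat \<Rightarrow> real ^ 'd) \<Rightarrow> (nat \<Rightarrow> real) \<Rightarrow> (nat \<Rightarrow> real ^ 'd) \<Rightarrow> real" where
  "minorant a \<theta> v x = (\<Sum>i=1..M-1. (\<Sum>j=1..i. v j) * a i) +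
     (\<Sum>i=1..M. v i * (\<theta> i \<bullet> x i - r (\<zeta> (\<sigma> i)) (\<theta> i)))"

text \<open>The cost is a supremum of continuous functions of \<open>(v, x)\<close>; this gives its lower semicontinuity.\<close>

lemma cost_le_iff:
  assumes v: "v \<in> prob_vectors M"
  shows "visit_cost M \<zeta> I u v \<sigma> x \<le> ereal b \<longleftrightarrow> (\<forall>a \<theta>. admissible a \<longrightarrow> minorant a \<theta> v x \<le> b)"
proof
  have V: "0 \<le> (\<Sum>j=1..i. v j)" if "i \<in> {1..M-1}" for i
    using v that by (auto simp: prob_vectors_def intro!: sum_nonneg)
  have v0: "0 \<le> v i" if "i \<in> {1..M}" for i using v that by (auto simp: prob_vectors_def)
  {
    assume le: "visit_cost M \<zeta> I u v \<sigma> x \<le> ereal b"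
    show "\<forall>a \<theta>. admissible a \<longrightarrow> minorant a \<theta> v x \<le> b"
    proof (intro allI impI)
      fix a \<theta> assume a: "admissible a"
      have "ereal (minorant a \<theta> v x) = (\<Sum>i=1..M-1. ereal (\<Sum>j=1..i. v j) * ereal (a i)) +
          (\<Sum>i=1..M. ereal (v i) * ereal (\<theta> i \<bullet> x i - r (\<zeta> (\<sigma> i)) (\<theta> i)))"
        by (simp add: minorant_def)
      also have "\<dots> \<le> visit_cost M \<zeta> I u v \<sigma> x"
        unfolding cost_eq[OF v] using a V v0 I_ge
        by (intro add_mono sum_mono ereal_mult_left_mono) (auto simp: admissible_def)
      finally have "ereal (minorant a \<theta> v x) \<le> ereal b" using le by (rule order_trans)
      then show "minorant a \<theta> v x \<le> b" by simp
    qed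
  next
    assume min: "\<forall>a \<theta>. admissible a \<longrightarrow> minorant a \<theta> v x \<le> b"
    \<comment> \<open>Both sums of the cost are merged into one sum over a disjoint union, to which
      \<open>sum_ereal_le_minorants\<close> applies once.\<close>
    define t where "t = case_sum
      (\<lambda>i. ereal (\<Sum>j=1..i. v j) * - u (\<zeta> (\<sigma> i)) (\<zeta> (\<sigma> (i+1)))) (\<lambda>i. ereal (v i) * I (\<zeta> (\<sigma> i)) (x i))"
    define A where "A = case_sum
      (\<lambda>i. {(\<Sum>j=1..i. v j) * a | a. 0 \<le> a \<and> ereal a \<le> - u (\<zeta> (\<sigma> i)) (\<zeta> (\<sigma> (i+1)))})
      (\<lambda>i. {v i * (\<theta> \<bullet> x i - r (\<zeta> (\<sigma> i)) \<theta>) | \<theta>. True})"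
    let ?S = "{1..M-1} <+> {1..M}"
    have "(\<Sum>i\<in>?S. t i) \<le> ereal b"
    proof (rule sum_ereal_le_minorants[where A = A])
      fix i assume i: "i \<in> ?S"
      show "A i \<noteq> {}"
      proof (cases i)
        case (Inl k)
        then have "0 \<le> - u (\<zeta> (\<sigma> k)) (\<zeta> (\<sigma> (k+1)))" using u_\<sigma>[of k] i by auto
        then show ?thesis using Inl by (auto simp: A_def zero_ereal_def)
      qed (auto simp: A_def)
      show "t i \<noteq> -\<infinity>"
      proof (cases i)
        case (Inl k)
        then have "0 \<le> - u (\<zeta> (\<sigma> k)) (\<zeta> (\<sigma> (k+1)))" "0 \<le> ereal (\<Sum>j=1..k. v j)"
          using u_\<sigma>[of k] V[of k] i by auto
        then have "0 \<le> t i" using Inl by (simp add: t_def ereal_0_le_mult del: ereal_mult_minus_right)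
        then show ?thesis by auto
      next
        case (Inr k)
        then have "0 \<le> I (\<zeta> (\<sigma> k)) (x k)" "0 \<le> ereal (v k)"
          using I_nonneg[OF \<sigma>_in] v0[of k] i by auto
        then have "0 \<le> t i" using Inr by (simp add: t_def)
        then show ?thesis by auto
      qed
    next
      fix i c assume i: "i \<in> ?S" and c: "\<And>y. y \<in> A i \<Longrightarrow> y \<le> c"
      show "t i \<le> ereal c"
      proof (cases i)
        case (Inl k)
        define V' where "V' = (\<Sum>j=1..k. v j)"
        define U where "U = - u (\<zeta> (\<sigma> k)) (\<zeta> (\<sigma> (k+1)))"
        have U: "0 \<le> U" and V': "0 \<le> V'" using u_\<sigma>[of k] V[of k] i Inl by (auto simp: U_def V'_def)
        have c': "V' * a \<le> c" if "0 \<le> a" "ereal a \<le> U" for a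
          using c that Inl by (auto simp: A_def V'_def U_def)
        have "ereal V' * U \<le> ereal c"
        proof (cases U)
          case (real w)
          then show ?thesis using c'[of w] U by simp
        next
          case PInf
          \<comment> \<open>An infinite connection cost admits arbitrarily large \<open>a\<close>,
            so a positive weight would contradict the bound \<open>c\<close>; with weight 0 the
            product is 0 by convention.\<close>
          have "V' = 0"
          proof (rule ccontr)
            assume "V' \<noteq> 0"
            then have "0 < V'" using V' by simp
            moreover have "0 \<le> c" using c'[of 0] PInf by simp
            ultimately show False using c'[of "(c + 1) / V'"] PInf by simp
          qed
          then show ?thesis using c'[of 0] PInf by simp
        qed (use U in simp)
        then show ?thesis using Inl by (simp add: t_def V'_def U_def del: ereal_mult_minus_right)
      next
        case (Inr k)
        have c': "v k * (\<theta> \<bullet> x k - r (\<zeta> (\<sigma> k)) \<theta>) \<le> c" for \<theta>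
          using c Inr by (auto simp: A_def)
        show ?thesis
        proof (cases "v k = 0")
          case True
          then show ?thesis using Inr c' by (simp add: t_def zero_ereal_def[symmetric])
        next
          case False
          then have vk: "0 < v k" using v0[of k] i Inr by auto
          have "I (\<zeta> (\<sigma> k)) (x k) \<le> ereal (c / v k)"
            unfolding I using c' vk by (intro SUP_least) (simp add: pos_le_divide_eq mult.commute)
          then have "ereal (v k) * I (\<zeta> (\<sigma> k)) (x k) \<le> ereal (v k) * ereal (c / v k)"
            using vk by (intro ereal_mult_left_mono) auto
          then show ?thesis using Inr vk by (simp add: t_def)
        qed
      qed
    next
      fix g assume g: "\<And>i. i \<in> ?S \<Longrightarrow> g i \<in> A i"
      have "\<forall>i\<in>{1..M-1}. \<exists>a. g (Inl i) = (\<Sum>j=1..i. v j) * a \<and> 0 \<le> a \<and> ereal a \<le> - u (\<zeta> (\<sigma> i)) (\<zeta> (\<sigma> (i+1)))"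
        using g[of "Inl _"] by (auto simp: A_def)
      then obtain a where a: "\<And>i. i \<in> {1..M-1} \<Longrightarrow> g (Inl i) = (\<Sum>j=1..i. v j) * a i" "admissible a"
        unfolding admissible_def by metis
      have "\<forall>i\<in>{1..M}. \<exists>\<theta>. g (Inr i) = v i * (\<theta> \<bullet> x i - r (\<zeta> (\<sigma> i)) \<theta>)"
        using g[of "Inr _"] by (auto simp: A_def)
      then obtain \<theta> where \<theta>: "\<And>i. i \<in> {1..M} \<Longrightarrow> g (Inr i) = v i * (\<theta> i \<bullet> x i - r (\<zeta> (\<sigma> i)) (\<theta> i))"
        by metis
      have "(\<Sum>i\<in>?S. g i) = minorant a \<theta> v x"
        by (simp add: sum.Plus minorant_def a \<theta>)
      then show "(\<Sum>i\<in>?S. g i) \<le> b" using min a(2) by simp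
    qed simp
    then show "visit_cost M \<zeta> I u v \<sigma> x \<le> ereal b"
      unfolding cost_eq[OF v] by (simp add: sum.Plus t_def del: ereal_mult_minus_right)
  }
qed

definition sublevel :: "real \<Rightarrow> (real ^ 'd) set" where
  "sublevel b = {z. \<exists>v\<in>prob_vectors M. \<exists>x\<in>mean_tuples M v z. visit_cost M \<zeta> I u v \<sigma> x \<le> ereal b}"

lemma compact_sublevel: "compact (sublevel b)"
proof -
  let ?g = "\<lambda>p. \<Sum>i=1..M. fst p i *\<^sub>R snd p i"
  \<comment> \<open>Tuples are functions on all natural numbers. Pinning \<open>v\<close> to 0 off
    {1..M} and bounding every coordinate of \<open>x\<close> makes this a product of compact
    sets.\<close>
  define K where "K = {v :: nat \<Rightarrow> real. \<forall>i. v i \<in> (if i \<in> {1..M} then {0..1} else {0})}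
    \<times> {x :: nat \<Rightarrow> real ^ 'd. \<forall>i. x i \<in> cball 0 \<bar>F\<bar>}"
  have "compact K"
    unfolding K_def by (intro compact_Times compact_functions) auto
  define T where "T = {p. (\<Sum>i=1..M. fst p i) = 1 \<and> (\<forall>a \<theta>. admissible a \<longrightarrow> minorant a \<theta> (fst p) (snd p) \<le> b)}"
  have [continuous_intros]: "continuous_on UNIV (\<lambda>p :: (nat \<Rightarrow> real) \<times> (nat \<Rightarrow> real ^ 'd). fst p i)" for i
    by (rule continuous_on_compose2[OF continuous_on_product_coordinates[of i]])
      (auto intro: continuous_on_fst continuous_on_id)
  have [continuous_intros]: "continuous_on UNIV (\<lambda>p :: (nat \<Rightarrow> real) \<times> (nat \<Rightarrow> real ^ 'd). snd p i)" for i
    by (rule continuous_on_compose2[OF continuous_on_product_coordinates[of i]])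
      (auto intro: continuous_on_snd continuous_on_id)
  have "closed T"
    unfolding T_def minorant_def
    by (intro closed_Collect_conj closed_Collect_all closed_Collect_imp closed_Collect_le
        closed_Collect_eq continuous_intros open_Collect_const)
  then have "compact (K \<inter> T)" using \<open>compact K\<close> by (rule compact_Int_closed[rotated])
  moreover have "continuous_on (K \<inter> T) ?g"
    by (rule continuous_on_subset[of UNIV]) (auto intro!: continuous_intros)
  ultimately have "compact (?g ` (K \<inter> T))"
    by (rule compact_continuous_image[rotated])
  also have "?g ` (K \<inter> T) = sublevel b"
  proof (intro equalityI subsetI)
    fix z assume "z \<in> ?g ` (K \<inter> T)"
    then obtain v x where vx: "(v, x) \<in> K" "(v, x) \<in> T" "z = (\<Sum>i=1..M. v i *\<^sub>R x i)" by auto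
    have "0 \<le> v i" if "i \<in> {1..M}" for i
    proof -
      have "v i \<in> (if i \<in> {1..M} then {0..1} else {0})" using vx(1) unfolding K_def by blast
      then show ?thesis using that by simp
    qed
    then have v: "v \<in> prob_vectors M" using vx(2) by (auto simp: prob_vectors_def T_def)
    moreover have "x \<in> mean_tuples M v z" using vx(3) by (simp add: mean_tuples_def)
    moreover have "visit_cost M \<zeta> I u v \<sigma> x \<le> ereal b"
      unfolding cost_le_iff[OF v] using vx(2) by (simp add: T_def)
    ultimately show "z \<in> sublevel b" unfolding sublevel_def by blast
  next
    fix z assume "z \<in> sublevel b"
    then obtain v x where v: "v \<in> prob_vectors M" and x: "x \<in> mean_tuples M v z"
      and cost: "visit_cost M \<zeta> I u v \<sigma> x \<le> ereal b" unfolding sublevel_def by blast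
    have v0: "0 \<le> v i" if "i \<in> {1..M}" for i using v that by (auto simp: prob_vectors_def)
    have v1: "v i \<le> 1" if "i \<in> {1..M}" for i
      using member_le_sum[of i "{1..M}" v] v that by (auto simp: prob_vectors_def)
    define v' where "v' i = (if i \<in> {1..M} then v i else 0)" for i
    \<comment> \<open>If \<open>v i = 0\<close> then \<open>x i\<close> is unconstrained, as \<open>0 * \<infinity> = 0\<close>.\<close>
    define x' where "x' i = (if v' i = 0 then 0 else x i)" for i
    have v'i: "v' i = v i" if "i \<in> {1..M}" for i using that by (simp add: v'_def)
    have v': "v' \<in> prob_vectors M"
      using v unfolding prob_vectors_def by (auto simp: v'i)
    have sums: "(\<Sum>j=1..i. v' j) = (\<Sum>j=1..i. v j)" if "i \<in> {1..M-1}" for i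
      using that by (intro sum.cong) (auto simp: v'_def)
    have "visit_cost M \<zeta> I u v' \<sigma> x' = visit_cost M \<zeta> I u v \<sigma> x"
      unfolding cost_eq[OF v] cost_eq[OF v']
    proof (rule arg_cong2[where f = "(+)"])
      show "(\<Sum>i=1..M-1. ereal (\<Sum>j=1..i. v' j) * - u (\<zeta> (\<sigma> i)) (\<zeta> (\<sigma> (i+1))))
          = (\<Sum>i=1..M-1. ereal (\<Sum>j=1..i. v j) * - u (\<zeta> (\<sigma> i)) (\<zeta> (\<sigma> (i+1))))"
        using sums by (intro sum.cong refl) metis
      show "(\<Sum>i=1..M. ereal (v' i) * I (\<zeta> (\<sigma> i)) (x' i)) = (\<Sum>i=1..M. ereal (v i) * I (\<zeta> (\<sigma> i)) (x i))"
        by (intro sum.cong refl) (auto simp: v'_def x'_def zero_ereal_def[symmetric])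
    qed
    then have cost': "visit_cost M \<zeta> I u v' \<sigma> x' \<le> ereal b" using cost by simp
    have xF: "norm (x' i) \<le> \<bar>F\<bar>" for i
    proof (cases "v' i = 0")
      case False
      then have i: "i \<in> {1..M}" "0 < v i" using v0[of i] by (auto simp: v'_def split: if_splits)
      have "I (\<zeta> (\<sigma> i)) (x i) \<noteq> \<infinity>"
      proof
        assume inf: "I (\<zeta> (\<sigma> i)) (x i) = \<infinity>"
        have "ereal (v i) * I (\<zeta> (\<sigma> i)) (x i) \<le> (\<Sum>i=1..M. ereal (v i) * I (\<zeta> (\<sigma> i)) (x i))"
          using i v0 I_nonneg[OF \<sigma>_in]
          by (subst sum.remove[of _ i]) (auto intro!: add_increasing2 sum_nonneg ereal_0_le_mult)
        also have "\<dots> \<le> visit_cost M \<zeta> I u v \<sigma> x"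
        proof -
          have "0 \<le> (\<Sum>i=1..M-1. ereal (\<Sum>j=1..i. v j) * - u (\<zeta> (\<sigma> i)) (\<zeta> (\<sigma> (i+1))))"
            using u_\<sigma> v0 by (intro sum_nonneg ereal_0_le_mult) (auto intro!: sum_nonneg)
          then show ?thesis unfolding cost_eq[OF v] by (simp only: add_increasing order_refl)
        qed
        finally show False using cost inf i(2) by simp
      qed
      then have "norm (x i) \<le> F" using I_finite_imp[OF \<sigma>_in[OF i(1)]] by simp
      then show ?thesis using False by (simp add: x'_def)
    qed (simp add: x'_def)
    have "(v', x') \<in> K"
      unfolding K_def using xF v0 v1 by (auto simp: v'_def)
    moreover have "(v', x') \<in> T"
      using v' cost' unfolding T_def cost_le_iff[OF v'] by (simp add: prob_vectors_def)
    moreover have "z = (\<Sum>i=1..M. v' i *\<^sub>R x' i)"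
    proof -
      have "z = (\<Sum>i=1..M. v i *\<^sub>R x i)" using x by (simp add: mean_tuples_def)
      also have "\<dots> = (\<Sum>i=1..M. v' i *\<^sub>R x' i)" by (intro sum.cong refl) (auto simp: v'_def x'_def)
      finally show ?thesis .
    qed
    ultimately show "z \<in> ?g ` (K \<inter> T)"
      by (intro image_eqI[of _ _ "(v', x')"]) auto
  qed
  finally show ?thesis .
qed

end

text \<open>Stated with a strict inequality, since a bound strictly above an infimum always has a
  witness, attained or not.\<close>

lemma J_fun_less_iff:
  "J_fun M \<zeta> I u z < b \<longleftrightarrow>
    (\<exists>v\<in>prob_vectors M. \<exists>x\<in>mean_tuples M v z. \<exists>\<sigma>. \<sigma> permutes {1..M} \<and> visit_cost M \<zeta> I u v \<sigma> x < b)"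
proof -
  have "finite {\<sigma>. \<sigma> permutes {1..M}}" by (rule finite_permutations) simp
  moreover have "{\<sigma>. \<sigma> permutes {1..M}} \<noteq> {}" using permutes_id by blast
  ultimately show ?thesis
    unfolding J_fun_def INF_less_iff by (simp add: Min_less_iff)
qed

lemma J_fun_good: "good_rate_function (J_fun M \<zeta> I u)"
proof -
  let ?L = "\<lambda>b. \<Union>\<sigma>\<in>{\<sigma>. \<sigma> permutes {1..M}}. sublevel \<sigma> b"
  have nonneg: "0 \<le> J_fun M \<zeta> I u z" for z
  proof (rule ccontr)
    assume "\<not> 0 \<le> J_fun M \<zeta> I u z"
    then have "J_fun M \<zeta> I u z < 0" by simp
    then show False unfolding J_fun_less_iff using cost_nonneg by (auto simp: not_le[symmetric])
  qed
  \<comment> \<open>Witnesses exist only for levels strictly above \<open>a\<close>, hence the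
    intersection over b > a of finite unions of compact sets.\<close>
  have level: "{z. J_fun M \<zeta> I u z \<le> ereal a} = (\<Inter>b\<in>{a<..}. ?L b)" for a
  proof (intro equalityI subsetI)
    fix z assume z: "z \<in> {z. J_fun M \<zeta> I u z \<le> ereal a}"
    show "z \<in> (\<Inter>b\<in>{a<..}. ?L b)"
    proof
      fix b assume "b \<in> {a<..}"
      then have "J_fun M \<zeta> I u z < ereal b" using z by (auto intro: le_less_trans)
      then obtain v x \<sigma> where "v \<in> prob_vectors M" "x \<in> mean_tuples M v z" "\<sigma> permutes {1..M}"
        "visit_cost M \<zeta> I u v \<sigma> x < ereal b" unfolding J_fun_less_iff by blast
      then show "z \<in> ?L b"
        by (auto simp: sublevel_def intro: less_imp_le)
    qed
  next
    fix z assume z: "z \<in> (\<Inter>b\<in>{a<..}. ?L b)"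
    have "J_fun M \<zeta> I u z \<le> ereal a"
    proof (rule ereal_le_epsilon2)
      fix e :: real assume "0 < e"
      then have "a + e / 2 \<in> {a<..}" by simp
      then obtain \<sigma> where "\<sigma> permutes {1..M}" "z \<in> sublevel \<sigma> (a + e / 2)" using z by blast
      then obtain v x where "v \<in> prob_vectors M" "x \<in> mean_tuples M v z"
        "visit_cost M \<zeta> I u v \<sigma> x \<le> ereal (a + e / 2)" by (auto simp: sublevel_def)
      moreover from this have "visit_cost M \<zeta> I u v \<sigma> x < ereal (a + e)"
        using \<open>0 < e\<close> by (auto intro: le_less_trans)
      ultimately have "J_fun M \<zeta> I u z < ereal (a + e)"
        unfolding J_fun_less_iff using \<open>\<sigma> permutes {1..M}\<close> by blast
      then show "J_fun M \<zeta> I u z \<le> ereal a + ereal e" by simp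
    qed
    then show "z \<in> {z. J_fun M \<zeta> I u z \<le> ereal a}" by simp
  qed
  have comp: "compact (?L b)" for b
    by (intro compact_UN finite_permutations ballI compact_sublevel) auto
  have level_compact: "compact {z. J_fun M \<zeta> I u z \<le> ereal a}" for a
  proof -
    have "closed (\<Inter>b\<in>{a<..}. ?L b)"
      by (intro closed_INT ballI compact_imp_closed comp)
    then have "compact (?L (a + 1) \<inter>
        (\<Inter>b\<in>{a<..}. ?L b))"
      by (rule compact_Int_closed[OF comp])
    moreover have "(\<Inter>b\<in>{a<..}. ?L b)
        \<subseteq> ?L (a + 1)"
      by (rule INT_lower) simp
    ultimately show ?thesis unfolding level by (simp add: Int_absorb1)
  qed
  show ?thesis
    unfolding good_rate_function_def
    using nonneg level_compact closed_sublevels_imp_lsc[of "J_fun M \<zeta> I u"] compact_imp_closed by blast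
qed

end

section \<open>The lower bound\<close>

text \<open>The \<open>LEAST\<close> in the definition is meaningful because the finitely many
  positive entries of \<open>P\<close> are eventually positive in \<open>Q\<close>.\<close>

lemma first_positive_index_pos:
  fixes Q :: "nat \<Rightarrow> 's::finite \<Rightarrow> 's \<Rightarrow> real"
  assumes lim: "\<And>x y. (\<lambda>n. Q n x y) \<longlonglongrightarrow> P x y"
    and "i \<in> G" "s \<in> C i" "t \<in> C i" "P s t > 0" "first_positive_index Q P C G \<le> n"
  shows "Q n s t > 0"
proof -
  have "eventually (\<lambda>n. \<forall>p\<in>UNIV. P (fst p) (snd p) > 0 \<longrightarrow> Q n (fst p) (snd p) > 0) sequentially"
  proof (rule eventually_ball_finite, simp, rule ballI)
    fix p :: "'s \<times> 's"
    show "eventually (\<lambda>n. P (fst p) (snd p) > 0 \<longrightarrow> Q n (fst p) (snd p) > 0) sequentially"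
      using order_tendstoD(1)[OF lim[of "fst p" "snd p"], of 0]
      by (cases "P (fst p) (snd p) > 0") auto
  qed
  then obtain m where m: "\<And>n s t. n \<ge> m \<Longrightarrow> P s t > 0 \<Longrightarrow> Q n s t > 0"
    by (fastforce simp: eventually_sequentially)
  have "\<exists>m. 1 \<le> m \<and> (\<forall>i\<in>G. \<forall>s\<in>C i. \<forall>t\<in>C i. P s t > 0 \<longrightarrow> (\<forall>n\<ge>m. Q n s t > 0))"
    using m by (intro exI[of _ "max 1 m"]) auto
  from LeastI_ex[OF this] show ?thesis
    using assms(2-6) unfolding first_positive_index_def by blast
qed

lemma (in prob_space) positive_state:
  fixes Y :: "'a \<Rightarrow> 's::finite"
  assumes [measurable]: "Y \<in> measurable M (count_space UNIV)"
    and "\<P>(\<omega> in M. Y \<omega> \<in> B) > 0"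
  shows "\<exists>s\<in>B. \<P>(\<omega> in M. Y \<omega> = s) > 0"
proof (rule ccontr)
  assume "\<not> ?thesis"
  then have "\<not> 0 < \<P>(\<omega> in M. Y \<omega> = s)" if "s \<in> B" for s using that by blast
  then have z: "\<P>(\<omega> in M. Y \<omega> = s) = 0" if "s \<in> B" for s
    using that by (simp only: not_less measure_le_0_iff)
  have "{\<omega> \<in> space M. Y \<omega> \<in> B} = (\<Union>s\<in>B. {\<omega> \<in> space M. Y \<omega> = s})" by auto
  then have "\<P>(\<omega> in M. Y \<omega> \<in> B) \<le> (\<Sum>s\<in>B. \<P>(\<omega> in M. Y \<omega> = s))"
    by (simp only:) (rule finite_measure_subadditive_finite, auto)
  also have "\<dots> = 0" using z by simp
  finally show False using assms(2) by simp
qed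

text \<open>Only links with nonpositive rates \<open>u\<close> enter, so that T1 and T0 become two
  instances.\<close>

lemma lower_bound:
  fixes Pn :: "nat \<Rightarrow> 's::finite \<Rightarrow> 's \<Rightarrow> real"
    and P :: "'s \<Rightarrow> 's \<Rightarrow> real"
    and \<Omega> :: "'w measure"
    and f :: "'s \<Rightarrow> real ^ 'd"
    and u :: "nat \<Rightarrow> nat \<Rightarrow> ereal"
  assumes st: "\<And>n. 1 \<le> n \<Longrightarrow> stochastic (Pn n)"
    and stP: "stochastic P"
    and lim: "\<And>x y. (\<lambda>n. Pn n x y) \<longlonglongrightarrow> P x y"
    and dec: "class_decomposition P C N M \<zeta>"
    and mc: "markov_chain \<Omega> X \<pi> Pn"
    and SIE: "condition_SIE \<Omega> X Pn P C (irreducible_indices P C (N + M))"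
    and lk: "\<And>i j. i \<in> {1..N+M} \<Longrightarrow> j \<in> {1..N+M} \<Longrightarrow> i \<noteq> j \<Longrightarrow> link Pn (C i) (C j) (u i j)"
    and u0: "\<And>i j. i \<in> {1..N+M} \<Longrightarrow> j \<in> {1..N+M} \<Longrightarrow> i \<noteq> j \<Longrightarrow> u i j \<le> 0"
    and "open U"
  shows "good_rate_function (J_fun M \<zeta> (\<lambda>i. block_rate P f (C i)) u)"
    and "- (INF z\<in>U. J_fun M \<zeta> (\<lambda>i. block_rate P f (C i)) u z)
      \<le> log_rate (\<lambda>n. \<P>(\<omega> in \<Omega>. sample_mean X f n \<omega> \<in> U))"
proof -
  define G where "G = irreducible_indices P C (N + M)"
  define I where "I = (\<lambda>i. block_rate P f (C i))"
  define r where "r = (\<lambda>i \<theta>. ln (perron_frobenius (C i) (\<lambda>s t. P s t * exp (\<theta> \<bullet> f t))))"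
  define F where "F = Max (range (\<lambda>y. norm (f y)))"
  have f_le: "norm (f y) \<le> F" for y unfolding F_def by (rule Max_ge) auto
  have F0: "0 \<le> F" using f_le norm_ge_zero order_trans by blast
  have nnP: "0 \<le> P s t" for s t using stP by (simp add: stochastic_def)
  have nn: "0 \<le> Pn n s t" if "n \<ge> 1" for n s t using st[OF that] by (simp add: stochastic_def)
  have \<zeta>: "bij_betw \<zeta> {1..M} G" and M1: "1 \<le> M"
    using dec unfolding class_decomposition_def G_def by auto
  have \<zeta>G: "\<zeta> i \<in> G" if "i \<in> {1..M}" for i using \<zeta> that bij_betwE by blast
  have \<zeta>N: "\<zeta> i \<in> {1..N+M}" if "i \<in> {1..M}" for i
    using \<zeta>G[OF that] by (auto simp: G_def irreducible_indices_def)
  have irr: "irreducible_block (C (\<zeta> i)) P" if "i \<in> {1..M}" for i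
    using \<zeta>G[OF that] by (auto simp: G_def irreducible_indices_def)
  have ne: "C (\<zeta> i) \<noteq> {}" if "i \<in> {1..M}" for i
    using class_nonempty[OF dec \<zeta>N[OF that]] .
  have inj: "inj_on \<zeta> {1..M}" using \<zeta> by (simp add: bij_betw_def)
  interpret class_rates M \<zeta> r F u I
  proof
    show "r (\<zeta> i) \<theta> \<le> F * norm \<theta>" if "i \<in> {1..M}" for i \<theta>
      unfolding r_def by (rule tilted_perron_bound(2)[OF irr[OF that] ne[OF that] stP f_le])
    show "u (\<zeta> i) (\<zeta> j) \<le> 0" if "i \<in> {1..M}" "j \<in> {1..M}" "i \<noteq> j" for i j
      using that \<zeta>N inj by (intro u0) (auto dest: inj_onD)
    show "I i x = (SUP \<theta>. ereal (\<theta> \<bullet> x - r i \<theta>))" for i x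
      by (simp add: I_def r_def block_rate_def)
  qed (use M1 F0 inj in auto)
  show "good_rate_function (J_fun M \<zeta> (\<lambda>i. block_rate P f (C i)) u)"
    using J_fun_good unfolding I_def .
  interpret prob_space \<Omega> using mc by (simp add: markov_chain_def)
  obtain n1 where n1: "n1 \<ge> first_positive_index Pn P C G - 1"
    "\<And>i. i \<in> G \<Longrightarrow> \<P>(\<omega> in \<Omega>. X n1 \<omega> \<in> C i) > 0"
    using SIE unfolding condition_SIE_def G_def by blast
  define R where "R = log_rate (\<lambda>n. \<P>(\<omega> in \<Omega>. sample_mean X f n \<omega> \<in> U))"
  have main: "- visit_cost M \<zeta> I u v \<sigma> x \<le> R"
    if z: "z \<in> U" and v: "v \<in> prob_vectors M" and x: "x \<in> mean_tuples M v z" and \<sigma>: "\<sigma> permutes {1..M}"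
    for z v x \<sigma>
  proof (cases "visit_cost M \<zeta> I u v \<sigma> x = \<infinity>")
    case False
    define B where "B i = C (\<zeta> (\<sigma> i))" for i
    define V where "V i = (\<Sum>j=1..i. v j)" for i
    define w where "w i = u (\<zeta> (\<sigma> i)) (\<zeta> (\<sigma> (i+1)))" for i
    have \<sigma>M: "\<sigma> i \<in> {1..M}" if "i \<in> {1..M}" for i using \<sigma>_in[OF \<sigma> that] .
    have v0: "0 \<le> v i" if "i \<in> {1..M}" for i using v that by (simp add: prob_vectors_def)
    have V0: "0 \<le> V i" if "i \<le> M" for i unfolding V_def using that by (intro sum_nonneg v0) auto
    have w0: "w i \<le> 0" if "i \<in> {1..M-1}" for i using u_\<sigma>[OF \<sigma> that] by (simp add: w_def)
    have Inn: "0 \<le> I (\<zeta> (\<sigma> i)) (x i)" if "i \<in> {1..M}" for i using I_nonneg[OF \<sigma>M[OF that]] .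
    have cost: "visit_cost M \<zeta> I u v \<sigma> x
        = (\<Sum>i=1..M-1. ereal (V i) * - w i) + (\<Sum>i=1..M. ereal (v i) * I (\<zeta> (\<sigma> i)) (x i))"
      using cost_eq[OF \<sigma> v] by (simp only: V_def w_def)
    have t1: "0 \<le> ereal (V i) * - w i" if "i \<in> {1..M-1}" for i
      using w0[OF that] V0[of i] that by (intro ereal_0_le_mult) auto
    have t2: "0 \<le> ereal (v i) * I (\<zeta> (\<sigma> i)) (x i)" if "i \<in> {1..M}" for i
      using v0[OF that] Inn[OF that] by (intro ereal_0_le_mult) auto
    have fin: "ereal (V i) * - w i \<noteq> \<infinity>" if "i \<in> {1..M-1}" for i
      using False that unfolding cost by (auto simp: sum_Pinfty)
    have fin2: "ereal (v i) * I (\<zeta> (\<sigma> i)) (x i) \<noteq> \<infinity>" if "i \<in> {1..M}" for i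
      using False that unfolding cost by (auto simp: sum_Pinfty)
    \<comment> \<open>These real values are faithful only where V i, respectively v i, is positive;
      elsewhere they are multiplied by 0.\<close>
    define ur where "ur i = real_of_ereal (w i)" for i
    define ir where "ir i = real_of_ereal (I (\<zeta> (\<sigma> i)) (x i))" for i
    have w_real: "w i = ereal (ur i)" if "i \<in> {1..M-1}" "0 < V i" for i
      using fin[OF that(1)] w0[OF that(1)] that(2) by (cases "w i") (auto simp: ur_def)
    have I_real: "I (\<zeta> (\<sigma> i)) (x i) = ereal (ir i)" if "i \<in> {1..M}" "0 < v i" for i
      using fin2[OF that(1)] Inn[OF that(1)] that(2) by (cases "I (\<zeta> (\<sigma> i)) (x i)") (auto simp: ir_def)
    have e1: "ereal (V i) * - w i = ereal (V i * - ur i)" if "i \<in> {1..M-1}" for i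
    proof (cases "V i = 0")
      case False
      have "i \<le> M" using that by auto
      then show ?thesis using w_real[OF that] V0[of i] False by simp
    qed (simp add: zero_ereal_def[symmetric])
    have e2: "ereal (v i) * I (\<zeta> (\<sigma> i)) (x i) = ereal (v i * ir i)" if "i \<in> {1..M}" for i
    proof (cases "v i = 0")
      case False
      then show ?thesis using I_real[OF that] v0[OF that] by auto
    qed (simp add: zero_ereal_def[symmetric])
    have "visit_cost M \<zeta> I u v \<sigma> x = (\<Sum>i=1..M-1. ereal (V i * - ur i)) + (\<Sum>i=1..M. ereal (v i * ir i))"
      unfolding cost by (intro arg_cong2[where f = "(+)"] sum.cong refl e1 e2)
    then have cost_real: "visit_cost M \<zeta> I u v \<sigma> x
        = ereal ((\<Sum>i=1..M-1. V i * - ur i) + (\<Sum>i=1..M. v i * ir i))" by simp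
    have "\<forall>i\<in>{1..M}. \<exists>b. b \<in> B i" using ne[OF \<sigma>M] unfolding B_def by blast
    then obtain b where b: "\<And>i. i \<in> {1..M} \<Longrightarrow> b i \<in> B i" by metis
    have ex: "\<exists>i. i \<in> {1..M} \<and> 0 < v i"
    proof (rule ccontr)
      assume "\<not> ?thesis"
      then have "(\<Sum>i=1..M. v i) \<le> 0" by (intro sum_nonpos) (auto simp: not_less)
      then show False using v by (simp add: prob_vectors_def)
    qed
    \<comment> \<open>The connections before \<open>k0\<close> have weight 0 and possibly rate
      -\<infinity>; starting in class \<open>k0\<close> avoids them, while all later ones have
      finite rate by \<open>V_pos\<close>.\<close>
    define k0 where "k0 = (LEAST i. i \<in> {1..M} \<and> 0 < v i)"
    have k0: "k0 \<in> {1..M}" "0 < v k0" using LeastI_ex[OF ex] unfolding k0_def by auto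
    have before: "v j = 0" if "j \<in> {1..<k0}" for j
    proof -
      have "\<not> (j \<in> {1..M} \<and> 0 < v j)" using that unfolding k0_def by (intro not_less_Least) simp
      then show ?thesis using v0[of j] that k0(1) by auto
    qed
    have V_pos: "0 < V i" if "k0 \<le> i" "i \<le> M" for i
      unfolding V_def using that k0 v0 by (intro sum_pos2[of _ k0]) auto
    have "\<P>(\<omega> in \<Omega>. X n1 \<omega> \<in> B k0) > 0"
      unfolding B_def using n1(2)[OF \<zeta>G[OF \<sigma>M[OF k0(1)]]] .
    then obtain s0 where s0: "s0 \<in> B k0" "\<P>(\<omega> in \<Omega>. X n1 \<omega> = s0) > 0"
      using positive_state[of "X n1" "B k0"] mc by (auto simp: markov_chain_def)
    \<comment> \<open>State of the construction: class \<open>i\<close> has been entered and the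
      shares of the classes before \<open>j\<close> are spent. Thus \<open>cor i i\<close> is on
      entry to class \<open>i\<close> and \<open>cor i (Suc i)\<close> just before leaving
      it.\<close>
    define cor where "cor i j = corridor Pn f n1 s0 (b i) (\<Sum>l\<in>{1..<j}. v l) (\<Sum>l\<in>{1..<j}. v l *\<^sub>R x l)
      ((\<Sum>l\<in>{1..<i}. V l * - ur l) + (\<Sum>l\<in>{1..<j}. v l * ir l))" for i j
    have enter: "cor k0 k0"
    proof -
      have "corridor Pn f n1 s0 (b k0) 0 0 0"
      proof (rule corridor_start[where F = F, OF irr[OF \<sigma>M[OF k0(1)]] nnP])
        show "s0 \<in> C (\<zeta> (\<sigma> k0))" "b k0 \<in> C (\<zeta> (\<sigma> k0))"
          using s0(1) b[OF k0(1)] by (auto simp: B_def)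
        fix n s t assume "n1 < n" "s \<in> C (\<zeta> (\<sigma> k0))" "t \<in> C (\<zeta> (\<sigma> k0))" "0 < P s t"
        then show "0 < Pn n s t"
          using n1(1) by (intro first_positive_index_pos[OF lim \<zeta>G[OF \<sigma>M[OF k0(1)]]]) auto
      qed (rule f_le)
      moreover have "V l = 0" if "l \<in> {1..<k0}" for l
        unfolding V_def using that by (intro sum.neutral ballI before) auto
      ultimately show ?thesis unfolding cor_def using before by (simp add: sum.neutral)
    qed
    \<comment> \<open>With v i = 0 nothing is appended, since x i may then have infinite rate and no
      loops near it.\<close>
    have stay: "cor i (Suc i)" if i: "i \<in> {1..M}" and c: "cor i i" for i
    proof (cases "v i = 0")
      case True
      then show ?thesis using c i unfolding cor_def by (simp add: sum.atLeastLessThan_Suc)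
    next
      case False
      then have "0 < v i" using v0[OF i] by simp
      have rate: "\<theta> \<bullet> x i - ln (perron_frobenius (C (\<zeta> (\<sigma> i))) (\<lambda>s t. P s t * exp (\<theta> \<bullet> f t))) \<le> ir i" for \<theta>
        using I_ge[of \<theta> "x i" "\<zeta> (\<sigma> i)"] unfolding I_real[OF i \<open>0 < v i\<close>] r_def by simp
      have "corridor Pn f n1 s0 (b i) ((\<Sum>l\<in>{1..<i}. v l) + v i)
          ((\<Sum>l\<in>{1..<i}. v l *\<^sub>R x l) + v i *\<^sub>R x i)
          (((\<Sum>l\<in>{1..<i}. V l * - ur l) + (\<Sum>l\<in>{1..<i}. v l * ir l)) + v i * ir i)"
        by (rule corridor_block[OF nn irr[OF \<sigma>M[OF i]] _ stP lim rate v0[OF i] c[unfolded cor_def]])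
          (use b[OF i] in \<open>simp_all add: B_def\<close>)
      then show ?thesis using i unfolding cor_def by (simp add: sum.atLeastLessThan_Suc algebra_simps)
    qed
    \<comment> \<open>Here k0 \<le> i makes V i positive, so finiteness of the cost turns the rate
      of the connection into a real number.\<close>
    have move: "cor (Suc i) (Suc i)" if i: "k0 \<le> i" "Suc i \<le> M" and c: "cor i (Suc i)" for i
    proof -
      have i1: "i \<in> {1..M-1}" "i \<in> {1..M}" "Suc i \<in> {1..M}" using i k0(1) by auto
      have V: "V i = (\<Sum>l\<in>{1..<Suc i}. v l)" unfolding V_def by (intro sum.cong) auto
      have "\<sigma> i \<noteq> \<sigma> (i+1)" using permutes_inj[OF \<sigma>] by (simp add: inj_eq)
      then have "\<zeta> (\<sigma> i) \<noteq> \<zeta> (\<sigma> (i+1))"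
        using inj_onD[OF inj _ \<sigma>M[OF i1(2)] \<sigma>M[OF i1(3)]] by auto
      then have "link Pn (B i) (B (Suc i)) (w i)"
        unfolding B_def w_def using lk[OF \<zeta>N[OF \<sigma>M[OF i1(2)]] \<zeta>N[OF \<sigma>M[OF i1(3)]]] by simp
      then have l: "link Pn (B i) (B (Suc i)) (ereal (ur i))"
        using w_real[OF i1(1)] V_pos[of i] i by simp
      have "corridor Pn f n1 s0 (b (Suc i)) (\<Sum>l\<in>{1..<Suc i}. v l) (\<Sum>l\<in>{1..<Suc i}. v l *\<^sub>R x l)
          (((\<Sum>l\<in>{1..<i}. V l * - ur l) + (\<Sum>l\<in>{1..<Suc i}. v l * ir l)) - (\<Sum>l\<in>{1..<Suc i}. v l) * ur i)"
        by (rule corridor_link[OF nn f_le l b[OF i1(2)] b[OF i1(3)] _ c[unfolded cor_def]])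
          (use V0[of i] i V in auto)
      moreover have "(\<Sum>l\<in>{1..<i}. V l * - ur l) - V i * ur i = (\<Sum>l\<in>{1..<Suc i}. V l * - ur l)"
        using i1 by (simp add: sum.atLeastLessThan_Suc)
      ultimately show ?thesis unfolding cor_def V[symmetric]
        by (simp only: diff_add_eq[symmetric])
    qed
    have "cor i (Suc i)" if "k0 \<le> i" "i \<le> M" for i
      using that
    proof (induction i rule: dec_induct)
      case base
      then show ?case using stay[OF k0(1) enter] by simp
    next
      case (step i)
      then have "cor (Suc i) (Suc i)" by (intro move) auto
      then show ?case using step k0(1) by (intro stay) auto
    qed
    then have "cor M (Suc M)" using k0(1) by simp
    moreover have "(\<Sum>l\<in>{1..<Suc M}. v l) = 1"
      using v by (simp only: atLeastLessThanSuc_atLeastAtMost) (simp add: prob_vectors_def)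
    moreover have "(\<Sum>l\<in>{1..<Suc M}. v l *\<^sub>R x l) = z"
      using x by (simp only: atLeastLessThanSuc_atLeastAtMost) (simp add: mean_tuples_def)
    moreover have "{1..<M} = {1..M-1}" using M1 by auto
    ultimately have fc: "corridor Pn f n1 s0 (b M) 1 z
        ((\<Sum>i=1..M-1. V i * - ur i) + (\<Sum>i=1..M. v i * ir i))"
      unfolding cor_def by (simp only: atLeastLessThanSuc_atLeastAtMost)
    have "ereal (- ((\<Sum>i=1..M-1. V i * - ur i) + (\<Sum>i=1..M. v i * ir i))) \<le> R"
      unfolding R_def by (rule corridor_log_rate[OF mc f_le fc s0(2) \<open>open U\<close> z])
    then show ?thesis unfolding cost_real by simp
  qed simp
  have "- R \<le> (INF z\<in>U. J_fun M \<zeta> I u z)"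
  proof (rule INF_greatest)
    fix z assume z: "z \<in> U"
    show "- R \<le> J_fun M \<zeta> I u z"
    proof (rule ccontr)
      assume "\<not> - R \<le> J_fun M \<zeta> I u z"
      then have "J_fun M \<zeta> I u z < - R" by simp
      then obtain v x \<sigma> where "v \<in> prob_vectors M" "x \<in> mean_tuples M v z" "\<sigma> permutes {1..M}"
        and lt: "visit_cost M \<zeta> I u v \<sigma> x < - R"
        unfolding J_fun_less_iff by blast
      with main[OF z] have "- visit_cost M \<zeta> I u v \<sigma> x \<le> R" by blast
      then have "- R \<le> visit_cost M \<zeta> I u v \<sigma> x" by (simp add: ereal_uminus_le_reorder)
      then show False using lt by simp
    qed
  qed
  then show "- (INF z\<in>U. J_fun M \<zeta> (\<lambda>i. block_rate P f (C i)) u z)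
      \<le> log_rate (\<lambda>n. \<P>(\<omega> in \<Omega>. sample_mean X f n \<omega> \<in> U))"
    unfolding R_def[symmetric] I_def by (simp add: ereal_uminus_le_reorder)
qed

theorem theorem3p2:
  fixes Pn :: "nat \<Rightarrow> 's::finite \<Rightarrow> 's \<Rightarrow> real"
    and P :: "'s \<Rightarrow> 's \<Rightarrow> real"
    and \<pi> :: "'s pmf"
    and \<Omega> :: "'w measure"
    and X :: "nat \<Rightarrow> 'w \<Rightarrow> 's"
    and f :: "'s \<Rightarrow> real ^ 'd"
    and C :: "nat \<Rightarrow> 's set"
    and N M :: nat
    and \<zeta> :: "nat \<Rightarrow> nat"
    and \<Gamma> :: "(real ^ 'd) set"
  defines "G \<equiv> irreducible_indices P C (N + M)"
    and "J \<equiv> J_fun M \<zeta> (\<lambda>i. block_rate P f (C i))"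
  assumes stochastic_Pn: "\<And>n. 1 \<le> n \<Longrightarrow> stochastic (Pn n)"
    and stochastic_P: "stochastic P"
    and Pn_limit: "\<And>x y. (\<lambda>n. Pn n x y) \<longlonglongrightarrow> P x y"
    and decomposition: "class_decomposition P C N M \<zeta>"
    and chain: "markov_chain \<Omega> X \<pi> Pn"
    and SIE: "condition_SIE \<Omega> X Pn P C G"
    and borel: "\<Gamma> \<in> sets borel"
  shows
    "(good_rate_function (J (T1_cost Pn C N M)) \<and>
      - (INF z\<in>interior \<Gamma>. J (T1_cost Pn C N M) z)
        \<le> log_rate (\<lambda>n. \<P>(\<omega> in \<Omega>. sample_mean X f n \<omega> \<in> interior \<Gamma>)))
     \<and>
     (assumption_B Pn C (N + M) \<or> assumption_C Pn P C G \<longrightarrow>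
       good_rate_function (J (T0_cost Pn C N M)) \<and>
       - (INF z\<in>interior \<Gamma>. J (T0_cost Pn C N M) z)
        \<le> log_rate (\<lambda>n. \<P>(\<omega> in \<Omega>. sample_mean X f n \<omega> \<in> interior \<Gamma>)))"
proof -
  have ne: "C l \<noteq> {}" if "l \<in> {1..N+M}" for l by (rule class_nonempty[OF decomposition that])
  have M1: "1 \<le> M" using decomposition by (simp add: class_decomposition_def)
  have T1: "link Pn (C i) (C j) (T1_cost Pn C N M i j)" "T1_cost Pn C N M i j \<le> 0"
    if "i \<in> {1..N+M}" "j \<in> {1..N+M}" "i \<noteq> j" for i j
    using T1_cost_link[where C = C, OF that M1 ne] T1_cost_nonpos[where C = C, OF that M1 ne stochastic_Pn]
    by auto
  have T0: "T0_cost Pn C N M i j \<le> 0" if "i \<in> {1..N+M}" "j \<in> {1..N+M}" "i \<noteq> j" for i j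
    using T0_cost_nonpos[where C = C, OF that ne stochastic_Pn] by auto
  have T0_link: "link Pn (C i) (C j) (T0_cost Pn C N M i j)"
    if BC: "assumption_B Pn C (N + M) \<or> assumption_C Pn P C G"
      and "i \<in> {1..N+M}" "j \<in> {1..N+M}" "i \<noteq> j" for i j
  proof (rule T0_cost_link[where C = C, OF that(2-4) ne stochastic_Pn])
    fix k l assume kl: "k \<in> {1..N+M}" "l \<in> {1..N+M}" "k \<noteq> l"
    from BC show "link Pn (C k) (C l) (tau Pn C k l)"
    proof
      assume "assumption_B Pn C (N + M)"
      from assumption_B_link[where Q = Pn and P = P, OF decomposition _ stochastic_P Pn_limit this kl]
      show ?thesis using stochastic_Pn by blast
    next
      assume "assumption_C Pn P C G"
      from assumption_C_link[where Q = Pn and P = P, OF decomposition _ stochastic_P Pn_limit this[unfolded G_def] kl]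
      show ?thesis using stochastic_Pn by blast
    qed
  qed auto
  note bound = lower_bound[where f = f, OF stochastic_Pn stochastic_P Pn_limit decomposition chain
      SIE[unfolded G_def] _ _ open_interior[of \<Gamma>]]
  have "good_rate_function (J (T1_cost Pn C N M))"
    "- (INF z\<in>interior \<Gamma>. J (T1_cost Pn C N M) z)
      \<le> log_rate (\<lambda>n. \<P>(\<omega> in \<Omega>. sample_mean X f n \<omega> \<in> interior \<Gamma>))"
    unfolding J_def by (rule bound; use T1 in simp)+
  moreover have "good_rate_function (J (T0_cost Pn C N M))"
    "- (INF z\<in>interior \<Gamma>. J (T0_cost Pn C N M) z)
      \<le> log_rate (\<lambda>n. \<P>(\<omega> in \<Omega>. sample_mean X f n \<omega> \<in> interior \<Gamma>))"
    if "assumption_B Pn C (N + M) \<or> assumption_C Pn P C G"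
    unfolding J_def by (rule bound; use T0 T0_link[OF that] in simp)+
  ultimately show ?thesis by blast
qed

end
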